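(* Let $(R,\mathfrak m)$ be a Noetherian local ring of dimension $d>0$, let $r\ge2$ be an integer, and let $I_1,\dots,I_r$ be $\mathfrak m$-primary ideals of $R$ such that $I_1,\dots,I_{r-1}\subset I_r$ (that is, $I_r$ is the largest ideal). Then $$e^{r-2}(R/I_1\oplus\dots\oplus R/I_r)=e(R/[I_1+\dots+I_{r-1}]\oplus R/I_r).$$ In particular, if $I_1\subset I_2\subset\dots\subset I_r$, then $$e^{r-2}(R/I_1\oplus\dots\oplus R/I_r)=e(R/I_{r-1}\oplus R/I_r).$$
   Context: $\ell_R$ denotes length of an $R$-module. Let $C$ be an $R$-module of finite length with minimal free presentation $R^n\xrightarrow{\varphi}F=R^r\to C\to 0$. Let $S=\mathrm{Sym}_R(F)$ with degree-$p$ component $S_p$, and let $R[M]=\mathrm{Im}(\mathrm{Sym}_R(\varphi))\subset S$ with degree-$p$ component $M^p$. For $C=R/I_1\oplus\dots\oplus R/I_r$ with $I_i$ $\mathfrak m$-primary, this means $S=R[t_1,\dots,t_r]$ (standard grading) and $R[M]=R[I_1t_1,\dots,I_rt_r]$. The Buchsbaum-Rim function of two variables of $C$ is $\Lambda(p,q)=\ell_R(S_{p+q}/M^pS_q)$. For $p,q\gg0$ it agrees with a polynomial of total degree $d+r-1$ (known fact). The associated Buchsbaum-Rim multiplicities are, for $j=0,1,\dots,d+r-1$, $$e^j(C):=(\text{coefficient of }p^{d+r-1-j}q^j\text{ in this polynomial})\cdot(d+r-1-j)!\,j!.$$ The ordinary Buchsbaum-Rim function of $C$ is $\lambda_C(p)=\ell_R(S_p/M^p)$;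 for $p\gg0$ it agrees with a polynomial of degree $d+r-1$, and the ordinary Buchsbaum-Rim multiplicity $e(C)$ is $(d+r-1)!$ times its leading coefficient. (Here $r$ is the rank of the free module $F$ in the minimal presentation of the module in question; thus for a sum of two cyclic modules $R/K_1\oplus R/K_2$ one uses $S=R[t_1,t_2]$ and degree $d+1$.) *)

theory Defs
  imports
    "HOL-Library.Poly_Mapping"
    "HOL-Library.Extended_Nat"
    "HOL-Computational_Algebra.Polynomial"
begin

text \<open>The base ring is a type of class \<open>comm_ring_1\<close>; its ideals are the subspaces of the ring as
  a module over itself.\<close>

interpretation self_module: module "(*) :: 'a::comm_ring_1 \<Rightarrow> 'a \<Rightarrow> 'a"
  by unfold_locales (simp_all add: algebra_simps)

abbreviation is_ideal :: "'a::comm_ring_1 set \<Rightarrow> bool" where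
  "is_ideal \<equiv> module.subspace (*)"

abbreviation ideal_gen :: "'a::comm_ring_1 set \<Rightarrow> 'a set" where
  "ideal_gen \<equiv> module.span (*)"

definition prime_ideal :: "'a::comm_ring_1 set \<Rightarrow> bool" where
  "prime_ideal P \<longleftrightarrow> is_ideal P \<and> P \<noteq> UNIV \<and> (\<forall>a b. a * b \<in> P \<longrightarrow> a \<in> P \<or> b \<in> P)"

definition maximal_ideal :: "'a::comm_ring_1 set \<Rightarrow> bool" where
  "maximal_ideal m \<longleftrightarrow> is_ideal m \<and> m \<noteq> UNIV \<and> (\<forall>J. is_ideal J \<and> m \<subseteq> J \<longrightarrow> J = m \<or> J = UNIV)"

definition noetherian_local_ring :: "'a::comm_ring_1 set \<Rightarrow> bool" where
  "noetherian_local_ring m \<longleftrightarrow>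
     (\<forall>J :: 'a set. is_ideal J \<longrightarrow> (\<exists>A. finite A \<and> J = ideal_gen A)) \<and>
     maximal_ideal m \<and> (\<forall>m'. maximal_ideal m' \<longrightarrow> m' = m)"

definition krull_dim :: "'a::comm_ring_1 itself \<Rightarrow> enat" where
  "krull_dim _ = (SUP n \<in> {n. \<exists>P :: nat \<Rightarrow> 'a set.
     (\<forall>i\<le>n. prime_ideal (P i)) \<and> (\<forall>i<n. P i \<subset> P (Suc i))}. enat n)"

definition radical :: "'a::comm_ring_1 set \<Rightarrow> 'a set" where
  "radical J = {a. \<exists>n. a ^ n \<in> J}"

definition primary_ideal_of :: "'a::comm_ring_1 set \<Rightarrow> 'a set \<Rightarrow> bool" where
  "primary_ideal_of m J \<longleftrightarrow> is_ideal J \<and> J \<noteq> UNIV \<and>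
     (\<forall>a b. a * b \<in> J \<longrightarrow> a \<in> J \<or> (\<exists>n. b ^ n \<in> J)) \<and> radical J = m"

text \<open>Polynomials in variables \<open>t\<^sub>i\<close> indexed by \<open>nat\<close>: a monomial is its finitely supported
  exponent vector. The polynomial ring \<open>R[t\<^sub>1,\<dots>,t\<^sub>r]\<close> is the part involving only the variables with
  index in \<open>{1..r}\<close>.\<close>

type_synonym 'a mpoly = "(nat \<Rightarrow>\<^sub>0 nat) \<Rightarrow>\<^sub>0 'a"

definition mscale :: "'a::comm_ring_1 \<Rightarrow> 'a mpoly \<Rightarrow> 'a mpoly" where
  "mscale c f = Poly_Mapping.single 0 c * f"

interpretation mpoly_module: module "mscale :: 'a::comm_ring_1 \<Rightarrow> 'a mpoly \<Rightarrow> 'a mpoly"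
  by unfold_locales
    (simp_all add: mscale_def distrib_left distrib_right single_add mult_single flip: mult.assoc)

abbreviation is_submodule :: "'a::comm_ring_1 mpoly set \<Rightarrow> bool" where
  "is_submodule \<equiv> module.subspace mscale"

text \<open>The degree-\<open>p\<close> component \<open>S\<^sub>p\<close> of \<open>S = R[t\<^sub>1,\<dots>,t\<^sub>r]\<close>; in particular \<open>sym_comp r 1\<close> is the
  free module \<open>F = R\<^sup>r\<close>.\<close>

definition sym_comp :: "nat \<Rightarrow> nat \<Rightarrow> 'a::comm_ring_1 mpoly set" where
  "sym_comp r p = {f. \<forall>u \<in> Poly_Mapping.keys f.
     Poly_Mapping.keys u \<subseteq> {1..r} \<and> (\<Sum>i\<in>Poly_Mapping.keys u. Poly_Mapping.lookup u i) = p}"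

text \<open>Below, \<open>M\<close> is a submodule of \<open>F = sym_comp r 1\<close>, the image of a minimal presentation
  \<open>R\<^sup>n \<rightarrow> F \<rightarrow> C \<rightarrow> 0\<close> of \<open>C = F/M\<close>; minimality means that \<open>M\<close> is contained in the maximal ideal
  times \<open>F\<close>. The image of \<open>Sym(R\<^sup>n) \<rightarrow> Sym(F)\<close> is the \<open>R\<close>-subalgebra \<open>R[M]\<close> generated by \<open>M\<close>.\<close>

inductive_set rees_algebra :: "'a::comm_ring_1 mpoly set \<Rightarrow> 'a mpoly set" for M where
  const: "Poly_Mapping.single 0 c \<in> rees_algebra M"
| gen: "f \<in> M \<Longrightarrow> f \<in> rees_algebra M"
| add: "f \<in> rees_algebra M \<Longrightarrow> g \<in> rees_algebra M \<Longrightarrow> f + g \<in> rees_algebra M"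
| mult: "f \<in> rees_algebra M \<Longrightarrow> g \<in> rees_algebra M \<Longrightarrow> f * g \<in> rees_algebra M"

definition rees_comp :: "nat \<Rightarrow> 'a::comm_ring_1 mpoly set \<Rightarrow> nat \<Rightarrow> 'a mpoly set" where
  "rees_comp r M p = rees_algebra M \<inter> sym_comp r p"

text \<open>The length of \<open>A/B\<close>, for submodules \<open>B \<subseteq> A\<close>: the submodules of \<open>A/B\<close> are the submodules
  between \<open>B\<close> and \<open>A\<close>.\<close>

definition quot_length :: "'a::comm_ring_1 mpoly set \<Rightarrow> 'a mpoly set \<Rightarrow> enat" where
  "quot_length A B = (SUP n \<in> {n. \<exists>N :: nat \<Rightarrow> 'a mpoly set.
     (\<forall>i\<le>n. is_submodule (N i)) \<and> N 0 = B \<and> N n = A \<and> (\<forall>i<n. N i \<subset> N (Suc i))}. enat n)"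

definition br_fun2 :: "nat \<Rightarrow> 'a::comm_ring_1 mpoly set \<Rightarrow> nat \<Rightarrow> nat \<Rightarrow> enat" where
  "br_fun2 r M p q = quot_length (sym_comp r (p + q))
     (module.span mscale {f * g | f g. f \<in> rees_comp r M p \<and> g \<in> sym_comp r q})"

definition br_fun :: "nat \<Rightarrow> 'a::comm_ring_1 mpoly set \<Rightarrow> nat \<Rightarrow> enat" where
  "br_fun r M p = quot_length (sym_comp r p) (rees_comp r M p)"

text \<open>Polynomials in \<open>p, q\<close> are elements of \<open>\<rat>[p][q]\<close>: the coefficient of \<open>p\<^sup>i q\<^sup>j\<close> in \<open>H\<close> is
  \<open>coeff (coeff H j) i\<close>.\<close>

definition br_poly2 :: "nat \<Rightarrow> 'a::comm_ring_1 mpoly set \<Rightarrow> rat poly poly" where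
  "br_poly2 r M = (THE H. \<exists>N. \<forall>p\<ge>N. \<forall>q\<ge>N. \<exists>k. br_fun2 r M p q = enat k \<and>
     poly (poly H [:of_nat q:]) (of_nat p) = of_nat k)"

definition br_poly :: "nat \<Rightarrow> 'a::comm_ring_1 mpoly set \<Rightarrow> rat poly" where
  "br_poly r M = (THE H. \<exists>N. \<forall>p\<ge>N. \<exists>k. br_fun r M p = enat k \<and> poly H (of_nat p) = of_nat k)"

text \<open>The multiplicities \<open>e\<^sup>j(C)\<close> (for \<open>j \<le> d + r - 1\<close>) and \<open>e(C)\<close> of \<open>C = F/M\<close>, where \<open>d\<close> is the
  dimension of the base ring.\<close>

definition br_mult_assoc :: "nat \<Rightarrow> nat \<Rightarrow> 'a::comm_ring_1 mpoly set \<Rightarrow> rat" where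
  "br_mult_assoc j r M = (let d = the_enat (krull_dim TYPE('a)) in
     coeff (coeff (br_poly2 r M) j) (d + r - 1 - j) * fact (d + r - 1 - j) * fact j)"

definition br_mult :: "nat \<Rightarrow> 'a::comm_ring_1 mpoly set \<Rightarrow> rat" where
  "br_mult r M = (let d = the_enat (krull_dim TYPE('a)) in
     fact (d + r - 1) * lead_coeff (br_poly r M))"

text \<open>The submodule \<open>I\<^sub>1t\<^sub>1 \<oplus> \<dots> \<oplus> I\<^sub>rt\<^sub>r\<close> of \<open>F\<close>, which presents \<open>R/I\<^sub>1 \<oplus> \<dots> \<oplus> R/I\<^sub>r\<close>; the
  presentation is minimal if all \<open>I\<^sub>i\<close> are proper ideals of a local ring.\<close>

definition cyclic_sum :: "nat \<Rightarrow> (nat \<Rightarrow> 'a::comm_ring_1 set) \<Rightarrow> 'a mpoly set" where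
  "cyclic_sum r I = {f \<in> sym_comp r 1.
     \<forall>i\<in>{1..r}. Poly_Mapping.lookup f (Poly_Mapping.single i 1) \<in> I i}"

end

(*
Everything is graded by monomials, so for M = I_1 t_1 + ... + I_r t_r the Buchsbaum-Rim function is
Lambda(p,q) = sum over |u| = p+q of the colength of J(p,u), the sum of the I^n with n <= u, |n| = p.

If I_r contains the other ideals and J' = I_1 + ... + I_(r-1), then J(p,u) = I_r^p when u_r >= p, and
J(p,u) = J'^a I_r^(p-a) when u_r = p - a and all other exponents are at least a. For fixed p and
q -> infinity only O(q^(r-3)) monomials are not of one of these kinds, so the coefficient of q^(r-1)
is A(p)/(r-1)! and that of q^(r-2) is lambda(p)/(r-2)! + const * A(p), where A(p) is the colength of
I_r^p and lambda is the ordinary Buchsbaum-Rim function of R/J' + R/I_r. Since A has degree at most d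
in p, comparing the coefficients of p^(d+1) gives the theorem, provided that Lambda is eventually a
polynomial and that lambda has degree exactly d + 1.

The first point is the Hilbert-Serre theorem for the layers M^p S_q / M^(p+1) S_(q-1), summed along
antidiagonals. The second is the dimension theorem. Writing chi_P(n) for the colength of P + m^n,
the upper bound is a Noetherian induction, with chi_P(n) <= chi_P(n-1) + chi_(P+x)(n) for P prime and
x in m outside P; the lower bound follows from chi_P(n) >= chi_P(n-c) + chi_(P+x)(n) (Artin-Rees).
*)
theory Submission
  imports Defs "HOL-Library.Product_Plus"
begin


section \<open>Lengths of intervals\<close>

text \<open>Quotient modules are never formed. An interval of ideals, or of families of ideals
  indexed by degree, stands for the quotient of its endpoints; the adjunction between multiplication
  by an element and the ideal quotient by it, together with the modular law, does the work of exact
  sequences. The layers are needed because the modules S_(p+q)/M^p S_q do not form a finitely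
  generated bigraded module: products with M land in m S_p, so S_p/M^p needs new generators for
  every p > 0. Summing the layers back runs through small p, where the joint polynomial is not yet
  valid, so each row and each column has to be eventually polynomial as well. That lambda is
  eventually a polynomial is a by-product: the two top coefficients of Lambda in q determine A(p)
  and lambda(p). Its degree must be known exactly because e is defined by a leading coefficient and
  e^(r-2) by a coefficient at a fixed place.\<close>

abbreviation chain_step :: "'b::order set \<Rightarrow> 'b \<Rightarrow> 'b \<Rightarrow> bool" where
  "chain_step L \<equiv> \<lambda>a b. a \<in> L \<and> b \<in> L \<and> a < b"

text \<open>The carrier \<open>L\<close> is a parameter because the same notion measures intervals
  of ideals, which form a type, and intervals of submodules of a polynomial ring, which are only a
  set of sets. If there is no chain at all, the supremum is 0.\<close>

definition clen :: "'b::order set \<Rightarrow> 'b \<Rightarrow> 'b \<Rightarrow> enat" where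
  "clen L x y = (SUP n \<in> {n. (chain_step L ^^ n) x y}. enat n)"

abbreviation len :: "'b::order \<Rightarrow> 'b \<Rightarrow> enat" where
  "len \<equiv> clen UNIV"

lemma clen_upper: "(chain_step L ^^ n) x y \<Longrightarrow> enat n \<le> clen L x y"
  unfolding clen_def by (rule SUP_upper) simp

lemma clen_least: "(\<And>n. (chain_step L ^^ n) x y \<Longrightarrow> enat n \<le> B) \<Longrightarrow> clen L x y \<le> B"
  unfolding clen_def by (rule SUP_least) simp

lemma chain_one: "chain_step L x y \<Longrightarrow> (chain_step L ^^ Suc 0) x y"
  by auto

lemma chain_le: "(chain_step L ^^ n) x y \<Longrightarrow> x \<le> y"
  by (induction n arbitrary: y) force+

lemma chain_map:
  assumes "(chain_step L ^^ n) x y"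
    and "\<And>a b. a \<in> L \<Longrightarrow> b \<in> L \<Longrightarrow> x \<le> a \<Longrightarrow> a < b \<Longrightarrow> b \<le> y \<Longrightarrow> chain_step L' (f a) (f b)"
  shows "(chain_step L' ^^ n) (f x) (f y)"
  using assms
proof (induction n arbitrary: y)
  case (Suc n)
  from Suc.prems(1) obtain z where z: "(chain_step L ^^ n) x z" "chain_step L z y"
    by auto
  have "(chain_step L' ^^ n) (f x) (f z)"
    using z Suc.prems(2) by (intro Suc.IH) (auto intro: order.trans)
  moreover have "chain_step L' (f z) (f y)"
    using Suc.prems(2)[of z y] z chain_le[OF z(1)] by auto
  ultimately show ?case by auto
qed simp

lemma clen_map:
  assumes "\<And>a b. a \<in> L \<Longrightarrow> b \<in> L \<Longrightarrow> x \<le> a \<Longrightarrow> a < b \<Longrightarrow> b \<le> y \<Longrightarrow> chain_step L' (f a) (f b)"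
    and "f x = x'" "f y = y'"
  shows "clen L x y \<le> clen L' x' y'"
proof (rule clen_least)
  fix n assume "(chain_step L ^^ n) x y"
  from chain_map[OF this, where L' = L' and f = f] assms show "enat n \<le> clen L' x' y'"
    by (intro clen_upper) auto
qed

text \<open>Every step moves at least one of the images under \<open>f\<close> and \<open>g\<close>,
  so after the repetitions are removed from both image chains at least \<open>n\<close> steps remain
  altogether.\<close>

lemma chain_split:
  assumes "(chain_step L ^^ n) x y"
    and "\<And>a b. a \<in> L \<Longrightarrow> b \<in> L \<Longrightarrow> x \<le> a \<Longrightarrow> a < b \<Longrightarrow> b \<le> y \<Longrightarrow>
      f a \<in> L1 \<and> f b \<in> L1 \<and> g a \<in> L2 \<and> g b \<in> L2 \<and> f a \<le> f b \<and> g a \<le> g b \<and> (f a \<noteq> f b \<or> g a \<noteq> g b)"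
  shows "\<exists>n1 n2. n \<le> n1 + n2 \<and> (chain_step L1 ^^ n1) (f x) (f y) \<and> (chain_step L2 ^^ n2) (g x) (g y)"
  using assms
proof (induction n arbitrary: y)
  case 0
  then show ?case by (intro exI[of _ 0]) auto
next
  case (Suc n)
  from Suc.prems(1) obtain z where z: "(chain_step L ^^ n) x z" "chain_step L z y"
    by auto
  have "\<exists>n1 n2. n \<le> n1 + n2 \<and> (chain_step L1 ^^ n1) (f x) (f z) \<and> (chain_step L2 ^^ n2) (g x) (g z)"
    using z Suc.prems(2) by (intro Suc.IH) (auto intro: order.trans)
  then obtain n1 n2 where n: "n \<le> n1 + n2"
    "(chain_step L1 ^^ n1) (f x) (f z)" "(chain_step L2 ^^ n2) (g x) (g z)" by blast
  have s: "f z \<in> L1 \<and> f y \<in> L1 \<and> g z \<in> L2 \<and> g y \<in> L2 \<and> f z \<le> f y \<and> g z \<le> g y \<and> (f z \<noteq> f y \<or> g z \<noteq> g y)"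
    using Suc.prems(2)[of z y] z chain_le[OF z(1)] by auto
  have f: "(chain_step L1 ^^ Suc n1) (f x) (f y)" if "f z \<noteq> f y" using s n that by auto
  have g: "(chain_step L2 ^^ Suc n2) (g x) (g y)" if "g z \<noteq> g y" using s n that by auto
  show ?case
  proof (cases "f z = f y")
    case True
    then have "g z \<noteq> g y" using s by blast
    with g n True show ?thesis by (intro exI[of _ n1] exI[of _ "Suc n2"]) simp
  next
    case F: False
    show ?thesis
    proof (cases "g z = g y")
      case True
      with f[OF F] n show ?thesis by (intro exI[of _ "Suc n1"] exI[of _ n2]) simp
    next
      case False
      from f[OF F] g[OF False] n show ?thesis
        by (intro exI[of _ "Suc n1"] exI[of _ "Suc n2"]) simp
    qed
  qed
qed

lemma clen_split:
  assumes "\<And>a b. a \<in> L \<Longrightarrow> b \<in> L \<Longrightarrow> x \<le> a \<Longrightarrow> a < b \<Longrightarrow> b \<le> y \<Longrightarrow>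
      f a \<in> L1 \<and> f b \<in> L1 \<and> g a \<in> L2 \<and> g b \<in> L2 \<and> f a \<le> f b \<and> g a \<le> g b \<and> (f a \<noteq> f b \<or> g a \<noteq> g b)"
    and "f x = x1" "f y = y1" "g x = x2" "g y = y2"
  shows "clen L x y \<le> clen L1 x1 y1 + clen L2 x2 y2"
proof (rule clen_least)
  fix n assume "(chain_step L ^^ n) x y"
  from chain_split[OF this, where f = f and ?L1.0 = L1 and g = g and ?L2.0 = L2] assms obtain n1 n2
    where n: "n \<le> n1 + n2" "(chain_step L1 ^^ n1) x1 y1" "(chain_step L2 ^^ n2) x2 y2"
    by auto
  have "enat n \<le> enat n1 + enat n2" using n(1) by simp
  also have "\<dots> \<le> clen L1 x1 y1 + clen L2 x2 y2"
    using n by (intro add_mono clen_upper)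
  finally show "enat n \<le> clen L1 x1 y1 + clen L2 x2 y2" .
qed

lemma clen_refl [simp]: "clen L x x = 0"
proof -
  have "clen L x x \<le> 0"
  proof (rule clen_least)
    fix n assume a: "(chain_step L ^^ n) x x"
    have "n = 0"
    proof (rule ccontr)
      assume "n \<noteq> 0"
      then obtain k where "n = Suc k" by (cases n) auto
      with a obtain z where "(chain_step L ^^ k) x z" "chain_step L z x" by auto
      with chain_le[of k L x z] show False by auto
    qed
    then show "enat n \<le> 0" by (simp add: zero_enat_def)
  qed
  then show ?thesis by simp
qed

lemma clen_ge_1: "x \<in> L \<Longrightarrow> y \<in> L \<Longrightarrow> x < y \<Longrightarrow> 1 \<le> clen L x y"
  using clen_upper[OF chain_one[where L = L and x = x and y = y]] by (auto simp: one_enat_def)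

text \<open>A finite supremum of natural numbers is attained once the set is nonempty;
  \<open>x \<le> y\<close> in \<open>L\<close> supplies a chain of length 0 or 1 for that.\<close>

lemma clen_finite_chain:
  assumes "clen L x y = enat k" "x \<le> y" "x \<in> L" "y \<in> L"
  shows "(chain_step L ^^ k) x y"
proof -
  let ?S = "{n. (chain_step L ^^ n) x y}"
  have ne: "?S \<noteq> {}"
  proof (cases "x = y")
    case True then have "0 \<in> ?S" by simp
    then show ?thesis by blast
  next
    case False
    then have "chain_step L x y" using assms by auto
    then have "Suc 0 \<in> ?S" using chain_one by blast
    then show ?thesis by blast
  qed
  have le: "n \<le> k" if "n \<in> ?S" for n
    using clen_upper[of n L x y] that assms(1) by simp
  then have fin: "finite ?S" by (meson finite_nat_set_iff_bounded_le)
  have "clen L x y \<le> enat (Max ?S)"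
    using fin by (intro clen_least) simp
  then have "k \<le> Max ?S" using assms(1) by simp
  moreover have "Max ?S \<in> ?S" using fin ne by (rule Max_in)
  moreover have "Max ?S \<le> k" using le calculation by blast
  ultimately show ?thesis by auto
qed

lemma clen_concat:
  assumes "x \<le> y" "y \<le> z" "x \<in> L" "y \<in> L" "z \<in> L"
  shows "clen L x y + clen L y z \<le> clen L x z"
proof (cases "clen L x z")
  case (enat k)
  \<comment> \<open>Both parts have finite length: a chain in either one extends, by a fixed chain
    in the other, to a chain from \<open>x\<close> to \<open>z\<close>, and these have length at
    most \<open>k\<close>.\<close>
  have fin: "\<exists>j. clen L u v = enat j"
    if "\<And>n. (chain_step L ^^ n) u v \<Longrightarrow> \<exists>n'. n \<le> n' \<and> (chain_step L ^^ n') x z" for u v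
  proof -
    have "clen L u v \<le> enat k"
    proof (rule clen_least)
      fix n assume "(chain_step L ^^ n) u v"
      from that[OF this] obtain n' where "n \<le> n'" "(chain_step L ^^ n') x z" by blast
      with clen_upper[of n' L x z] enat show "enat n \<le> enat k" by simp
    qed
    then show ?thesis using enat_ile by blast
  qed
  have one: "\<exists>n. (chain_step L ^^ n) u v" if "u \<le> v" "u \<in> L" "v \<in> L" for u v
  proof (cases "u = v")
    case True then show ?thesis by (intro exI[of _ 0]) simp
  next
    case False then show ?thesis using that by (intro exI[of _ "Suc 0"] chain_one) auto
  qed
  obtain a where a: "(chain_step L ^^ a) x y" using one[of x y] assms by blast
  obtain b where b: "(chain_step L ^^ b) y z" using one[of y z] assms by blast
  have "\<exists>j. clen L x y = enat j"
    by (rule fin) (use b in \<open>blast intro: relpowp_trans le_add1\<close>)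
  then obtain i where i: "clen L x y = enat i" by blast
  have "\<exists>j. clen L y z = enat j"
    by (rule fin) (use a in \<open>blast intro: relpowp_trans le_add2\<close>)
  then obtain j where j: "clen L y z = enat j" by blast
  have "(chain_step L ^^ i) x y"
    using assms by (rule_tac clen_finite_chain[OF i])
  moreover have "(chain_step L ^^ j) y z"
    using assms by (rule_tac clen_finite_chain[OF j])
  ultimately have "(chain_step L ^^ (i + j)) x z" by (rule relpowp_trans)
  then show ?thesis using clen_upper i j by fastforce
qed simp

section \<open>Modular lattices and additivity of length\<close>

class modular_lattice = complete_lattice +
  assumes modular: "z \<le> x \<Longrightarrow> inf x (sup y z) \<le> sup (inf x y) z"
begin

text \<open>Modularity forbids a pentagon, and \<open>a < b\<close> with equal meets and equal joins
  with \<open>c\<close> would be one.\<close>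

lemma modular_cancel:
  assumes "a \<le> b" "inf a c = inf b c" "sup a c = sup b c"
  shows "a = b"
proof -
  have "b = inf b (sup c a)" using assms by (metis inf.absorb1 sup.commute sup_ge1)
  also have "\<dots> \<le> sup (inf b c) a" by (rule modular[OF assms(1)])
  also have "\<dots> \<le> a" using assms(2) by (metis inf_le1 le_sup_iff order_refl)
  finally show ?thesis using assms(1) by simp
qed

end

instance "fun" :: (type, modular_lattice) modular_lattice
  by standard (auto simp: le_fun_def modular)

text \<open>A strict step cannot keep both its meet and its join with \<open>y\<close>, so a chain
  from \<open>x\<close> to \<open>z\<close> splits into one below and one above \<open>y\<close>.
  Concatenation of chains gives the other inequality.\<close>

lemma len_add:
  fixes x y z :: "'b::modular_lattice"
  assumes "x \<le> y" "y \<le> z"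
  shows "len x z = len x y + len y z"
proof (rule antisym)
  show "len x z \<le> len x y + len y z"
  proof (rule clen_split[where f = "\<lambda>a. inf a y" and g = "\<lambda>a. sup a y"])
    fix a b :: 'b assume "a < b"
    then show "inf a y \<in> UNIV \<and> inf b y \<in> UNIV \<and> sup a y \<in> UNIV \<and> sup b y \<in> UNIV \<and>
       inf a y \<le> inf b y \<and> sup a y \<le> sup b y \<and> (inf a y \<noteq> inf b y \<or> sup a y \<noteq> sup b y)"
      using modular_cancel[of a b y] less_imp_le[of a b] by (auto intro: le_infI1 le_supI1)
  qed (use assms in \<open>auto simp: inf_absorb1 inf_absorb2 sup_absorb1 sup_absorb2\<close>)
qed (use assms in \<open>auto intro: clen_concat\<close>)

lemma len_antimono_left:
  fixes x y z :: "'b::modular_lattice"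
  shows "x \<le> y \<Longrightarrow> y \<le> z \<Longrightarrow> len y z \<le> len x z"
  by (simp add: len_add[of x y z])

lemma len_mono_right:
  fixes x y z :: "'b::modular_lattice"
  shows "x \<le> y \<Longrightarrow> y \<le> z \<Longrightarrow> len x y \<le> len x z"
  by (simp add: len_add[of x y z])

lemma len_top_antimono:
  fixes x y :: "'b::modular_lattice"
  shows "x \<le> y \<Longrightarrow> len y top \<le> len x top"
  by (rule len_antimono_left) auto

lemma quot_length_eq: "quot_length A B = clen {N. is_submodule N} B A"
proof -
  let ?C = "\<lambda>n. \<exists>N :: nat \<Rightarrow> 'a mpoly set. (\<forall>i\<le>n. is_submodule (N i)) \<and> N 0 = B \<and> N n = A \<and>
    (\<forall>i<n. N i \<subset> N (Suc i))"
  \<comment> \<open>For \<open>n = 0\<close> the two conditions differ, since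
    \<open>quot_length\<close> then also asks that \<open>B\<close> is a submodule; either way this
    case contributes only 0 to the supremum.\<close>
  have *: "?C n
     \<longleftrightarrow> (chain_step {N. is_submodule N} ^^ n) B A" if "n \<noteq> 0" for n
  proof
    assume "?C n"
    then obtain N :: "nat \<Rightarrow> 'a mpoly set" where N: "\<forall>i\<le>n. is_submodule (N i)" "N 0 = B" "N n = A"
      "\<forall>i<n. N i \<subset> N (Suc i)" by blast
    then show "(chain_step {N. is_submodule N} ^^ n) B A"
      unfolding relpowp_fun_conv by (intro exI[of _ N]) simp
  next
    assume "(chain_step {N. is_submodule N} ^^ n) B A"
    then obtain f where f: "f 0 = B" "f n = A" "\<And>i. i < n \<Longrightarrow> is_submodule (f i)"
      "\<And>i. i < n \<Longrightarrow> is_submodule (f (Suc i))" "\<And>i. i < n \<Longrightarrow> f i \<subset> f (Suc i)"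
      unfolding relpowp_fun_conv by auto
    have "is_submodule (f i)" if "i \<le> n" for i
      using f(3)[of i] f(4)[of "n - 1"] that \<open>n \<noteq> 0\<close> by (cases "i = n") auto
    with f show "?C n"
      by blast
  qed
  show ?thesis
  proof (rule antisym)
    show "quot_length A B \<le> clen {N. is_submodule N} B A"
      unfolding quot_length_def
    proof (rule SUP_least, clarify)
      fix n and N :: "nat \<Rightarrow> 'a mpoly set"
      assume "\<forall>i\<le>n. is_submodule (N i)" "B = N 0" "A = N n" "\<forall>i<n. N i \<subset> N (Suc i)"
      with *[of n] show "enat n \<le> clen {N. is_submodule N} (N 0) (N n)"
        by (cases "n = 0") (auto simp: zero_enat_def intro!: clen_upper)
    qed
    show "clen {N. is_submodule N} B A \<le> quot_length A B"
    proof (rule clen_least)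
      fix n assume "(chain_step {N. is_submodule N} ^^ n) B A"
      with *[of n] show "enat n \<le> quot_length A B"
        by (cases "n = 0") (auto simp: zero_enat_def[symmetric] quot_length_def intro!: SUP_upper)
    qed
  qed
qed


section \<open>The lattice of ideals\<close>

text \<open>As a simp rule this reassociates all products in the base ring and loops with \<open>mult.assoc\<close>.\<close>

declare self_module.scale_scale [simp del]

text \<open>A type of its own lets class instances apply: complete lattice, monoid under products of
  ideals, and, pointwise, families of ideals as functions into it.\<close>

typedef (overloaded) 'a ideal = "{J :: 'a::comm_ring_1 set. is_ideal J}"
  morphisms set_of Ideal
  by (intro exI[of _ UNIV]) (simp add: self_module.subspace_UNIV)

lemma is_ideal_set_of [simp]: "is_ideal (set_of J)"
  using set_of[of J] by simp

lemma set_of_Ideal [simp]: "is_ideal J \<Longrightarrow> set_of (Ideal J) = J"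
  by (simp add: Ideal_inverse)

lemma ideal_0 [simp]: "0 \<in> set_of J"
  and ideal_add: "x \<in> set_of J \<Longrightarrow> y \<in> set_of J \<Longrightarrow> x + y \<in> set_of J"
  and ideal_diff: "x \<in> set_of J \<Longrightarrow> y \<in> set_of J \<Longrightarrow> x - y \<in> set_of J"
  and ideal_mult: "x \<in> set_of J \<Longrightarrow> c * x \<in> set_of J"
  and ideal_mult_right: "x \<in> set_of J \<Longrightarrow> x * c \<in> set_of J"
  using is_ideal_set_of[of J] self_module.subspace_scale[of "set_of J" x c]
  by (auto simp: self_module.subspace_0 self_module.subspace_add self_module.subspace_diff mult.commute)

definition spn :: "'a::comm_ring_1 set \<Rightarrow> 'a ideal" where
  "spn A = Ideal (ideal_gen A)"

lemma set_of_spn: "set_of (spn A) = ideal_gen A"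
  by (simp add: spn_def)

instantiation ideal :: (comm_ring_1) complete_lattice
begin

definition less_eq_ideal :: "'a ideal \<Rightarrow> 'a ideal \<Rightarrow> bool" where
  "A \<le> B \<longleftrightarrow> set_of A \<subseteq> set_of B"
definition less_ideal :: "'a ideal \<Rightarrow> 'a ideal \<Rightarrow> bool" where
  "A < B \<longleftrightarrow> set_of A \<subset> set_of B"
definition inf_ideal :: "'a ideal \<Rightarrow> 'a ideal \<Rightarrow> 'a ideal" where
  "inf A B = Ideal (set_of A \<inter> set_of B)"
definition sup_ideal :: "'a ideal \<Rightarrow> 'a ideal \<Rightarrow> 'a ideal" where
  "sup A B = spn (set_of A \<union> set_of B)"
definition Inf_ideal :: "'a ideal set \<Rightarrow> 'a ideal" where
  "Inf S = Ideal (\<Inter>J\<in>S. set_of J)"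
definition Sup_ideal :: "'a ideal set \<Rightarrow> 'a ideal" where
  "Sup S = spn (\<Union>J\<in>S. set_of J)"
definition bot_ideal :: "'a ideal" where "bot = Ideal {0}"
definition top_ideal :: "'a ideal" where "top = Ideal UNIV"

lemma spn_least: "A \<subseteq> set_of J \<Longrightarrow> ideal_gen A \<subseteq> set_of J"
  by (intro self_module.span_minimal) auto

instance
proof
  fix A B C :: "'a ideal" and S :: "'a ideal set"
  have i: "set_of (inf A B) = set_of A \<inter> set_of B" for A B :: "'a ideal"
    by (simp add: inf_ideal_def self_module.subspace_inter)
  have s: "set_of (sup A B) = ideal_gen (set_of A \<union> set_of B)" for A B :: "'a ideal"
    by (simp add: sup_ideal_def set_of_spn)
  have I: "set_of (Inf S) = (\<Inter>J\<in>S. set_of J)" for S :: "'a ideal set"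
    unfolding Inf_ideal_def by (rule set_of_Ideal, rule self_module.subspace_Int) auto
  have S: "set_of (Sup S) = ideal_gen (\<Union>J\<in>S. set_of J)" for S :: "'a ideal set"
    by (simp add: Sup_ideal_def set_of_spn)
  show "A < B \<longleftrightarrow> A \<le> B \<and> \<not> B \<le> A" "A \<le> A" "A \<le> B \<Longrightarrow> B \<le> C \<Longrightarrow> A \<le> C"
    by (auto simp: less_eq_ideal_def less_ideal_def)
  show "A \<le> B \<Longrightarrow> B \<le> A \<Longrightarrow> A = B"
    by (simp add: less_eq_ideal_def set_of_inject[symmetric])
  show "inf A B \<le> A" "inf A B \<le> B" "A \<le> B \<Longrightarrow> A \<le> C \<Longrightarrow> A \<le> inf B C"
    by (auto simp: less_eq_ideal_def i)
  show "A \<le> sup A B" "B \<le> sup A B" "B \<le> A \<Longrightarrow> C \<le> A \<Longrightarrow> sup B C \<le> A"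
    using self_module.span_superset[of "set_of A \<union> set_of B"] spn_least[of "set_of B \<union> set_of C" A]
    by (auto simp: less_eq_ideal_def s)
  show "A \<in> S \<Longrightarrow> Inf S \<le> A" "(\<And>B. B \<in> S \<Longrightarrow> A \<le> B) \<Longrightarrow> A \<le> Inf S"
    by (auto simp: less_eq_ideal_def I)
  show "A \<in> S \<Longrightarrow> A \<le> Sup S"
    using self_module.span_superset[of "\<Union>J\<in>S. set_of J"] by (auto simp: less_eq_ideal_def S)
  show "(\<And>B. B \<in> S \<Longrightarrow> B \<le> A) \<Longrightarrow> Sup S \<le> A"
    unfolding less_eq_ideal_def S by (intro spn_least) auto
  show "Inf {} = (top :: 'a ideal)" by (simp add: Inf_ideal_def top_ideal_def)
  show "Sup {} = (bot :: 'a ideal)" by (simp add: Sup_ideal_def bot_ideal_def spn_def)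
qed

end

lemma ideal_leI: "(\<And>x. x \<in> set_of A \<Longrightarrow> x \<in> set_of B) \<Longrightarrow> A \<le> B"
  and ideal_leD: "A \<le> B \<Longrightarrow> x \<in> set_of A \<Longrightarrow> x \<in> set_of B"
  by (auto simp: less_eq_ideal_def)

lemma set_of_inf [simp]: "set_of (inf A B) = set_of A \<inter> set_of B"
  by (simp add: inf_ideal_def self_module.subspace_inter)

lemma set_of_top [simp]: "set_of top = UNIV"
  by (simp add: top_ideal_def self_module.subspace_UNIV)

lemma spn_le_iff: "spn A \<le> J \<longleftrightarrow> A \<subseteq> set_of J"
  using spn_least[of A J] self_module.span_superset[of A]
  by (auto simp: less_eq_ideal_def set_of_spn)

lemma set_of_sup: "set_of (sup A B) = {a + b | a b. a \<in> set_of A \<and> b \<in> set_of B}"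
proof -
  have "set_of (sup A B) = ideal_gen (set_of A \<union> set_of B)"
    by (simp add: sup_ideal_def set_of_spn)
  also have "\<dots> = {a + b | a b. a \<in> ideal_gen (set_of A) \<and> b \<in> ideal_gen (set_of B)}"
    by (rule self_module.span_Un)
  finally show ?thesis
    by (simp only: self_module.span_eq_iff[THEN iffD2, OF is_ideal_set_of])
qed

lemma sup_memE:
  assumes "x \<in> set_of (sup A B)"
  obtains a b where "a \<in> set_of A" "b \<in> set_of B" "x = a + b"
  using assms by (auto simp: set_of_sup)

lemma sup_memI: "a \<in> set_of A \<Longrightarrow> b \<in> set_of B \<Longrightarrow> a + b \<in> set_of (sup A B)"
  by (auto simp: set_of_sup)

instance ideal :: (comm_ring_1) modular_lattice
proof
  fix x y z :: "'a ideal" assume zx: "z \<le> x"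
  show "inf x (sup y z) \<le> sup (inf x y) z"
  proof (rule ideal_leI)
    fix a assume "a \<in> set_of (inf x (sup y z))"
    then obtain b c where a: "a \<in> set_of x" "b \<in> set_of y" "c \<in> set_of z" "a = b + c"
      by (auto elim: sup_memE)
    have "a - c \<in> set_of x" using a(1,3) zx by (blast intro: ideal_diff dest: ideal_leD)
    then have "b \<in> set_of (inf x y)" using a(2,4) by simp
    with a(3,4) show "a \<in> set_of (sup (inf x y) z)" by (simp add: sup_memI)
  qed
qed

section \<open>Ideal quotients and products of ideals\<close>

definition colon :: "'a::comm_ring_1 ideal \<Rightarrow> 'a \<Rightarrow> 'a ideal" where
  "colon J a = Ideal {x. a * x \<in> set_of J}"

lemma set_of_colon [simp]: "set_of (colon J a) = {x. a * x \<in> set_of J}"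
proof -
  have "is_ideal {x. a * x \<in> set_of J}"
    by (auto simp: self_module.subspace_def distrib_left mult.left_commute[of a]
        intro: ideal_add ideal_mult)
  then show ?thesis by (simp add: colon_def)
qed

abbreviation gen :: "'a::comm_ring_1 \<Rightarrow> 'a ideal" where
  "gen a \<equiv> spn {a}"

lemma gen_le_iff [simp]: "gen a \<le> J \<longleftrightarrow> a \<in> set_of J"
  by (simp add: spn_le_iff)

lemma set_of_gen: "set_of (gen a) = range (\<lambda>c. c * a)"
  by (simp add: set_of_spn self_module.span_singleton)

lemma mem_gen [simp]: "a \<in> set_of (gen a)"
  using gen_le_iff[of a "gen a"] by simp

lemma top_iff_one: "J = top \<longleftrightarrow> 1 \<in> set_of J"
proof
  assume "1 \<in> set_of J"
  then have "x \<in> set_of J" for x using ideal_mult[of 1 J x] by simp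
  then show "J = top" by (auto simp: set_of_inject[symmetric])
qed simp

instantiation ideal :: (comm_ring_1) comm_monoid_mult
begin

definition times_ideal :: "'a ideal \<Rightarrow> 'a ideal \<Rightarrow> 'a ideal" where
  "A * B = spn {a * b | a b. a \<in> set_of A \<and> b \<in> set_of B}"
definition one_ideal :: "'a ideal" where "(1 :: 'a ideal) = top"

lemma times_le_iff: "A * B \<le> J \<longleftrightarrow> (\<forall>a\<in>set_of A. \<forall>b\<in>set_of B. a * b \<in> set_of J)"
  by (auto simp: times_ideal_def spn_le_iff)

lemma times_le_colon: "A * B \<le> J \<longleftrightarrow> (\<forall>a\<in>set_of A. B \<le> colon J a)"
  by (auto simp: times_le_iff less_eq_ideal_def[of B])

lemma times_commute_aux: "A * B = B * (A :: 'a ideal)"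
  unfolding times_ideal_def by (intro arg_cong[of _ _ spn] Collect_cong) (metis mult.commute)

instance
proof
  fix A B C :: "'a ideal"
  show c: "A * B = B * A" for A B :: "'a ideal" by (rule times_commute_aux)
  \<comment> \<open>An ideal is determined by the ideals above it, and both bracketings lie below
    \<open>J\<close> exactly when all triple products lie in \<open>J\<close>. This avoids handling
    sums of products.\<close>
  have "A * B * C \<le> J \<longleftrightarrow> (\<forall>a\<in>set_of A. \<forall>b\<in>set_of B. \<forall>c\<in>set_of C. a * b * c \<in> set_of J)"
    for A B C J :: "'a ideal"
  proof -
    have "A * B * C \<le> J \<longleftrightarrow> C * (A * B) \<le> J" by (simp add: c)
    also have "\<dots> \<longleftrightarrow> (\<forall>c\<in>set_of C. \<forall>a\<in>set_of A. \<forall>b\<in>set_of B. c * (a * b) \<in> set_of J)"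
      by (simp add: times_le_colon[of C] times_le_iff[of A])
    finally have "A * B * C \<le> J \<longleftrightarrow> (\<forall>c\<in>set_of C. \<forall>a\<in>set_of A. \<forall>b\<in>set_of B. c * (a * b) \<in> set_of J)" .
    moreover have "c * (a * b) = a * b * c" for a b c :: 'a by (simp add: mult_ac)
    ultimately show ?thesis by (simp only:) blast
  qed
  note 1 = this
  have "A * (B * C) \<le> J \<longleftrightarrow> A * B * C \<le> J" for J
  proof -
    have "A * (B * C) \<le> J \<longleftrightarrow> B * C * A \<le> J" by (simp add: c)
    also have "\<dots> \<longleftrightarrow> (\<forall>a\<in>set_of A. \<forall>b\<in>set_of B. \<forall>c\<in>set_of C. b * c * a \<in> set_of J)"
      unfolding 1 by blast
    also have "\<dots> \<longleftrightarrow> A * B * C \<le> J" unfolding 1 by (simp add: mult_ac)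
    finally show ?thesis .
  qed
  then show "A * B * C = A * (B * C)" by (metis antisym order_refl)
  have "1 * A \<le> A" by (auto simp: times_le_iff one_ideal_def intro: ideal_mult)
  moreover have "A \<le> 1 * A"
  proof (rule ideal_leI)
    fix x assume "x \<in> set_of A"
    then have "1 * x \<in> set_of (1 * A)"
      using times_le_iff[of 1 A "1 * A"] by (metis UNIV_I one_ideal_def order_refl set_of_top)
    then show "x \<in> set_of (1 * A)" by simp
  qed
  ultimately show "1 * A = A" by simp
qed

end

lemma times_memI: "a \<in> set_of A \<Longrightarrow> b \<in> set_of B \<Longrightarrow> a * b \<in> set_of (A * B)"
  using times_le_iff[of A B "A * B"] by simp

lemma ideal_times_mono: "A \<le> A' \<Longrightarrow> B \<le> B' \<Longrightarrow> A * B \<le> A' * (B' :: 'a::comm_ring_1 ideal)"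
  by (auto simp: times_le_iff intro: times_memI dest: ideal_leD)

lemma ideal_times_le1: "A * B \<le> (A :: 'a::comm_ring_1 ideal)"
  and ideal_times_le2: "A * B \<le> (B :: 'a::comm_ring_1 ideal)"
  by (auto simp: times_le_iff intro: ideal_mult ideal_mult_right)

lemma top_times [simp]: "top * A = (A :: 'a::comm_ring_1 ideal)"
  and times_top [simp]: "A * top = (A :: 'a::comm_ring_1 ideal)"
  using mult_1_left[of A] mult_1_right[of A] by (simp_all add: one_ideal_def)

lemma ideal_one_eq_top: "(1 :: 'a::comm_ring_1 ideal) = top"
  by (simp add: one_ideal_def)

text \<open>Multiplication by \<open>A\<close> is a left adjoint, by way of ideal quotients, and so
  preserves suprema.\<close>

lemma times_SUP: "A * (SUP i\<in>S. f i) = (SUP i\<in>S. A * (f i :: 'a::comm_ring_1 ideal))"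
proof (rule antisym)
  have "f i \<le> colon (SUP i\<in>S. A * f i) a" if "i \<in> S" "a \<in> set_of A" for i a
  proof -
    have "A * f i \<le> (SUP i\<in>S. A * f i)" using that by (intro SUP_upper)
    with that show ?thesis by (simp add: times_le_colon)
  qed
  then show "A * (SUP i\<in>S. f i) \<le> (SUP i\<in>S. A * f i)"
    unfolding times_le_colon by (intro ballI SUP_least) simp
qed (auto intro!: SUP_least ideal_times_mono SUP_upper)

lemma times_sup: "A * sup B C = sup (A * B) (A * (C :: 'a::comm_ring_1 ideal))"
  using times_SUP[of A "\<lambda>b. if b then B else C" UNIV] by (simp add: UNIV_bool sup_commute)

lemma sup_times: "sup B C * A = sup (B * A) (C * (A :: 'a::comm_ring_1 ideal))"
  using times_sup[of A B C] by (simp add: mult.commute)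

lemma times_bot [simp]: "A * bot = (bot :: 'a::comm_ring_1 ideal)"
  by (rule antisym[OF ideal_times_le2]) simp

lemma ideal_power_mono: "A \<le> B \<Longrightarrow> A ^ n \<le> (B :: 'a::comm_ring_1 ideal) ^ n"
  by (induction n) (auto intro: ideal_times_mono)

lemma ideal_power_antimono: "i \<le> j \<Longrightarrow> A ^ j \<le> (A :: 'a::comm_ring_1 ideal) ^ i"
  using ideal_times_le1[of "A ^ i" "A ^ (j - i)"] by (simp add: power_add[symmetric])

text \<open>The adjunction that, lifted to families as \<open>fmul_le_iff\<close>, replaces the maps
  of quotients induced by multiplication by \<open>a\<close>. A principal ideal only has to be
  tested on its generator.\<close>

lemma gen_times_le_iff: "gen a * B \<le> J \<longleftrightarrow> B \<le> colon J a"
proof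
  assume "gen a * B \<le> J"
  then show "B \<le> colon J a" by (simp add: times_le_colon)
next
  assume "B \<le> colon J a"
  then have "a * b \<in> set_of J" if "b \<in> set_of B" for b using that by (auto dest: ideal_leD)
  then show "gen a * B \<le> J"
    by (auto simp: times_le_iff set_of_gen mult.assoc intro: ideal_mult)
qed

lemma set_of_gen_times: "set_of (gen a * B) = (\<lambda>b. a * b) ` set_of B"
proof -
  have id: "is_ideal ((\<lambda>b. a * b) ` set_of B)"
  proof (rule self_module.subspaceI)
    show "0 \<in> (\<lambda>b. a * b) ` set_of B" by (rule image_eqI[of _ _ 0]) auto
    fix x y assume "x \<in> (\<lambda>b. a * b) ` set_of B" "y \<in> (\<lambda>b. a * b) ` set_of B"
    then show "x + y \<in> (\<lambda>b. a * b) ` set_of B"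
      by (auto simp flip: distrib_left intro: ideal_add)
  next
    fix c x assume "x \<in> (\<lambda>b. a * b) ` set_of B"
    then show "c * x \<in> (\<lambda>b. a * b) ` set_of B"
      by (auto simp: mult.left_commute[of c] intro: ideal_mult)
  qed
  have "gen a * B \<le> Ideal ((\<lambda>b. a * b) ` set_of B)"
    unfolding gen_times_le_iff using id by (auto simp: less_eq_ideal_def)
  then have "set_of (gen a * B) \<subseteq> (\<lambda>b. a * b) ` set_of B"
    using id by (simp add: less_eq_ideal_def)
  then show ?thesis by (auto intro: times_memI)
qed

lemma gen_times_inf_colon: "gen a * inf A (colon J a) = inf (gen a * A) J"
  by (auto simp: set_of_inject[symmetric] set_of_gen_times)

lemma colon_sup_le: "A \<le> B \<Longrightarrow> inf B (colon (sup J (gen a * A)) a) \<le> sup A (inf B (colon J a))"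
proof (rule ideal_leI)
  fix x assume AB: "A \<le> B" and "x \<in> set_of (inf B (colon (sup J (gen a * A)) a))"
  then have x: "x \<in> set_of B" "a * x \<in> set_of (sup J (gen a * A))" by auto
  from x(2) obtain y z where y: "y \<in> set_of J" "z \<in> set_of A" "a * x = y + a * z"
    by (auto elim!: sup_memE simp: set_of_gen_times)
  then have "a * (x - z) \<in> set_of J" by (simp add: right_diff_distrib)
  moreover have "x - z \<in> set_of B" using x y AB by (auto intro: ideal_diff dest: ideal_leD)
  ultimately have "z + (x - z) \<in> set_of (sup A (inf B (colon J a)))"
    using y by (intro sup_memI) auto
  then show "x \<in> set_of (sup A (inf B (colon J a)))" by simp
qed

text \<open>Multiplication by \<open>a\<close> induces an isomorphism from
  \<open>A/(A \<inter> (J : a))\<close> onto \<open>(J + aA)/J\<close>. In its place, the maps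
  \<open>N \<mapsto> A \<inter> (N : a)\<close> and \<open>N \<mapsto> J + aN\<close> are shown to
  be strictly monotone on the two intervals, one for each inequality.\<close>

lemma len_sup_gen_times:
  "len J (sup J (gen a * A)) = len (inf A (colon J a)) (A :: 'a::comm_ring_1 ideal)"
proof (rule antisym)
  show "len J (sup J (gen a * A)) \<le> len (inf A (colon J a)) A"
  proof (rule clen_map[where f = "\<lambda>N. inf A (colon N a)"])
    fix M N :: "'a ideal" assume h: "J \<le> M" "M < N" "N \<le> sup J (gen a * A)"
    have le: "inf A (colon M a) \<le> inf A (colon N a)"
      using h by (auto simp: less_eq_ideal_def less_ideal_def)
    have "inf A (colon M a) \<noteq> inf A (colon N a)"
    proof
      assume "inf A (colon M a) = inf A (colon N a)"
      then have e: "inf (gen a * A) M = inf (gen a * A) N"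
        by (simp only: flip: gen_times_inf_colon)
      \<comment> \<open>As \<open>N\<close> lies between \<open>J\<close> and \<open>J + aA\<close>,
        modularity rebuilds it from \<open>J\<close> and its intersection with
        \<open>aA\<close>.\<close>
      have "N = inf N (sup (gen a * A) J)" using h by (simp add: inf_absorb1 sup_commute)
      also have "\<dots> \<le> sup (inf N (gen a * A)) J" using h by (intro modular) auto
      also have "\<dots> = sup (inf (gen a * A) M) J" using e by (simp add: inf_commute)
      also have "\<dots> \<le> M" using h by simp
      finally show False using h by simp
    qed
    with le show "chain_step UNIV (inf A (colon M a)) (inf A (colon N a))" by (simp only: less_le) simp
  next
    have "A \<le> colon (sup J (gen a * A)) a" by (simp flip: gen_times_le_iff)
    then show "inf A (colon (sup J (gen a * A)) a) = A" by (simp add: inf_absorb1)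
  qed simp
  show "len (inf A (colon J a)) A \<le> len J (sup J (gen a * A))"
  proof (rule clen_map[where f = "\<lambda>N. sup J (gen a * N)"])
    fix M N :: "'a ideal" assume h: "inf A (colon J a) \<le> M" "M < N" "N \<le> A"
    have le: "sup J (gen a * M) \<le> sup J (gen a * N)"
      using h by (auto intro!: ideal_times_mono le_supI2)
    have "sup J (gen a * M) \<noteq> sup J (gen a * N)"
    proof
      assume "sup J (gen a * M) = sup J (gen a * N)"
      then have "gen a * N \<le> sup J (gen a * M)" by simp
      then have "N \<le> inf A (colon (sup J (gen a * M)) a)" using h by (simp add: gen_times_le_iff)
      also have "\<dots> \<le> sup M (inf A (colon J a))" using h by (intro colon_sup_le) auto
      also have "\<dots> \<le> M" using h by simp
      finally show False using h by simp
    qed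
    with le show "chain_step UNIV (sup J (gen a * M)) (sup J (gen a * N))" by (simp only: less_le) simp
  next
    show "sup J (gen a * inf A (colon J a)) = J"
      by (simp add: gen_times_inf_colon sup_absorb1)
  qed simp
qed

section \<open>Prime ideals and noetherian induction\<close>

definition prime_id :: "'a::comm_ring_1 ideal \<Rightarrow> bool" where
  "prime_id P \<longleftrightarrow> P \<noteq> top \<and> (\<forall>a b. a * b \<in> set_of P \<longrightarrow> a \<in> set_of P \<or> b \<in> set_of P)"

lemma prime_id_iff: "prime_id P \<longleftrightarrow> prime_ideal (set_of P)"
  by (auto simp: prime_id_def prime_ideal_def set_of_inject[symmetric])

locale noetherian =
  fixes ty :: "'a::comm_ring_1 itself"
  assumes fin_gen: "is_ideal (J :: 'a set) \<Longrightarrow> \<exists>A. finite A \<and> J = ideal_gen A"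
begin

lemma ascending_stationary:
  fixes f :: "nat \<Rightarrow> 'a ideal"
  assumes "mono f"
  shows "\<exists>N. \<forall>n\<ge>N. f n = f N"
proof -
  obtain A where A: "finite A" "set_of (SUP n. f n) = ideal_gen A"
    using fin_gen[of "set_of (SUP n. f n)"] by auto
  have sub: "is_ideal (\<Union>n. set_of (f n))"
  proof (rule self_module.subspaceI)
    fix x y assume "x \<in> (\<Union>n. set_of (f n))" "y \<in> (\<Union>n. set_of (f n))"
    then obtain i j where "x \<in> set_of (f i)" "y \<in> set_of (f j)" by auto
    then have "x \<in> set_of (f (max i j))" "y \<in> set_of (f (max i j))"
      using monoD[OF assms, of i "max i j"] monoD[OF assms, of j "max i j"]
      by (auto dest: ideal_leD)
    then show "x + y \<in> (\<Union>n. set_of (f n))" by (blast intro: ideal_add)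
  qed (auto intro: ideal_mult)
  then have "(SUP n. f n) \<le> Ideal (\<Union>n. set_of (f n))"
    by (intro SUP_least) (auto simp: less_eq_ideal_def)
  then have "set_of (SUP n. f n) \<subseteq> (\<Union>n. set_of (f n))"
    using sub by (simp add: less_eq_ideal_def)
  then have "A \<subseteq> (\<Union>n. set_of (f n))"
    using self_module.span_superset[of A] unfolding A(2) by (rule order.trans[rotated])
  with A(1) have "\<exists>n. A \<subseteq> set_of (f n)"
  proof (induction A rule: finite_induct)
    case (insert x A)
    then obtain i j where "A \<subseteq> set_of (f i)" "x \<in> set_of (f j)" by auto
    then have "insert x A \<subseteq> set_of (f (max i j))"
      using monoD[OF assms, of i "max i j"] monoD[OF assms, of j "max i j"]
      by (auto dest: ideal_leD)
    then show ?case by blast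
  qed simp
  then obtain N where "A \<subseteq> set_of (f N)" by blast
  then have "ideal_gen A \<subseteq> set_of (f N)" by (rule spn_least)
  then have "(SUP n. f n) \<le> f N" using A(2) by (simp add: less_eq_ideal_def)
  then have "f n \<le> f N" for n by (rule order.trans[rotated]) (rule SUP_upper, simp)
  then have "f n = f N" if "n \<ge> N" for n
    using monoD[OF assms that] by (intro antisym)
  then show ?thesis by (intro exI allI impI)
qed

lemma wf_greater: "wf {(B, A :: 'a ideal). A < B}"
proof (rule ccontr)
  assume "\<not> wf {(B, A :: 'a ideal). A < B}"
  then obtain f where f: "\<And>i. f i < (f (Suc i) :: 'a ideal)"
    by (auto simp: wf_iff_no_infinite_down_chain)
  then have "mono f" by (simp add: mono_iff_le_Suc less_imp_le)
  then obtain N where "\<forall>n\<ge>N. f n = f N" using ascending_stationary by meson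
  then have "f (Suc N) = f N" by (meson le_SucI order_refl)
  with f[of N] show False by simp
qed

lemma noetherian_induct [case_names less]:
  assumes "\<And>J :: 'a ideal. (\<And>K. J < K \<Longrightarrow> P K) \<Longrightarrow> P J"
  shows "P J"
proof (induction J rule: wf_induct_rule[OF wf_greater])
  case (1 J)
  show ?case by (rule assms, rule 1) simp
qed

lemma finite_generators:
  fixes J :: "'a ideal"
  obtains A where "finite A" "J = spn A"
proof -
  obtain A where "finite A" "set_of J = ideal_gen A"
    using fin_gen[OF is_ideal_set_of] by blast
  then show ?thesis using that[of A] set_of_inject[of J "spn A"] by (simp add: set_of_spn)
qed

end


section \<open>Noetherian families of ideals\<close>

text \<open>A family \<open>P\<close> of ideals indexed by a monoid stands for the graded submodule
  \<open>\<Oplus>\<^sub>d P d \<cdot> X\<^sup>d\<close> of the monoid algebra, and an operator \<open>(a, g)\<close> for multiplication by \<open>a X\<^sup>g\<close>.\<close>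

definition fmul :: "'a::comm_ring_1 \<times> 'g::cancel_comm_monoid_add \<Rightarrow> ('g \<Rightarrow> 'a ideal) \<Rightarrow> 'g \<Rightarrow> 'a ideal" where
  "fmul x P d = (if d - snd x + snd x = d then gen (fst x) * P (d - snd x) else bot)"

text \<open>The quotient (F : a X^g), right adjoint to \<open>fmul x\<close>. As subtraction in the
  monoid undoes addition, the test \<open>d - g + g = d\<close> in \<open>fmul\<close> says that
  \<open>g\<close> divides the degree \<open>d\<close>.\<close>

definition fcol :: "'a::comm_ring_1 \<times> 'g::cancel_comm_monoid_add \<Rightarrow> ('g \<Rightarrow> 'a ideal) \<Rightarrow> 'g \<Rightarrow> 'a ideal" where
  "fcol x F d = colon (F (d + snd x)) (fst x)"

lemma fmul_le_iff: "fmul x P \<le> F \<longleftrightarrow> P \<le> fcol x F"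
proof
  assume h: "fmul x P \<le> F"
  show "P \<le> fcol x F"
  proof (rule le_funI)
    fix d
    have "fmul x P (d + snd x) \<le> F (d + snd x)" using h by (rule le_funD)
    then show "P d \<le> fcol x F d" by (simp add: fmul_def fcol_def gen_times_le_iff)
  qed
next
  assume h: "P \<le> fcol x F"
  show "fmul x P \<le> F"
  proof (rule le_funI)
    fix d
    show "fmul x P d \<le> F d"
    proof (cases "d - snd x + snd x = d")
      case True
      with le_funD[OF h, of "d - snd x"] show ?thesis
        by (simp add: fmul_def fcol_def gen_times_le_iff)
    qed (simp add: fmul_def)
  qed
qed

lemma fcol_mono: "F \<le> G \<Longrightarrow> fcol x F \<le> fcol x G"
  by (meson fmul_le_iff order.trans order_refl)

lemma fmul_mono: "P \<le> Q \<Longrightarrow> fmul x P \<le> fmul x Q"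
  by (meson fmul_le_iff order.trans order_refl)

lemma fcol_commute: "fcol x (fcol y F) = fcol y (fcol x F)"
  by (rule ext) (auto simp: fcol_def set_of_inject[symmetric] add_ac mult_ac)

lemma fmul_commute: "fmul x (fmul y P) = fmul y (fmul x P)"
proof -
  have "fmul x (fmul y P) \<le> F \<longleftrightarrow> fmul y (fmul x P) \<le> F" for F
    by (simp add: fmul_le_iff fcol_commute[of x])
  then show ?thesis by (meson antisym order_refl)
qed

lemma fmul_inf_fcol: "fmul x (inf P (fcol x F)) = inf (fmul x P) F"
proof (rule ext)
  fix d
  show "fmul x (inf P (fcol x F)) d = inf (fmul x P) F d"
    using gen_times_inf_colon[of "fst x" "P (d - snd x)" "F d"] by (simp add: fmul_def fcol_def)
qed

lemma fmul_funpow_inf: "(fmul x ^^ n) (inf P ((fcol x ^^ n) F)) = inf ((fmul x ^^ n) P) F"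
proof (induction n arbitrary: P)
  case (Suc n)
  have "(fmul x ^^ Suc n) (inf P ((fcol x ^^ Suc n) F)) = (fmul x ^^ n) (fmul x (inf P (fcol x ((fcol x ^^ n) F))))"
    by (simp only: funpow_Suc_right[of n "fmul x"] funpow.simps(2)[of n "fcol x"] o_def)
  also have "\<dots> = inf ((fmul x ^^ n) (fmul x P)) F"
    by (simp only: fmul_inf_fcol Suc.IH)
  finally show ?case by (simp only: funpow_Suc_right[of n "fmul x"] o_def)
qed simp

lemma fcol_funpow_mono: "F \<le> G \<Longrightarrow> (fcol x ^^ n) F \<le> (fcol x ^^ n) G"
  by (induction n) (auto intro: fcol_mono)

lemma fmul_funpow_mono: "F \<le> G \<Longrightarrow> (fmul x ^^ n) F \<le> (fmul x ^^ n) G"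
  by (induction n) (auto intro: fmul_mono)

lemma fcol_funpow_commute: "fcol y ((fcol x ^^ n) F) = (fcol x ^^ n) (fcol y F)"
proof (induction n)
  case (Suc n)
  then show ?case by (simp add: fcol_commute[of y x])
qed simp

lemma fmul_funpow_commute: "fmul y ((fmul x ^^ n) F) = (fmul x ^^ n) (fmul y F)"
proof (induction n)
  case (Suc n)
  then show ?case by (simp add: fmul_commute[of y x])
qed simp

text \<open>These families are the graded submodules over the algebra generated by
  \<open>ops\<close>. In this form, closure under meets, joins and quotients follows from the
  adjunction and from the commutation of operators.\<close>

definition stable :: "('a::comm_ring_1 \<times> 'g::cancel_comm_monoid_add) set \<Rightarrow> ('g \<Rightarrow> 'a ideal) \<Rightarrow> bool" where
  "stable ops P \<longleftrightarrow> (\<forall>x\<in>ops. P \<le> fcol x P)"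

lemma stableD: "stable ops P \<Longrightarrow> x \<in> ops \<Longrightarrow> P \<le> fcol x P"
  by (simp add: stable_def)

lemma stableI:
  "(\<And>x d. x \<in> ops \<Longrightarrow> gen (fst x) * P d \<le> P (d + snd x)) \<Longrightarrow> stable ops P"
  by (auto simp: stable_def le_fun_def fcol_def gen_times_le_iff)

lemma stable_fmul: "stable ops P \<Longrightarrow> x \<in> ops \<Longrightarrow> fmul x P \<le> P"
  by (simp add: stable_def fmul_le_iff)

lemma stable_inf:
  assumes "stable ops P" "stable ops Q"
  shows "stable ops (inf P Q)"
  unfolding stable_def fmul_le_iff[symmetric]
proof (intro ballI le_infI)
  fix x assume x: "x \<in> ops"
  show "fmul x (inf P Q) \<le> P"
    by (rule order.trans[OF fmul_mono[OF inf_le1] stable_fmul[OF assms(1) x]])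
  show "fmul x (inf P Q) \<le> Q"
    by (rule order.trans[OF fmul_mono[OF inf_le2] stable_fmul[OF assms(2) x]])
qed

lemma stable_sup:
  assumes "stable ops P" "stable ops Q"
  shows "stable ops (sup P Q)"
  unfolding stable_def
proof (intro ballI sup_least)
  fix x assume x: "x \<in> ops"
  show "P \<le> fcol x (sup P Q)"
    by (rule order.trans[OF stableD[OF assms(1) x] fcol_mono[OF sup_ge1]])
  show "Q \<le> fcol x (sup P Q)"
    by (rule order.trans[OF stableD[OF assms(2) x] fcol_mono[OF sup_ge2]])
qed

lemma stable_fcol_funpow:
  assumes "stable ops F"
  shows "stable ops ((fcol x ^^ n) F)"
  unfolding stable_def fcol_funpow_commute
  by (intro ballI fcol_funpow_mono stableD[OF assms])

lemma stable_fcol: "stable ops F \<Longrightarrow> stable ops (fcol x F)"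
  using stable_fcol_funpow[of ops F 1 x] by simp

lemma stable_fmul_funpow:
  assumes "stable ops F"
  shows "stable ops ((fmul x ^^ n) F)"
  unfolding stable_def fmul_le_iff[symmetric] fmul_funpow_commute
  by (intro ballI fmul_funpow_mono stable_fmul[OF assms])

lemma stable_fmul1: "stable ops F \<Longrightarrow> stable ops (fmul x F)"
  using stable_fmul_funpow[of ops F 1 x] by simp

lemma stable_SUP:
  assumes "\<And>i. i \<in> S \<Longrightarrow> stable ops (f i)"
  shows "stable ops (SUP i\<in>S. f i)"
  unfolding stable_def
proof (intro ballI SUP_least)
  fix x i assume "x \<in> ops" "i \<in> S"
  then have "f i \<le> fcol x (f i)" using assms by (blast intro: stableD)
  also have "\<dots> \<le> fcol x (SUP i\<in>S. f i)" using \<open>i \<in> S\<close> by (intro fcol_mono SUP_upper)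
  finally show "f i \<le> fcol x (SUP i\<in>S. f i)" .
qed

text \<open>The ascending chain condition for graded submodules of \<open>P\<close>; other
  submodules of the monoid algebra cannot be expressed by families.\<close>

definition noeth :: "('a::comm_ring_1 \<times> 'g::cancel_comm_monoid_add) set \<Rightarrow> ('g \<Rightarrow> 'a ideal) \<Rightarrow> bool" where
  "noeth ops P \<longleftrightarrow>
     (\<forall>Q :: nat \<Rightarrow> 'g \<Rightarrow> 'a ideal. mono Q \<and> (\<forall>n. stable ops (Q n) \<and> Q n \<le> P) \<longrightarrow> (\<exists>N. \<forall>n\<ge>N. Q n = Q N))"

lemma noethD:
  fixes Q :: "nat \<Rightarrow> 'g::cancel_comm_monoid_add \<Rightarrow> 'a::comm_ring_1 ideal"
  assumes "noeth ops P" "mono Q" "\<And>n. stable ops (Q n)" "\<And>n. Q n \<le> P"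
  shows "\<exists>N. \<forall>n\<ge>N. Q n = Q N"
  by (rule assms(1)[unfolded noeth_def, THEN spec[of _ Q], THEN mp]) (use assms(2-) in simp)

lemma noeth_le:
  assumes "noeth ops P" "P' \<le> P"
  shows "noeth ops P'"
  unfolding noeth_def
proof (intro allI impI, elim conjE)
  fix Q :: "nat \<Rightarrow> 'b \<Rightarrow> 'a ideal"
  assume Q: "mono Q" "\<forall>n. stable ops (Q n) \<and> Q n \<le> P'"
  have "Q n \<le> P" for n using Q(2) assms(2) by (blast intro: order.trans)
  with Q show "\<exists>N. \<forall>n\<ge>N. Q n = Q N" by (intro noethD[OF assms(1)]) simp_all
qed

section \<open>Hilbert's basis theorem for families\<close>

definition low :: "'a::comm_ring_1 \<times> 'g::cancel_comm_monoid_add \<Rightarrow> ('g \<Rightarrow> 'a ideal) \<Rightarrow> nat \<Rightarrow> 'g \<Rightarrow> 'a ideal" where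
  "low x P n = (SUP i\<in>{..<n}. (fmul x ^^ i) P)"

text \<open>The analogue of the polynomials in \<open>x\<close> over \<open>P\<close>, with
  \<open>low x P n\<close> as those of degree below \<open>n\<close>. The operator \<open>x\<close>
  is no free variable: different powers of it may meet in one degree of the grading.\<close>

definition adjoin :: "'a::comm_ring_1 \<times> 'g::cancel_comm_monoid_add \<Rightarrow> ('g \<Rightarrow> 'a ideal) \<Rightarrow> 'g \<Rightarrow> 'a ideal" where
  "adjoin x P = (SUP n. low x P n)"

lemma low_0 [simp]: "low x P 0 = bot"
  by (simp add: low_def)

lemma low_Suc: "low x P (Suc n) = sup (low x P n) ((fmul x ^^ n) P)"
  unfolding low_def lessThan_Suc SUP_insert by (rule sup_commute)

lemma low_mono: "i \<le> j \<Longrightarrow> low x P i \<le> low x P j"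
  unfolding low_def by (intro SUP_subset_mono) auto

lemma low_le_fcol: "low x P n \<le> fcol x (low x P (Suc n))"
proof -
  have "(fmul x ^^ i) P \<le> fcol x (low x P (Suc n))" if "i < n" for i
  proof -
    have "fmul x ((fmul x ^^ i) P) = (fmul x ^^ Suc i) P" by simp
    also have "\<dots> \<le> low x P (Suc n)"
      unfolding low_def using that by (intro SUP_upper) auto
    finally show ?thesis by (simp add: fmul_le_iff)
  qed
  then show ?thesis unfolding low_def[of x P n] by (intro SUP_least) auto
qed

lemma stable_low: "stable ops P \<Longrightarrow> stable ops (low x P n)"
  unfolding low_def by (intro stable_SUP stable_fmul_funpow)

lemma stable_adjoin:
  assumes "stable ops P"
  shows "stable (insert x ops) (adjoin x P)"
proof -
  have "adjoin x P \<le> fcol x (adjoin x P)"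
    unfolding adjoin_def
  proof (rule SUP_least)
    fix n
    have "low x P n \<le> fcol x (low x P (Suc n))" by (rule low_le_fcol)
    also have "\<dots> \<le> fcol x (SUP n. low x P n)" by (intro fcol_mono SUP_upper) simp
    finally show "low x P n \<le> fcol x (SUP n. low x P n)" .
  qed
  moreover have "stable ops (adjoin x P)"
    unfolding adjoin_def using assms by (intro stable_SUP stable_low)
  ultimately show ?thesis by (simp add: stable_def)
qed

lemma le_adjoin: "P \<le> adjoin x P"
proof -
  have "P = low x P (Suc 0)" by (simp add: low_Suc)
  also have "\<dots> \<le> adjoin x P" unfolding adjoin_def by (rule SUP_upper) simp
  finally show ?thesis .
qed

text \<open>\<open>P \<sqinter> (Q \<squnion> low x P n : x\<^sup>n)\<close> collects the leading coefficients of the elements of \<open>Q\<close> of degree at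
  most \<open>n\<close> in \<open>x\<close>, as in Hilbert's basis theorem.\<close>

lemma leading_coeffs_determine:
  assumes "Q \<le> Q'"
    and lc: "\<And>n. inf P ((fcol x ^^ n) (sup Q (low x P n))) = inf P ((fcol x ^^ n) (sup Q' (low x P n)))"
  shows "inf Q' (low x P n) \<le> Q"
proof (induction n)
  case (Suc n)
  let ?X = "(fmul x ^^ n) P" and ?F = "sup Q (low x P n)" and ?F' = "sup Q' (low x P n)"
  have X: "inf ?X ?F' = inf ?X ?F"
    using lc[of n] by (metis fmul_funpow_inf)
  \<comment> \<open>Elements of \<open>Q'\<close> of degree at most \<open>n\<close> in
    \<open>x\<close> share their leading terms with elements of \<open>Q\<close>; two applications
    of the modular law do the work of subtracting these.\<close>
  have "inf Q' (low x P (Suc n)) \<le> inf ?F' (sup ?X (low x P n))"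
    unfolding low_Suc by (intro inf_mono) (auto simp: sup_commute)
  also have "\<dots> \<le> sup (inf ?F' ?X) (low x P n)" by (intro modular) auto
  also have "\<dots> = sup (inf ?X ?F) (low x P n)" using X by (simp add: inf_commute)
  also have "\<dots> \<le> sup (low x P n) Q" by (simp add: le_infI2)
  finally have "inf Q' (low x P (Suc n)) \<le> inf Q' (sup (low x P n) Q)" by simp
  also have "\<dots> \<le> sup (inf Q' (low x P n)) Q" by (rule modular[OF assms(1)])
  also have "\<dots> \<le> Q" by (intro sup_least Suc.IH order_refl)
  finally show ?case .
qed (simp add: le_fun_def)

text \<open>The diagonal stops at some \<open>K\<close>, which settles all rows from
  \<open>K\<close> on; the finitely many other rows stop one by one.\<close>

lemma double_chain_stationary:
  fixes L :: "nat \<Rightarrow> nat \<Rightarrow> 'b::order"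
  assumes mono: "\<And>n n' k k'. n \<le> n' \<Longrightarrow> k \<le> k' \<Longrightarrow> L n k \<le> L n' k'"
    and acc: "\<And>f. mono (f :: nat \<Rightarrow> 'b) \<Longrightarrow> range f \<subseteq> range (case_prod L) \<Longrightarrow> \<exists>N. \<forall>n\<ge>N. f n = f N"
  shows "\<exists>N. \<forall>n. \<forall>k\<ge>N. L n k = L n N"
proof -
  have "\<exists>K. \<forall>k\<ge>K. L k k = L K K"
    by (rule acc[of "\<lambda>k. L k k"]) (auto simp: mono_def intro: mono)
  then obtain K where K: "\<forall>k\<ge>K. L k k = L K K" by (rule exE)
  have "\<forall>n. \<exists>N. \<forall>k\<ge>N. L n k = L n N"
    by (rule allI, rule acc) (auto simp: mono_def intro: mono)
  from choice[OF this] obtain g where g: "\<forall>n. \<forall>k\<ge>g n. L n k = L n (g n)" by (rule exE)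
  define N where "N = max K (Max (insert 0 (g ` {..<K})))"
  have "L n k = L n N" if "k \<ge> N" for n k
  proof (cases "n < K")
    case True
    then have "g n \<le> Max (insert 0 (g ` {..<K}))" by (intro Max_ge) auto
    then have "g n \<le> N" by (simp add: N_def)
    with that have "g n \<le> k" by simp
    have "L n k = L n (g n)" using g \<open>g n \<le> k\<close> by blast
    also have "\<dots> = L n N" by (rule sym) (use g \<open>g n \<le> N\<close> in blast)
    finally show ?thesis .
  next
    case False
    have "L n j = L K K" if "j \<ge> N" for j
    proof (rule antisym)
      have "L n j \<le> L (max n j) (max n j)" by (intro mono) auto
      also have "\<dots> = L K K" by (rule K[rule_format]) (use False in auto)
      finally show "L n j \<le> L K K" .
      show "L K K \<le> L n j" using that False by (intro mono) (auto simp: N_def)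
    qed
    from this[OF that] this[OF order_refl] show ?thesis by (rule trans[OF _ sym])
  qed
  then show ?thesis by (intro exI allI impI)
qed

context noetherian begin

text \<open>In a single degree the filtration consists of ideals of the noetherian base ring. A
  common \<open>n\<close> for all degrees need not exist.\<close>

lemma adjoin_attained:
  fixes P :: "'g::cancel_comm_monoid_add \<Rightarrow> 'a ideal"
  shows "\<exists>n. adjoin x P d = low x P n d"
proof -
  have "mono (\<lambda>n. low x P n d)"
    by (intro monoI le_funD[OF low_mono])
  from ascending_stationary[OF this]
  obtain N where N: "\<forall>n\<ge>N. low x P n d = low x P N d" by (rule exE)
  have "low x P n d \<le> low x P N d" for n
  proof (cases "n \<ge> N")
    case True
    with N have "low x P n d = low x P N d" by blast
    then show ?thesis by (rule eq_refl)
  next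
    case False then show ?thesis by (intro le_funD[OF low_mono]) simp
  qed
  then have "adjoin x P d \<le> low x P N d"
    unfolding adjoin_def SUP_apply by (intro SUP_least)
  moreover have "low x P N d \<le> adjoin x P d"
    unfolding adjoin_def SUP_apply by (intro SUP_upper UNIV_I)
  ultimately have "adjoin x P d = low x P N d" by (rule antisym)
  then show ?thesis by (rule exI)
qed

text \<open>Hilbert's basis theorem. The families of leading coefficients increase both with the
  degree \<open>n\<close> and with the chain index \<open>k\<close>, so inside \<open>P\<close> they
  stop uniformly in \<open>n\<close>; by \<open>leading_coeffs_determine\<close> the given chain
  stops there too.\<close>

theorem noeth_adjoin:
  fixes P :: "'g::cancel_comm_monoid_add \<Rightarrow> 'a ideal"
  assumes P: "noeth ops P" "stable ops P"
  shows "noeth (insert x ops) (adjoin x P)"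
  unfolding noeth_def
proof (intro allI impI, elim conjE)
  fix Q :: "nat \<Rightarrow> 'g \<Rightarrow> 'a ideal"
  assume mono: "mono Q" and Q: "\<forall>n. stable (insert x ops) (Q n) \<and> Q n \<le> adjoin x P"
  have Qx: "Q k \<le> fcol x (Q k)" and Qops: "stable ops (Q k)" for k
    using Q by (auto simp: stable_def)
  define L where "L n k = inf P ((fcol x ^^ n) (sup (Q k) (low x P n)))" for n k
  have stL: "stable ops (L n k)" for n k
    unfolding L_def using P Qops by (intro stable_inf stable_fcol_funpow stable_sup stable_low)
  have mk: "L n k \<le> L n k'" if "k \<le> k'" for n k k'
    unfolding L_def using monoD[OF mono that]
    by (intro inf_mono order_refl fcol_funpow_mono sup_mono)
  have mn: "L n k \<le> L (Suc n) k" for n k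
  proof -
    have "sup (Q k) (low x P n) \<le> fcol x (sup (Q k) (low x P (Suc n)))"
    proof (rule sup_least)
      show "Q k \<le> fcol x (sup (Q k) (low x P (Suc n)))"
        using Qx by (rule order.trans) (simp add: fcol_mono)
      show "low x P n \<le> fcol x (sup (Q k) (low x P (Suc n)))"
        using low_le_fcol by (rule order.trans) (simp add: fcol_mono)
    qed
    then have "(fcol x ^^ n) (sup (Q k) (low x P n)) \<le> (fcol x ^^ n) (fcol x (sup (Q k) (low x P (Suc n))))"
      by (rule fcol_funpow_mono)
    then show ?thesis unfolding L_def funpow_Suc_right o_def by (rule inf_mono[OF order_refl])
  qed
  have "\<exists>N. \<forall>n. \<forall>k\<ge>N. L n k = L n N"
  proof (rule double_chain_stationary)
    fix n n' k k' :: nat assume "n \<le> n'" "k \<le> k'"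
    have "L n k \<le> L n' k" by (rule lift_Suc_mono_le[of "\<lambda>n. L n k", OF mn \<open>n \<le> n'\<close>])
    also have "\<dots> \<le> L n' k'" by (rule mk[OF \<open>k \<le> k'\<close>])
    finally show "L n k \<le> L n' k'" .
  next
    fix f :: "nat \<Rightarrow> 'g \<Rightarrow> 'a ideal" assume f: "mono f" "range f \<subseteq> range (case_prod L)"
    have "stable ops (f n) \<and> f n \<le> P" for n
    proof -
      have "f n \<in> range (case_prod L)" using f(2) by auto
      then obtain i k where "f n = L i k" by auto
      moreover have "L i k \<le> P" by (simp add: L_def)
      ultimately show ?thesis using stL by simp
    qed
    then show "\<exists>N. \<forall>n\<ge>N. f n = f N" by (intro noethD[OF P(1) f(1)]) simp_all
  qed
  then obtain N where N: "\<forall>n. \<forall>k\<ge>N. L n k = L n N" by (rule exE)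
  have "Q k = Q N" if "k \<ge> N" for k
  proof (rule antisym)
    show "Q N \<le> Q k" using mono that by (rule monoD)
    show "Q k \<le> Q N"
    proof (rule le_funI)
      fix d
      obtain n where n: "adjoin x P d = low x P n d" using adjoin_attained by (rule exE)
      have "inf (Q k) (low x P n) \<le> Q N"
      proof (rule leading_coeffs_determine)
        show "Q N \<le> Q k" by fact
        show "inf P ((fcol x ^^ n) (sup (Q N) (low x P n))) = inf P ((fcol x ^^ n) (sup (Q k) (low x P n)))" for n
          using N[rule_format, OF that, of n] unfolding L_def by (rule sym)
      qed
      then have "inf (Q k d) (low x P n d) \<le> Q N d" by (simp add: le_fun_def)
      moreover have "Q k d \<le> low x P n d" unfolding n[symmetric] by (rule le_funD) (use Q in simp)
      ultimately show "Q k d \<le> Q N d" by (simp add: inf_absorb1)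
    qed
  qed
  then show "\<exists>N. \<forall>n\<ge>N. Q n = Q N" by (intro exI allI impI)
qed

definition unit_fam :: "'g::cancel_comm_monoid_add \<Rightarrow> 'a ideal" where
  "unit_fam d = (if d = 0 then top else bot)"

lemma noeth_unit_fam: "noeth {} (unit_fam :: 'g::cancel_comm_monoid_add \<Rightarrow> 'a ideal)"
  unfolding noeth_def
proof (intro allI impI, elim conjE)
  fix Q :: "nat \<Rightarrow> 'g \<Rightarrow> 'a ideal"
  assume m: "mono Q" and Q: "\<forall>n. stable {} (Q n) \<and> Q n \<le> unit_fam"
  have "mono (\<lambda>n. Q n 0)" using m by (auto simp: mono_def le_fun_def)
  then obtain N where N: "\<forall>n\<ge>N. Q n 0 = Q N 0" using ascending_stationary by blast
  have b: "Q n d = bot" if "d \<noteq> 0" for n d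
  proof -
    have "Q n d \<le> unit_fam d" using Q by (auto simp: le_fun_def)
    then show ?thesis using that by (simp add: unit_fam_def bot_unique)
  qed
  have "Q n = Q N" if "n \<ge> N" for n
  proof (rule ext)
    fix d show "Q n d = Q N d"
    proof (cases "d = 0")
      case True then show ?thesis using N that by blast
    next
      case False then show ?thesis by (simp add: b)
    qed
  qed
  then show "\<exists>N. \<forall>n\<ge>N. Q n = Q N" by (intro exI allI impI)
qed

text \<open>The hypothesis says that \<open>P\<close> lies in the algebra generated by
  \<open>xs\<close> over the base ring in degree 0. Stated this way it fits Rees algebras without a
  formula for the result of adjoining the generators one at a time.\<close>

lemma noeth_generated:
  fixes xs :: "('a \<times> 'g::cancel_comm_monoid_add) list"
  assumes "\<And>G. stable (set xs) G \<Longrightarrow> G 0 = top \<Longrightarrow> P \<le> G"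
  shows "noeth (set xs) P"
proof -
  define G where "G = foldr adjoin xs unit_fam"
  have G: "noeth (set xs) G \<and> stable (set xs) G \<and> unit_fam \<le> G"
    unfolding G_def
  proof (induction xs)
    case (Cons x xs)
    let ?G = "foldr adjoin xs unit_fam"
    have "unit_fam \<le> adjoin x ?G" using Cons by (intro order.trans[OF _ le_adjoin]) simp
    with Cons show ?case by (simp add: noeth_adjoin stable_adjoin)
  qed (simp add: noeth_unit_fam stable_def)
  then have "unit_fam \<le> G" by simp
  from le_funD[OF this, of 0] have "G 0 = top" by (simp add: unit_fam_def top_unique)
  with G have "P \<le> G" by (intro assms) simp_all
  with G show ?thesis by (intro noeth_le[of _ G P]) simp_all
qed

end

section \<open>Dimension\<close>

lemma spn_times_le_iff: "spn A * B \<le> J \<longleftrightarrow> (\<forall>a\<in>A. B \<le> colon J a)"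
proof -
  have "spn A * B \<le> J \<longleftrightarrow> (\<forall>b\<in>set_of B. spn A \<le> colon J b)"
    by (simp only: mult.commute[of "spn A"] times_le_colon)
  also have "\<dots> \<longleftrightarrow> (\<forall>a\<in>A. B \<le> colon J a)"
    unfolding spn_le_iff less_eq_ideal_def[of B] subset_iff set_of_colon mem_Collect_eq
    by (intro iffI ballI allI impI; subst mult.commute; blast)
  finally show ?thesis .
qed

locale noeth_local = noetherian ty for ty :: "'a::comm_ring_1 itself" +
  fixes m :: "'a ideal"
  assumes m_ne_top: "m \<noteq> top" and le_m: "J \<noteq> top \<Longrightarrow> J \<le> m"
begin

section \<open>The Rees algebra of \<open>m\<close> and the Artin-Rees lemma\<close>

lemma noeth_powers: "\<exists>A. m = spn A \<and> noeth ((\<lambda>a. (a, 1 :: nat)) ` A) (\<lambda>n. m ^ n)"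
proof -
  obtain A where A: "finite A" "m = spn A" by (rule finite_generators)
  obtain as where as: "set as = A" using finite_list[OF A(1)] by blast
  have "noeth (set (map (\<lambda>a. (a, 1 :: nat)) as)) (\<lambda>n. m ^ n)"
  proof (rule noeth_generated, rule le_funI)
    fix G :: "nat \<Rightarrow> 'a ideal" and n
    assume G: "stable (set (map (\<lambda>a. (a, 1)) as)) G" "G 0 = top"
    show "m ^ n \<le> G n"
    proof (induction n)
      case (Suc n)
      have "m ^ n \<le> colon (G (Suc n)) a" if "a \<in> A" for a
      proof -
        have "G \<le> fcol (a, 1) G" using G(1) that as by (intro stableD) auto
        then have "G n \<le> colon (G (Suc n)) a" by (auto simp: le_fun_def fcol_def)
        with Suc.IH show ?thesis by simp
      qed
      then have "spn A * m ^ n \<le> G (Suc n)" by (simp add: spn_times_le_iff)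
      then show ?case using A by simp
    qed (simp add: G)
  qed
  with A as show ?thesis by auto
qed

lemma Artin_Rees: "\<exists>c. \<forall>n\<ge>c. inf B (m ^ n) \<le> m ^ (n - c) * B"
proof -
  obtain A where A: "m = spn A" "noeth ((\<lambda>a. (a, 1 :: nat)) ` A) (\<lambda>n. m ^ n)"
    using noeth_powers by blast
  \<comment> \<open>\<open>Q k\<close> is the graded submodule of the Rees algebra that consists of
    the intersections up to degree \<open>k\<close> and is generated by the last one beyond. These
    increase with \<open>k\<close>, and the index where they stop is the Artin-Rees number.\<close>
  define Q where "Q k n = (if n \<le> k then inf B (m ^ n) else m ^ (n - k) * inf B (m ^ k))" for k n
  have step: "m * inf B (m ^ n) \<le> inf B (m ^ Suc n)" for n
    unfolding power_Suc
    by (intro le_infI order.trans[OF ideal_times_le2 inf_le1] ideal_times_mono order_refl inf_le2)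
  have "\<exists>N. \<forall>k\<ge>N. Q k = Q N"
  proof (rule noethD[OF A(2)])
    show "mono Q"
    proof (rule mono_iff_le_Suc[THEN iffD2], intro allI le_funI)
      fix k n
      consider "n \<le> k" | "n = Suc k" | "n > Suc k" by linarith
      then show "Q k n \<le> Q (Suc k) n"
      proof cases
        case 3
        have "Q k n = m ^ (n - Suc k) * (m * inf B (m ^ k))"
          using 3 by (simp add: Q_def Suc_diff_Suc flip: mult.assoc power_Suc2)
        also have "\<dots> \<le> Q (Suc k) n"
          using 3 step[of k] by (simp add: Q_def ideal_times_mono)
        finally show ?thesis .
      qed (use step in \<open>auto simp: Q_def\<close>)
    qed
    show "stable ((\<lambda>a. (a, 1)) ` A) (Q k)" for k
    proof (rule stableI)
      fix x n assume "x \<in> (\<lambda>a. (a, 1 :: nat)) ` A"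
      then obtain a where a: "x = (a, 1)" "a \<in> A" by auto
      have am: "gen a \<le> m" using a(2) unfolding A(1) by (simp add: set_of_spn self_module.span_base)
      have "gen a * Q k n \<le> m * Q k n" using am by (intro ideal_times_mono) auto
      also have "\<dots> \<le> Q k (Suc n)"
      proof (cases "n < k")
        case True
        then show ?thesis using step[of n] by (simp add: Q_def)
      next
        case False
        then show ?thesis by (auto simp: Q_def Suc_diff_le mult.assoc)
      qed
      finally show "gen (fst x) * Q k n \<le> Q k (n + snd x)" by (simp add: a)
    qed
    show "Q k \<le> (\<lambda>n. m ^ n)" for k
    proof (rule le_funI)
      fix n
      have "m ^ (n - k) * inf B (m ^ k) \<le> m ^ (n - k) * m ^ k" by (intro ideal_times_mono) auto
      then show "Q k n \<le> m ^ n" by (auto simp: Q_def simp flip: power_add)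
    qed
  qed
  then obtain c where c: "\<forall>k\<ge>c. Q k = Q c" by (rule exE)
  have "inf B (m ^ n) \<le> m ^ (n - c) * B" if "n \<ge> c" for n
  proof -
    have "inf B (m ^ n) = Q n n" by (simp add: Q_def)
    also have "\<dots> = Q c n" by (rule fun_cong[OF c[rule_format, OF that]])
    also have "\<dots> \<le> m ^ (n - c) * B" using that by (auto simp: Q_def ideal_one_eq_top intro: ideal_times_mono)
    finally show ?thesis .
  qed
  then show ?thesis by blast
qed

text \<open>If \<open>x y = p + w\<close> with \<open>w\<close> in \<open>m^n\<close>, Artin-Rees
  for the ideal \<open>(x) + P\<close> writes \<open>w\<close> as \<open>x z + q\<close> with
  \<open>z\<close> in \<open>m^(n-c)\<close> and \<open>q\<close> in \<open>P\<close>. As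
  \<open>x\<close> is no zero divisor modulo \<open>P\<close>, the difference \<open>y - z\<close>
  lies in \<open>P\<close>.\<close>

lemma prime_colon_power:
  assumes P: "prime_id P" "x \<notin> set_of P"
  shows "\<exists>c. \<forall>n\<ge>c. colon (sup P (m ^ n)) x \<le> sup P (m ^ (n - c))"
proof -
  obtain c where c: "\<And>n. n \<ge> c \<Longrightarrow> inf (sup (gen x) P) (m ^ n) \<le> m ^ (n - c) * sup (gen x) P"
    using Artin_Rees[of "sup (gen x) P"] by blast
  have "colon (sup P (m ^ n)) x \<le> sup P (m ^ (n - c))" if "n \<ge> c" for n
  proof (rule ideal_leI)
    fix y assume "y \<in> set_of (colon (sup P (m ^ n)) x)"
    then obtain p w where pw: "p \<in> set_of P" "w \<in> set_of (m ^ n)" "x * y = p + w"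
      by (auto elim: sup_memE)
    have "x * y + (- p) \<in> set_of (sup (gen x) P)"
      using pw(1) ideal_diff[of 0 P p] by (intro sup_memI ideal_mult_right) auto
    moreover have "x * y + (- p) = w" using pw(3) by simp
    ultimately have "w \<in> set_of (inf (sup (gen x) P) (m ^ n))" using pw(2) by simp
    with c[OF that] have "w \<in> set_of (m ^ (n - c) * sup (gen x) P)" by (rule ideal_leD)
    then have "w \<in> set_of (sup (gen x * m ^ (n - c)) (m ^ (n - c) * P))"
      by (simp add: times_sup mult.commute)
    then obtain z q where z: "z \<in> set_of (m ^ (n - c))" "q \<in> set_of (m ^ (n - c) * P)" "w = x * z + q"
      by (auto elim!: sup_memE simp: set_of_gen_times)
    have "q \<in> set_of P" using ideal_leD[OF ideal_times_le2 z(2)] .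
    moreover have "x * (y - z) = p + q" using pw(3) z(3) by (simp add: right_diff_distrib)
    ultimately have "x * (y - z) \<in> set_of P" using pw(1) by (simp add: ideal_add)
    then have "y - z \<in> set_of P" using P by (auto simp: prime_id_def)
    then have "(y - z) + z \<in> set_of (sup P (m ^ (n - c)))" using z(1) by (rule sup_memI)
    then show "y \<in> set_of (sup P (m ^ (n - c)))" by simp
  qed
  then show ?thesis by blast
qed

lemma prime_m: "prime_id m"
  unfolding prime_id_def
proof (intro conjI allI impI m_ne_top)
  fix a b assume ab: "a * b \<in> set_of m"
  show "a \<in> set_of m \<or> b \<in> set_of m"
  proof (rule disjCI)
    assume "b \<notin> set_of m"
    then have "\<not> sup m (gen b) \<le> m" by simp
    then have "sup m (gen b) = top" using le_m by blast
    then have "1 \<in> set_of (sup m (gen b))" by simp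
    then obtain u c where u: "u \<in> set_of m" "1 = u + c * b"
      by (auto elim!: sup_memE simp: set_of_gen)
    have "a * u + c * (a * b) \<in> set_of m" by (rule ideal_add[OF ideal_mult[OF u(1)] ideal_mult[OF ab]])
    also have "a * u + c * (a * b) = a * (u + c * b)" by (simp add: algebra_simps)
    finally show "a \<in> set_of m" by (simp flip: u(2))
  qed
qed

lemma len_m_top: "len m top \<le> 1"
proof (rule clen_least)
  fix n assume ch: "(chain_step UNIV ^^ n) m (top :: 'a ideal)"
  show "enat n \<le> 1"
  proof (rule ccontr)
    assume "\<not> enat n \<le> 1"
    then obtain k where "n = Suc (Suc k)"
      by (cases n; cases "n - 1") (auto simp: one_enat_def)
    with ch obtain z w where z: "(chain_step UNIV ^^ k) m z" "z < w" "w < (top :: 'a ideal)" by auto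
    have "m \<le> z" using z(1) by (rule chain_le)
    moreover have "w \<le> m" using z(3) by (intro le_m) auto
    ultimately show False using z(2) by simp
  qed
qed

text \<open>Lengths in the exact sequence R/(J : x) -> R/J -> R/(J + (x)), whose first map is
  multiplication by \<open>x\<close>.\<close>

lemma len_top_colon:
  "len J top = len (colon J x) top + len (sup J (gen x)) (top :: 'a ideal)"
  using len_add[of J "sup J (gen x)" top] len_sup_gen_times[of J x top] by simp

text \<open>The Hilbert-Samuel function of R/J. It is valued in \<open>enat\<close> because
  finiteness is itself a consequence of the bound \<open>chi_le_dim\<close>.\<close>

definition chi :: "'a ideal \<Rightarrow> nat \<Rightarrow> enat" where
  "chi J n = len (sup J (m ^ n)) top"

lemma chi_antimono: "J \<le> K \<Longrightarrow> chi K n \<le> chi J n"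
  unfolding chi_def by (intro len_top_antimono sup_mono order_refl)

lemma chi_mono: "i \<le> j \<Longrightarrow> chi J i \<le> chi J j"
  unfolding chi_def by (intro len_top_antimono sup_mono order_refl ideal_power_antimono)

lemma chi_0 [simp]: "chi J 0 = 0"
  by (simp add: chi_def ideal_one_eq_top)

lemma chi_colon: "chi J n = len (colon (sup J (m ^ n)) x) top + chi (sup J (gen x)) n"
  unfolding chi_def by (subst len_top_colon[of _ x]) (simp add: sup_aci)

definition prime_chain :: "'a ideal \<Rightarrow> nat \<Rightarrow> bool" where
  "prime_chain J n \<longleftrightarrow>
     (\<exists>P. J \<le> P 0 \<and> (\<forall>i\<le>n. prime_id (P i)) \<and> (\<forall>i<n. P i < (P (Suc i) :: 'a ideal)))"

lemma prime_chain_antimono: "J \<le> K \<Longrightarrow> prime_chain K n \<Longrightarrow> prime_chain J n"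
  unfolding prime_chain_def by (meson order.trans)

lemma prime_chain_Cons:
  assumes "prime_id P" "P < J" "prime_chain J n"
  shows "prime_chain P (Suc n)"
proof -
  obtain F where F: "J \<le> F 0" "\<forall>i\<le>n. prime_id (F i)" "\<forall>i<n. F i < F (Suc i)"
    using assms(3) unfolding prime_chain_def by blast
  show ?thesis unfolding prime_chain_def
    by (intro exI[of _ "case_nat P F"])
      (use F assms in \<open>auto split: nat.split simp: less_Suc_eq_0_disj\<close>)
qed

text \<open>A proper ideal that is not prime contains a product \<open>a b\<close> of elements
  outside it; then \<open>J + (a)\<close> and \<open>J : a\<close> are both larger and have no
  longer chains of primes above them. A prime \<open>J\<close> can be put in front of any chain
  above \<open>J + (x)\<close>, so there the exponent drops by one, and summation over
  \<open>n\<close> restores it.\<close>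

theorem chi_le_dim:
  assumes "\<And>n. prime_chain J n \<Longrightarrow> n \<le> k"
  shows "\<exists>C. \<forall>n. chi J n \<le> enat (C * (n + 1) ^ k)"
  using assms
proof (induction J arbitrary: k rule: noetherian_induct)
  case (less J)
  consider "J = top" | "J \<noteq> top" "\<not> prime_id J" | "J = m" | "prime_id J" "J \<noteq> m"
    by blast
  then show ?case
  proof cases
    case 1
    then show ?thesis by (intro exI[of _ 0]) (simp add: chi_def zero_enat_def[symmetric])
  next
    case 2
    then obtain a b where ab: "a * b \<in> set_of J" "a \<notin> set_of J" "b \<notin> set_of J"
      by (auto simp: prime_id_def)
    have lt1: "J < sup J (gen a)" using ab(2) by (simp add: less_le_not_le)
    have le2: "J \<le> colon J a" by (rule ideal_leI) (simp add: ideal_mult)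
    have "b \<in> set_of (colon J a)" using ab(1) by simp
    with ab(3) have "\<not> colon J a \<le> J" by (blast dest: ideal_leD)
    then have lt2: "J < colon J a" using le2 by (simp add: less_le_not_le)
    obtain C1 where C1: "\<And>n. chi (sup J (gen a)) n \<le> enat (C1 * (n + 1) ^ k)"
      using less.IH[OF lt1, of k] less.prems prime_chain_antimono[OF less_imp_le[OF lt1]] by blast
    obtain C2 where C2: "\<And>n. chi (colon J a) n \<le> enat (C2 * (n + 1) ^ k)"
      using less.IH[OF lt2, of k] less.prems prime_chain_antimono[OF le2] by blast
    have "chi J n \<le> enat ((C1 + C2) * (n + 1) ^ k)" for n
    proof -
      have "sup (colon J a) (m ^ n) \<le> colon (sup J (m ^ n)) a"
      proof (rule sup_least)
        show "colon J a \<le> colon (sup J (m ^ n)) a"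
          by (rule ideal_leI) (auto intro: ideal_leD[OF sup_ge1])
        show "m ^ n \<le> colon (sup J (m ^ n)) a"
          by (rule ideal_leI) (auto intro!: ideal_leD[OF sup_ge2] ideal_mult)
      qed
      then have "len (colon (sup J (m ^ n)) a) top \<le> chi (colon J a) n"
        unfolding chi_def by (rule len_top_antimono)
      then have "chi J n \<le> chi (colon J a) n + chi (sup J (gen a)) n"
        unfolding chi_colon[of J n a] by (rule add_right_mono)
      also have "\<dots> \<le> enat (C2 * (n + 1) ^ k) + enat (C1 * (n + 1) ^ k)"
        using C1 C2 by (intro add_mono)
      finally show ?thesis by (simp add: algebra_simps)
    qed
    then show ?thesis by blast
  next
    case 3
    have "chi J n \<le> enat (1 * (n + 1) ^ k)" for n
    proof -
      have "chi J n \<le> len m top" unfolding chi_def 3 by (rule len_top_antimono) simp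
      also have "\<dots> \<le> 1" by (rule len_m_top)
      also have "\<dots> \<le> enat (1 * (n + 1) ^ k)" by (simp add: one_enat_def Suc_le_eq)
      finally show ?thesis .
    qed
    then show ?thesis by blast
  next
    case 4
    then have "J \<le> m" by (intro le_m) (auto simp: prime_id_def)
    with 4 have Jm: "J < m" by simp
    then obtain x where x: "x \<in> set_of m" "x \<notin> set_of J"
      by (auto simp: less_ideal_def)
    have lt: "J < sup J (gen x)" using x(2) by (simp add: less_le_not_le)
    \<comment> \<open>The chain \<open>J < m\<close> of primes shows \<open>k \<ge> 1\<close>, so
      that \<open>k - 1\<close> below is not truncated.\<close>
    have "prime_chain m 0" using prime_m by (auto simp: prime_chain_def)
    then have "prime_chain J 1" using prime_chain_Cons[OF 4(1) Jm] by simp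
    then have k: "k \<ge> 1" by (rule less.prems)
    have "n \<le> k - 1" if "prime_chain (sup J (gen x)) n" for n
      using less.prems[OF prime_chain_Cons[OF 4(1) lt that]] by simp
    then obtain C where C: "\<And>n. chi (sup J (gen x)) n \<le> enat (C * (n + 1) ^ (k - 1))"
      using less.IH[OF lt, of "k - 1"] by blast
    have "chi J n \<le> enat (C * (n + 1) ^ k)" for n
    proof (induction n)
      case (Suc n)
      have "sup J (m ^ n) \<le> colon (sup J (m ^ Suc n)) x"
      proof (rule sup_least)
        show "J \<le> colon (sup J (m ^ Suc n)) x"
          by (rule ideal_leI) (auto intro!: ideal_leD[OF sup_ge1] ideal_mult simp del: power_Suc)
        show "m ^ n \<le> colon (sup J (m ^ Suc n)) x"
          using x(1) by (intro ideal_leI) (auto intro!: ideal_leD[OF sup_ge2] times_memI)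
      qed
      then have "len (colon (sup J (m ^ Suc n)) x) top \<le> chi J n"
        unfolding chi_def by (rule len_top_antimono)
      then have "chi J (Suc n) \<le> chi J n + chi (sup J (gen x)) (Suc n)"
        unfolding chi_colon[of J "Suc n" x] by (rule add_right_mono)
      also have "\<dots> \<le> enat (C * (n + 1) ^ k) + enat (C * (Suc n + 1) ^ (k - 1))"
        by (intro add_mono Suc.IH C)
      also have "\<dots> \<le> enat (C * (Suc n + 1) ^ k)"
      proof -
        have "(n + 1) ^ k = (n + 1) * (n + 1) ^ (k - 1)" using k by (cases k) auto
        also have "\<dots> \<le> (n + 1) * (Suc n + 1) ^ (k - 1)"
          by (intro mult_left_mono power_mono) auto
        finally have "(n + 1) ^ k + (Suc n + 1) ^ (k - 1) \<le> (Suc n + 1) * (Suc n + 1) ^ (k - 1)"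
          by simp
        also have "\<dots> = (Suc n + 1) ^ k" using k by (cases k) auto
        finally show ?thesis by (simp flip: distrib_left)
      qed
      finally show ?case .
    qed simp
    then show ?thesis by blast
  qed
qed

text \<open>The recursion is summed in steps of a fixed size, and Pascal's rule turns the increments
  into a binomial coefficient. The scale \<open>C\<close> collects the Artin-Rees losses along the
  chain of primes.\<close>

theorem chi_ge_dim:
  assumes "prime_chain J n"
  shows "\<exists>C\<ge>1. \<forall>s\<ge>1. enat (s choose n) \<le> chi J (C * s)"
  using assms
proof (induction n arbitrary: J)
  case 0
  then obtain P where P: "J \<le> P" "prime_id P" by (auto simp: prime_chain_def)
  have "enat (s choose 0) \<le> chi J (1 * s)" if "s \<ge> 1" for s
  proof -
    have "J \<le> m" using P le_m[of P] by (auto simp: prime_id_def)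
    moreover have "m ^ s \<le> m" using ideal_power_antimono[of 1 s m] that by simp
    moreover have "m < top" using m_ne_top by (simp add: top.not_eq_extremum)
    ultimately have "sup J (m ^ s) < top" by (meson le_less_trans le_sup_iff)
    then show ?thesis
      using clen_ge_1[of "sup J (m ^ s)" UNIV top] by (simp add: chi_def one_enat_def)
  qed
  then show ?case by blast
next
  case (Suc n)
  then obtain F where F: "J \<le> F 0" "\<forall>i\<le>Suc n. prime_id (F i)" "\<forall>i<Suc n. F i < F (Suc i)"
    unfolding prime_chain_def by blast
  define P where "P = F 0"
  have P: "prime_id P" "J \<le> P" "P < F 1" using F by (auto simp: P_def)
  then obtain x where x: "x \<in> set_of (F 1)" "x \<notin> set_of P" by (auto simp: less_ideal_def)
  define K where "K = sup P (gen x)"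
  have "K \<le> F 1" using P x by (simp add: K_def)
  then have "prime_chain K n" unfolding prime_chain_def
    using F by (intro exI[of _ "\<lambda>i. F (Suc i)"]) auto
  then obtain C where C: "C \<ge> 1" "\<And>s. s \<ge> 1 \<Longrightarrow> enat (s choose n) \<le> chi K (C * s)"
    using Suc.IH by blast
  obtain c where c: "\<And>t. t \<ge> c \<Longrightarrow> colon (sup P (m ^ t)) x \<le> sup P (m ^ (t - c))"
    using prime_colon_power[OF P(1) x(2)] by blast
  have rec: "chi P (t - c) + chi K t \<le> chi P t" if "t \<ge> c" for t
    unfolding chi_colon[of P t x] K_def[symmetric]
    unfolding chi_def[of P] using c[OF that] by (intro add_right_mono len_top_antimono)
  \<comment> \<open>A step of at least \<open>c\<close> makes up for the Artin-Rees loss, and one of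
    at least \<open>C\<close> keeps the bound for \<open>K\<close> usable.\<close>
  define D where "D = max C c"
  have "enat (s choose Suc n) \<le> chi P (D * s)" for s
  proof (induction s)
    case (Suc s)
    have "enat (s choose Suc n) + enat (Suc s choose n) \<le> chi P (D * Suc s - c) + chi K (D * Suc s)"
    proof (rule add_mono)
      note Suc.IH
      also have "chi P (D * s) \<le> chi P (D * Suc s - c)"
        by (rule chi_mono) (simp add: D_def)
      finally show "enat (s choose Suc n) \<le> chi P (D * Suc s - c)" .
      have "enat (Suc s choose n) \<le> chi K (C * Suc s)" by (rule C) simp
      also have "\<dots> \<le> chi K (D * Suc s)" by (intro chi_mono mult_right_mono) (auto simp: D_def)
      finally show "enat (Suc s choose n) \<le> chi K (D * Suc s)" .
    qed
    also have "\<dots> \<le> chi P (D * Suc s)" by (rule rec) (simp add: D_def)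
    finally have "enat ((s choose Suc n) + (Suc s choose n)) \<le> chi P (D * Suc s)" by simp
    \<comment> \<open>Pascal's rule, with \<open>s choose n\<close> bounded by
      \<open>Suc s choose n\<close>.\<close>
    moreover have "Suc s choose Suc n \<le> (s choose Suc n) + (Suc s choose n)"
      by (cases n) auto
    ultimately show ?case by (meson enat_ord_simps(1) order.trans)
  qed (simp add: zero_enat_def[symmetric])
  moreover have "chi P t \<le> chi J t" for t using P(2) by (rule chi_antimono)
  ultimately have "\<forall>s\<ge>1. enat (s choose Suc n) \<le> chi J (D * s)" by (meson order.trans)
  then show ?case using C(1) by (intro exI[of _ D]) (simp add: D_def)
qed

end


section \<open>Hilbert functions\<close>

text \<open>Multiplication of the generating function of \<open>f\<close> by X^g.\<close>

definition sh :: "'g::cancel_comm_monoid_add \<Rightarrow> ('g \<Rightarrow> int) \<Rightarrow> 'g \<Rightarrow> int" where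
  "sh g f d = (if d - g + g = d then f (d - g) else 0)"

text \<open>\<open>hs [g\<^sub>1, \<dots>, g\<^sub>k] f\<close> says that the generating function of \<open>f\<close> is a polynomial divided by
  \<open>(1 - X\<^bsup>g\<^sub>1\<^esup>) \<cdots> (1 - X\<^bsup>g\<^sub>k\<^esup>)\<close>.\<close>

primrec hs :: "'g::cancel_comm_monoid_add list \<Rightarrow> ('g \<Rightarrow> int) \<Rightarrow> bool" where
  "hs [] f \<longleftrightarrow> finite {d. f d \<noteq> 0}"
| "hs (g # L) f \<longleftrightarrow> hs L (\<lambda>d. f d - sh g f d)"

lemma sh_add [simp]: "sh g f (d + g) = f d"
  by (simp add: sh_def)

lemma sh_outside: "(\<And>e. d \<noteq> e + g) \<Longrightarrow> sh g f d = 0"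
  by (auto simp: sh_def) metis

lemma sh_cases:
  obtains e where "d = e + g" | "\<And>e. d \<noteq> e + g"
  by blast

lemma sh_diff: "sh g (\<lambda>d. f d - f' d) = (\<lambda>d. sh g f d - sh g f' d)"
  by (auto simp: sh_def)

lemma sh_commute: "sh g (sh g' f) = sh g' (sh g f)"
proof (rule ext)
  have *: "sh g (sh g' f) d = 0" if "\<And>e. d \<noteq> e + g' + g" for g g' d and f :: "'a \<Rightarrow> int"
  proof (cases rule: sh_cases[of d g])
    case (1 e)
    with that show ?thesis by (simp add: sh_outside)
  qed (rule sh_outside)
  fix d
  show "sh g (sh g' f) d = sh g' (sh g f) d"
  proof (cases "\<exists>e. d = e + g' + g")
    case True
    then obtain e where e: "d = e + g' + g" by blast
    then have "d = e + g + g'" by (simp add: add_ac)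
    then have "sh g' (sh g f) d = f e" by simp
    with e show ?thesis by simp
  next
    case False
    then have "\<And>e. d \<noteq> e + g + g'" by (simp add: add_ac)
    from *[OF this] *[of d g' g f] False show ?thesis by simp
  qed
qed

lemma finite_sh:
  assumes "finite {d. f d \<noteq> 0}"
  shows "finite {d. sh g f d \<noteq> 0}"
proof (rule finite_subset)
  show "{d. sh g f d \<noteq> 0} \<subseteq> (\<lambda>e. e + g) ` {d. f d \<noteq> 0}"
  proof
    fix d assume "d \<in> {d. sh g f d \<noteq> 0}"
    then show "d \<in> (\<lambda>e. e + g) ` {d. f d \<noteq> 0}"
      by (cases rule: sh_cases[of d g]) (auto simp: sh_outside)
  qed
qed (use assms in simp)

lemma hs_sh: "hs L f \<Longrightarrow> hs L (sh g f)"
proof (induction L arbitrary: f)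
  case (Cons g' L)
  then have "hs L (sh g (\<lambda>d. f d - sh g' f d))" by simp
  then show ?case by (simp add: sh_diff sh_commute[of g'])
qed (simp add: finite_sh)

lemma hs_diff: "hs L f \<Longrightarrow> hs L f' \<Longrightarrow> hs L (\<lambda>d. f d - f' d)"
proof (induction L arbitrary: f f')
  case Nil
  then have "finite ({d. f d \<noteq> 0} \<union> {d. f' d \<noteq> 0})" by simp
  then show ?case unfolding hs.simps by (rule finite_subset[rotated]) auto
next
  case (Cons g L)
  then have "hs L (\<lambda>d. (f d - sh g f d) - (f' d - sh g f' d))" by simp
  then show ?case by (simp add: sh_diff algebra_simps)
qed

definition hl :: "('g \<Rightarrow> 'a::comm_ring_1 ideal) \<Rightarrow> ('g \<Rightarrow> 'a ideal) \<Rightarrow> 'g \<Rightarrow> int" where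
  "hl Q P d = int (the_enat (len (Q d) (P d)))"

text \<open>Multiplication by \<open>x\<close> on P/Q has kernel K/Q with
  \<open>K = inf P (fcol x Q)\<close> and cokernel P/(Q + xP). The identity is the alternating sum
  of lengths in this four-term exact sequence.\<close>

lemma hl_sh_identity:
  fixes P Q :: "'g::cancel_comm_monoid_add \<Rightarrow> 'a::comm_ring_1 ideal"
  assumes QP: "Q \<le> P" and fin: "\<And>d. len (Q d) (P d) \<noteq> \<infinity>"
    and Q: "Q \<le> fcol x Q" and P: "fmul x P \<le> P"
  shows "hl Q P d - sh (snd x) (hl Q P) d =
    hl (sup Q (fmul x P)) P d - sh (snd x) (hl Q (inf P (fcol x Q))) d"
proof (cases rule: sh_cases[of d "snd x"])
  case (1 e)
  let ?K = "inf P (fcol x Q)" and ?S = "sup Q (fmul x P)"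
  have le: "Q d \<le> ?S d" "?S d \<le> P d" "Q e \<le> ?K e" "?K e \<le> P e"
    using le_funD[OF QP] le_funD[OF Q] le_funD[OF P] by simp_all
  have S: "?S d = sup (Q d) (gen (fst x) * P e)" and K: "?K e = inf (P e) (colon (Q d) (fst x))"
    using 1 by (simp_all add: fmul_def fcol_def)
  have A: "len (Q d) (P d) = len (Q d) (?S d) + len (?S d) (P d)"
    by (rule len_add[OF le(1,2)])
  have B: "len (Q e) (P e) = len (Q e) (?K e) + len (?K e) (P e)"
    by (rule len_add[OF le(3,4)])
  have C: "len (Q d) (?S d) = len (?K e) (P e)"
    unfolding S K by (rule len_sup_gen_times)
  from fin[of d] fin[of e] obtain i j where ij: "len (Q d) (P d) = enat i" "len (Q e) (P e) = enat j"
    by (auto simp: not_infinity_eq)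
  from A ij(1) obtain a b where ab: "len (Q d) (?S d) = enat a" "len (?S d) (P d) = enat b"
    by (cases "len (Q d) (?S d)"; cases "len (?S d) (P d)") auto
  from B ij(2) obtain a' c where ac: "len (?K e) (P e) = enat a'" "len (Q e) (?K e) = enat c"
    by (cases "len (Q e) (?K e)"; cases "len (?K e) (P e)") auto
  have "a' = a" using C ab ac by simp
  have "i = a + b" using A ij ab by simp
  moreover have "j = c + a" using B ij ac \<open>a' = a\<close> by simp
  moreover have "hl Q P d = int i" "hl ?S P d = int b" "hl Q P e = int j" "hl Q ?K e = int c"
    unfolding hl_def using ij ab ac by simp_all
  moreover have "sh (snd x) f d = f e" for f unfolding 1 by simp
  ultimately show ?thesis by simp
next
  case 2
  then have "d - snd x + snd x \<noteq> d" by metis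
  then have "fmul x P d = bot" by (simp add: fmul_def)
  with 2 show ?thesis by (simp add: sh_outside hl_def)
qed

text \<open>Every family between \<open>Q\<close> and \<open>P\<close> is stable, because the
  operators send all of \<open>P\<close> into \<open>Q\<close>. Raising \<open>Q\<close> to
  \<open>P\<close> in one degree after another would therefore give an infinite strictly increasing
  chain.\<close>

lemma noeth_support_finite:
  assumes N: "noeth ops P" and QP: "Q \<le> P" and kill: "\<And>x. x \<in> ops \<Longrightarrow> fmul x P \<le> Q"
  shows "finite {d. Q d \<noteq> P d}"
proof (rule ccontr)
  assume "infinite {d. Q d \<noteq> P d}"
  then obtain f :: "nat \<Rightarrow> 'b" where f: "inj f" "range f \<subseteq> {d. Q d \<noteq> P d}"
    by (meson infinite_countable_subset)
  define R where "R k d = (if d \<in> f ` {..<k} then P d else Q d)" for k d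
  have le: "Q d \<le> R k d" "R k d \<le> P d" for k d
    using le_funD[OF QP, of d] by (auto simp: R_def)
  have "\<exists>n. \<forall>k\<ge>n. R k = R n"
  proof (rule noethD[OF N])
    show "mono R"
      using le_funD[OF QP] by (auto simp: mono_def le_fun_def R_def)
    show "stable ops (R k)" for k
    proof (rule stableI)
      fix x d assume "x \<in> ops"
      then have "P \<le> fcol x Q" using kill by (simp add: fmul_le_iff)
      then have "P d \<le> fcol x Q d" by (rule le_funD)
      then have "gen (fst x) * P d \<le> Q (d + snd x)" by (simp add: fcol_def gen_times_le_iff)
      also have "\<dots> \<le> R k (d + snd x)" by (rule le)
      finally have *: "gen (fst x) * P d \<le> R k (d + snd x)" .
      have "gen (fst x) * R k d \<le> gen (fst x) * P d" by (intro ideal_times_mono order_refl le)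
      then show "gen (fst x) * R k d \<le> R k (d + snd x)" using * by (rule order.trans)
    qed
    show "R k \<le> P" for k by (rule le_funI) (rule le)
  qed
  then obtain n where n: "\<forall>k\<ge>n. R k = R n" by (rule exE)
  have "R (Suc n) = R n" using n[rule_format, of "Suc n"] by simp
  then have "R (Suc n) (f n) = R n (f n)" by simp
  moreover have "R (Suc n) (f n) = P (f n)" by (simp add: R_def)
  moreover have "f n \<notin> f ` {..<n}" using f(1) by (auto dest: injD)
  then have "R n (f n) = Q (f n)" by (simp add: R_def)
  moreover have "Q (f n) \<noteq> P (f n)" using f(2) by auto
  ultimately show False by simp
qed

text \<open>Induction over the operators that may still act nontrivially on P/Q: kernel and cokernel
  of the first one are both annihilated by it. With none left, the length vanishes outside finitely
  many degrees.\<close>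

theorem Hilbert_Serre:
  fixes P Q :: "'g::cancel_comm_monoid_add \<Rightarrow> 'a::comm_ring_1 ideal"
  assumes "noeth ops P" "stable ops P" "stable ops Q" "Q \<le> P" "\<And>d. len (Q d) (P d) \<noteq> \<infinity>"
    and "set xs \<subseteq> ops" "\<And>x. x \<in> ops \<Longrightarrow> x \<notin> set xs \<Longrightarrow> fmul x P \<le> Q"
  shows "hs (map snd xs) (hl Q P)"
  using assms
proof (induction xs arbitrary: P Q)
  case Nil
  then have "finite {d. Q d \<noteq> P d}"
    by (intro noeth_support_finite[of ops]) simp_all
  moreover have "{d. hl Q P d \<noteq> 0} \<subseteq> {d. Q d \<noteq> P d}"
    by (auto simp: hl_def zero_enat_def)
  ultimately show ?case by (simp add: finite_subset)
next
  case (Cons x xs)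
  note N = Cons.prems(1) and P = Cons.prems(2) and Q = Cons.prems(3) and QP = Cons.prems(4)
    and fin = Cons.prems(5) and kill = Cons.prems(7)
  have x: "x \<in> ops" using Cons.prems(6) by simp
  define K where "K = inf P (fcol x Q)"
  define S where "S = sup Q (fmul x P)"
  have xP: "fmul x P \<le> P" using P x by (rule stable_fmul)
  have xQ: "Q \<le> fcol x Q" using Q x by (rule stableD)
  have KP: "K \<le> P" unfolding K_def by (rule inf_le1)
  have QK: "Q \<le> K" unfolding K_def using QP xQ by (rule le_infI)
  have SP: "S \<le> P" unfolding S_def using QP xP by (rule le_supI)
  have QS: "Q \<le> S" unfolding S_def by (rule sup_ge1)
  have "hs (map snd xs) (hl Q K)"
  proof (rule Cons.IH)
    show "noeth ops K" using N KP by (rule noeth_le)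
    show "stable ops K" unfolding K_def using P stable_fcol[OF Q] by (rule stable_inf)
    show "len (Q d) (K d) \<noteq> \<infinity>" for d
      using len_mono_right[OF le_funD[OF QK] le_funD[OF KP], of d] fin[of d]
      by (cases "len (Q d) (K d)") auto
    fix y assume y: "y \<in> ops" "y \<notin> set xs"
    show "fmul y K \<le> Q"
    proof (cases "y = x")
      case True
      have "fmul x K = inf (fmul x P) Q" unfolding K_def by (rule fmul_inf_fcol)
      then show ?thesis unfolding True by (simp only: inf_le2)
    next
      case False
      then show ?thesis using fmul_mono[OF KP, of y] kill[of y] y by (auto intro: order.trans)
    qed
  qed (use Q QK Cons.prems(6) in simp_all)
  moreover have "hs (map snd xs) (hl S P)"
  proof (rule Cons.IH)
    show "stable ops S" unfolding S_def using Q stable_fmul1[OF P] by (rule stable_sup)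
    show "len (S d) (P d) \<noteq> \<infinity>" for d
      using len_antimono_left[OF le_funD[OF QS] le_funD[OF SP], of d] fin[of d]
      by (cases "len (S d) (P d)") auto
    fix y assume y: "y \<in> ops" "y \<notin> set xs"
    show "fmul y P \<le> S"
    proof (cases "y = x")
      case True then show ?thesis unfolding S_def by (simp only: sup_ge2)
    next
      case False
      then have "fmul y P \<le> Q" using kill[of y] y by simp
      then show ?thesis using QS by (rule order.trans)
    qed
  qed (use N P SP Cons.prems(6) in simp_all)
  ultimately have "hs (map snd xs) (\<lambda>d. hl S P d - sh (snd x) (hl Q K) d)"
    by (intro hs_diff hs_sh)
  also have "(\<lambda>d. hl S P d - sh (snd x) (hl Q K) d) = (\<lambda>d. hl Q P d - sh (snd x) (hl Q P) d)"
    unfolding S_def K_def using hl_sh_identity[OF QP fin xQ xP] by (intro ext) (rule sym)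
  finally show ?case by simp
qed

text \<open>Needed because \<open>Hilbert_Serre\<close> is applied in the grading by monomials,
  where each component is a single ideal, whereas the function under study depends on total degrees
  only.\<close>

definition push :: "('g \<Rightarrow> 'h) \<Rightarrow> ('g \<Rightarrow> int) \<Rightarrow> 'h \<Rightarrow> int" where
  "push \<pi> f e = (\<Sum>d\<in>{d. \<pi> d = e \<and> f d \<noteq> 0}. f d)"

lemma push_eq:
  assumes "finite A" "{d. \<pi> d = e \<and> f d \<noteq> 0} \<subseteq> A" "\<And>d. d \<in> A \<Longrightarrow> \<pi> d = e"
  shows "push \<pi> f e = (\<Sum>d\<in>A. f d)"
  unfolding push_def using assms by (intro sum.mono_neutral_left) auto

lemma push_diff_sh:
  fixes \<pi> :: "'g::cancel_comm_monoid_add \<Rightarrow> 'h::ab_group_add"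
  assumes hom: "\<And>d d'. \<pi> (d + d') = \<pi> d + \<pi> d'"
    and fin: "\<And>e. finite {d. \<pi> d = e \<and> f d \<noteq> 0}"
  shows "push \<pi> (\<lambda>d. f d - sh g f d) e = push \<pi> f e - sh (\<pi> g) (push \<pi> f) e"
    and "finite {d. \<pi> d = e \<and> f d - sh g f d \<noteq> 0}"
proof -
  \<comment> \<open>The part of the support of \<open>f\<close> over \<open>e - \<pi> g\<close>,
    shifted by \<open>g\<close>; it contains every point over \<open>e\<close> where
    \<open>sh g f\<close> is nonzero.\<close>
  define B where "B = (\<lambda>d. d + g) ` {d. \<pi> d = e - \<pi> g \<and> f d \<noteq> 0}"
  define A where "A = {d. \<pi> d = e \<and> f d \<noteq> 0} \<union> B"
  have fA: "finite A" and fB: "finite B" using fin by (simp_all add: A_def B_def)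
  have \<pi>A: "\<pi> d = e" if "d \<in> A" for d using that by (auto simp: A_def B_def hom)
  have shB: "d \<in> B" if d: "\<pi> d = e" "sh g f d \<noteq> 0" for d
  proof (cases rule: sh_cases[of d g])
    case (1 d')
    then have "\<pi> d' = e - \<pi> g" using d(1) by (simp add: hom eq_diff_eq)
    with 1 d(2) show ?thesis by (simp add: B_def)
  next
    case 2 then show ?thesis using d(2) by (simp add: sh_outside)
  qed
  have sub: "{d. \<pi> d = e \<and> f d - sh g f d \<noteq> 0} \<subseteq> A"
  proof
    fix d assume "d \<in> {d. \<pi> d = e \<and> f d - sh g f d \<noteq> 0}"
    then have d: "\<pi> d = e" "f d \<noteq> 0 \<or> sh g f d \<noteq> 0" by auto
    with shB[of d] show "d \<in> A" unfolding A_def by blast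
  qed
  then show "finite {d. \<pi> d = e \<and> f d - sh g f d \<noteq> 0}" using fA by (rule finite_subset)
  have "push \<pi> (\<lambda>d. f d - sh g f d) e = (\<Sum>d\<in>A. f d - sh g f d)"
    using fA sub \<pi>A by (rule push_eq)
  also have "\<dots> = (\<Sum>d\<in>A. f d) - (\<Sum>d\<in>A. sh g f d)" by (rule sum_subtractf)
  also have "(\<Sum>d\<in>A. f d) = push \<pi> f e"
    by (rule push_eq[symmetric, OF fA _ \<pi>A]) (auto simp: A_def)
  also have "(\<Sum>d\<in>A. sh g f d) = (\<Sum>d\<in>B. sh g f d)"
  proof (rule sum.mono_neutral_right[OF fA])
    show "B \<subseteq> A" by (simp add: A_def)
    show "\<forall>d\<in>A - B. sh g f d = 0" using shB \<pi>A by blast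
  qed
  also have "\<dots> = (\<Sum>d\<in>{d. \<pi> d = e - \<pi> g \<and> f d \<noteq> 0}. f d)"
    unfolding B_def by (subst sum.reindex) (auto intro: inj_onI)
  also have "\<dots> = sh (\<pi> g) (push \<pi> f) e" by (simp add: push_def sh_def)
  finally show "push \<pi> (\<lambda>d. f d - sh g f d) e = push \<pi> f e - sh (\<pi> g) (push \<pi> f) e" .
qed

lemma hs_push:
  fixes \<pi> :: "'g::cancel_comm_monoid_add \<Rightarrow> 'h::ab_group_add"
  assumes hom: "\<And>d d'. \<pi> (d + d') = \<pi> d + \<pi> d'"
    and "\<And>e. finite {d. \<pi> d = e \<and> f d \<noteq> 0}" and "hs L f"
  shows "hs (map \<pi> L) (push \<pi> f)"
  using assms(2,3)
proof (induction L arbitrary: f)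
  case Nil
  have "{e. push \<pi> f e \<noteq> 0} \<subseteq> \<pi> ` {d. f d \<noteq> 0}"
  proof (clarify, rule ccontr)
    fix e assume "push \<pi> f e \<noteq> 0" "e \<notin> \<pi> ` {d. f d \<noteq> 0}"
    moreover from this(2) have "{d. \<pi> d = e \<and> f d \<noteq> 0} = {}" by auto
    ultimately show False by (simp add: push_def)
  qed
  with Nil show ?case by (auto intro: finite_subset)
next
  case (Cons g L)
  have "hs (map \<pi> L) (push \<pi> (\<lambda>d. f d - sh g f d))"
    using Cons.prems by (intro Cons.IH push_diff_sh(2) hom) simp_all
  also have "push \<pi> (\<lambda>d. f d - sh g f d) = (\<lambda>e. push \<pi> f e - sh (\<pi> g) (push \<pi> f) e)"
    using Cons.prems(1) by (intro ext push_diff_sh(1) hom)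
  finally show ?case by simp
qed

section \<open>Polynomial functions of two variables\<close>

text \<open>A predicate on functions and not on polynomials, so that substitution and summation need
  no calculation with coefficients.\<close>

definition pf2 :: "(rat \<Rightarrow> rat \<Rightarrow> rat) \<Rightarrow> bool" where
  "pf2 H \<longleftrightarrow> (\<exists>P :: rat poly poly. H = (\<lambda>x y. poly (poly P [:y:]) x))"

lemma pf2I: "H = (\<lambda>x y. poly (poly P [:y:]) x) \<Longrightarrow> pf2 H"
  unfolding pf2_def by (rule exI)

lemma pf2E:
  assumes "pf2 H"
  obtains P where "H = (\<lambda>x y. poly (poly P [:y:]) x)"
  using assms unfolding pf2_def by (rule exE)

lemma pf2_add:
  assumes "pf2 F" "pf2 G"
  shows "pf2 (\<lambda>x y. F x y + G x y)"
proof -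
  obtain P where P: "F = (\<lambda>x y. poly (poly P [:y:]) x)" using assms(1) by (rule pf2E)
  obtain Q where Q: "G = (\<lambda>x y. poly (poly Q [:y:]) x)" using assms(2) by (rule pf2E)
  show ?thesis by (rule pf2I[of _ "P + Q"]) (simp add: P Q)
qed

lemma pf2_mult:
  assumes "pf2 F" "pf2 G"
  shows "pf2 (\<lambda>x y. F x y * G x y)"
proof -
  obtain P where P: "F = (\<lambda>x y. poly (poly P [:y:]) x)" using assms(1) by (rule pf2E)
  obtain Q where Q: "G = (\<lambda>x y. poly (poly Q [:y:]) x)" using assms(2) by (rule pf2E)
  show ?thesis by (rule pf2I[of _ "P * Q"]) (simp add: P Q)
qed

lemma pf2_diff:
  assumes "pf2 F" "pf2 G"
  shows "pf2 (\<lambda>x y. F x y - G x y)"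
proof -
  obtain P where P: "F = (\<lambda>x y. poly (poly P [:y:]) x)" using assms(1) by (rule pf2E)
  obtain Q where Q: "G = (\<lambda>x y. poly (poly Q [:y:]) x)" using assms(2) by (rule pf2E)
  show ?thesis by (rule pf2I[of _ "P - Q"]) (simp add: P Q)
qed

lemma pf2_const: "pf2 (\<lambda>x y. c)"
  by (rule pf2I[of _ "[:[:c:]:]"]) simp

lemma pf2_fst: "pf2 (\<lambda>x y. x)"
  by (rule pf2I[of _ "[:[:0, 1:]:]"]) simp

lemma pf2_snd: "pf2 (\<lambda>x y. y)"
  by (rule pf2I[of _ "[:0, 1:]"]) simp

lemma pf2_power: "pf2 F \<Longrightarrow> pf2 (\<lambda>x y. F x y ^ n)"
  by (induction n) (simp_all add: pf2_const pf2_mult)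

lemma pf2_sum: "(\<And>i. i \<in> A \<Longrightarrow> pf2 (F i)) \<Longrightarrow> pf2 (\<lambda>x y. \<Sum>i\<in>A. F i x y)"
  by (induction A rule: infinite_finite_induct) (simp_all add: pf2_const pf2_add)

lemma pf2_poly: "pf2 F \<Longrightarrow> pf2 (\<lambda>x y. poly P (F x y))"
  unfolding poly_altdef by (intro pf2_sum pf2_mult pf2_const pf2_power)

lemma poly_poly_expand:
  "poly (poly P [:y:]) x = (\<Sum>j\<le>degree P. poly (coeff P j) x * (y :: rat) ^ j)"
  unfolding poly_altdef[of P] by (simp add: poly_sum poly_power)

lemma pf2_compose:
  assumes "pf2 H" "pf2 F" "pf2 G"
  shows "pf2 (\<lambda>x y. H (F x y) (G x y))"
proof -
  obtain P where P: "H = (\<lambda>x y. poly (poly P [:y:]) x)" using assms(1) by (rule pf2E)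
  show ?thesis unfolding P poly_poly_expand
    by (intro pf2_sum pf2_mult pf2_power pf2_poly assms)
qed

text \<open>Telescoping the binomial expansion of \<open>(i + 1)^(k + 1) - i^(k + 1)\<close>
  expresses the sum of \<open>k\<close>-th powers through the sums of lower powers.\<close>

lemma sum_power_poly: "\<exists>Q :: rat poly. \<forall>n. (\<Sum>i<n. of_nat i ^ k) = poly Q (of_nat n)"
proof (induction k rule: less_induct)
  case (less k)
  then have "\<forall>j. \<exists>Q :: rat poly. j < k \<longrightarrow> (\<forall>n. (\<Sum>i<n. of_nat i ^ j) = poly Q (of_nat n))"
    by blast
  from choice[OF this] obtain Q :: "nat \<Rightarrow> rat poly"
    where Q: "\<forall>j. j < k \<longrightarrow> (\<forall>n. (\<Sum>i<n. of_nat i ^ j) = poly (Q j) (of_nat n))" by (rule exE)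
  have key: "of_nat (k + 1) * (\<Sum>i<n. of_nat i ^ k) =
      (of_nat n :: rat) ^ (k + 1) - (\<Sum>j<k. of_nat ((k + 1) choose j) * poly (Q j) (of_nat n))" for n
  proof -
    have "(of_nat n :: rat) ^ (k + 1) = (\<Sum>i<n. of_nat (Suc i) ^ (k + 1) - of_nat i ^ (k + 1))"
      by (subst sum_lessThan_telescope) simp
    also have "\<dots> = (\<Sum>i<n. \<Sum>j\<le>k. of_nat ((k + 1) choose j) * of_nat i ^ j)"
    proof (rule sum.cong[OF refl])
      fix i
      have "(of_nat (Suc i) :: rat) ^ (k + 1) = (of_nat i + 1) ^ (k + 1)" by (simp add: add.commute)
      also have "\<dots> = (\<Sum>j\<le>k + 1. of_nat ((k + 1) choose j) * of_nat i ^ j)"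
        by (subst binomial_ring) simp
      also have "\<dots> = (\<Sum>j\<le>k. of_nat ((k + 1) choose j) * of_nat i ^ j) + of_nat i ^ (k + 1)"
        by simp
      finally show "of_nat (Suc i) ^ (k + 1) - of_nat i ^ (k + 1) =
          (\<Sum>j\<le>k. of_nat ((k + 1) choose j) * (of_nat i :: rat) ^ j)" by simp
    qed
    also have "\<dots> = (\<Sum>j\<le>k. of_nat ((k + 1) choose j) * (\<Sum>i<n. of_nat i ^ j))"
      by (subst sum.swap) (simp add: sum_distrib_left)
    also have "\<dots> = (\<Sum>j<k. of_nat ((k + 1) choose j) * (\<Sum>i<n. of_nat i ^ j))
        + of_nat (k + 1) * (\<Sum>i<n. of_nat i ^ k)"
      by (simp add: lessThan_Suc_atMost[symmetric])
    also have "(\<Sum>j<k. of_nat ((k + 1) choose j) * (\<Sum>i<n. (of_nat i :: rat) ^ j)) =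
        (\<Sum>j<k. of_nat ((k + 1) choose j) * poly (Q j) (of_nat n))"
      using Q by (intro sum.cong refl) simp
    finally show ?thesis by simp
  qed
  show ?case
  proof (rule exI, rule allI)
    fix n
    let ?P = "smult (1 / of_nat (k + 1)) (monom 1 (k + 1) - (\<Sum>j<k. smult (of_nat ((k + 1) choose j)) (Q j)))"
    have "of_nat (k + 1) * poly ?P (of_nat n) = of_nat (k + 1) * (\<Sum>i<n. (of_nat i :: rat) ^ k)"
      unfolding key by (simp add: poly_sum poly_monom)
    then have "poly ?P (of_nat n) = (\<Sum>i<n. (of_nat i :: rat) ^ k)"
      by (rule mult_left_cancel[THEN iffD1, rotated]) simp
    then show "(\<Sum>i<n. of_nat i ^ k) = poly ?P (of_nat n)" by (rule sym)
  qed
qed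

lemma sum_poly: "\<exists>Q :: rat poly. \<forall>n. (\<Sum>i<n. poly P (of_nat i)) = poly Q (of_nat n)"
proof -
  from choice[OF allI[OF sum_power_poly]] obtain Q :: "nat \<Rightarrow> rat poly"
    where Q: "\<forall>k n. (\<Sum>i<n. of_nat i ^ k) = poly (Q k) (of_nat n)" by (rule exE)
  have "(\<Sum>i<n. poly P (of_nat i)) = poly (\<Sum>k\<le>degree P. smult (coeff P k) (Q k)) (of_nat n)" for n
  proof -
    have "(\<Sum>i<n. poly P (of_nat i)) = (\<Sum>k\<le>degree P. coeff P k * (\<Sum>i<n. of_nat i ^ k))"
      unfolding poly_altdef by (subst sum.swap) (simp add: sum_distrib_left)
    then show ?thesis using Q by (simp add: poly_sum)
  qed
  then show ?thesis by blast
qed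

lemma pf2_summation:
  assumes "pf2 H"
  shows "\<exists>S. pf2 S \<and> (\<forall>n y. (\<Sum>i<n. H (of_nat i) y) = S (of_nat n) y)"
proof -
  obtain P where P: "H = (\<lambda>x y. poly (poly P [:y:]) x)" using assms by (rule pf2E)
  from choice[OF allI[OF sum_poly[of "coeff P _"]]] obtain Q :: "nat \<Rightarrow> rat poly"
    where Q: "\<forall>j n. (\<Sum>i<n. poly (coeff P j) (of_nat i)) = poly (Q j) (of_nat n)" by (rule exE)
  have "(\<Sum>i<n. H (of_nat i) y) = (\<Sum>j\<le>degree P. poly (Q j) (of_nat n) * y ^ j)" for n y
    unfolding P poly_poly_expand using Q by (subst sum.swap) (simp flip: sum_distrib_right)
  then show ?thesis
    by (intro exI[of _ "\<lambda>x y. \<Sum>j\<le>degree P. poly (Q j) x * y ^ j"] conjI pf2_sum pf2_mult pf2_poly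
        pf2_power pf2_fst pf2_snd allI)
qed

section \<open>Eventually polynomial functions\<close>

definition epoly :: "(nat \<Rightarrow> rat) \<Rightarrow> bool" where
  "epoly h \<longleftrightarrow> (\<exists>P N. \<forall>n\<ge>N. h n = poly P (of_nat n))"

lemma epolyE:
  assumes "epoly h"
  obtains P N where "\<And>n. n \<ge> N \<Longrightarrow> h n = poly P (of_nat n)"
  using assms unfolding epoly_def by blast

lemma epoly_sum:
  assumes "\<And>i. i \<in> A \<Longrightarrow> epoly (h i)"
  shows "epoly (\<lambda>n. \<Sum>i\<in>A. h i n)"
  using assms
proof (induction A rule: infinite_finite_induct)
  case (insert a A)
  from insert.prems have "epoly (h a)" by simp
  then obtain P N where P: "\<And>n. n \<ge> N \<Longrightarrow> h a n = poly P (of_nat n)" by (rule epolyE) blast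
  from insert have "epoly (\<lambda>n. \<Sum>i\<in>A. h i n)" by simp
  then obtain Q M where Q: "\<And>n. n \<ge> M \<Longrightarrow> (\<Sum>i\<in>A. h i n) = poly Q (of_nat n)" by (rule epolyE) blast
  show ?case unfolding epoly_def
    by (intro exI[of _ "P + Q"] exI[of _ "max N M"]) (use insert P Q in simp)
qed (auto simp: epoly_def intro: exI[of _ 0])

lemma sum_atMost_split:
  fixes f :: "nat \<Rightarrow> rat"
  assumes "N \<le> n" "\<And>i. i \<ge> N \<Longrightarrow> i < n \<Longrightarrow> f i = g i"
  shows "(\<Sum>i<n. f i) = (\<Sum>i<N. f i) + (\<Sum>i<n. g i) - (\<Sum>i<N. g i)"
proof -
  have *: "(\<Sum>i<n. h i) = (\<Sum>i<N. h i) + (\<Sum>i\<in>{N..<n}. h i)" for h :: "nat \<Rightarrow> rat"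
    using sum.atLeastLessThan_concat[of 0 N n h] assms(1) by (simp add: atLeast0LessThan)
  have "(\<Sum>i\<in>{N..<n}. f i) = (\<Sum>i\<in>{N..<n}. g i)" using assms(2) by (intro sum.cong) auto
  then show ?thesis unfolding *[of f] *[of g] by simp
qed

lemma epoly_summation:
  assumes "epoly h"
  shows "epoly (\<lambda>n. \<Sum>i<Suc n. h i)"
proof -
  from assms obtain P N where P: "\<And>n. n \<ge> N \<Longrightarrow> h n = poly P (of_nat n)" by (rule epolyE) blast
  obtain Q where Q: "\<And>n. (\<Sum>i<n. poly P (of_nat i)) = poly Q (of_nat n)" using sum_poly by blast
  let ?c = "(\<Sum>i<N. h i) - (\<Sum>i<N. poly P (of_nat i))"
  have "(\<Sum>i<Suc n. h i) = poly ([:?c:] + pcompose Q [:1, 1:]) (of_nat n)" if "n \<ge> N" for n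
  proof -
    have "(\<Sum>i<Suc n. h i) = (\<Sum>i<N. h i) + (\<Sum>i<Suc n. poly P (of_nat i)) - (\<Sum>i<N. poly P (of_nat i))"
      by (rule sum_atMost_split) (use that P in auto)
    also have "(\<Sum>i<Suc n. poly P (of_nat i)) = poly Q (of_nat (Suc n))" by (rule Q)
    finally show ?thesis by (simp add: poly_pcompose)
  qed
  then show ?thesis unfolding epoly_def by blast
qed

definition epoly2 :: "(nat \<Rightarrow> nat \<Rightarrow> rat) \<Rightarrow> bool" where
  "epoly2 G \<longleftrightarrow> (\<exists>H N. pf2 H \<and> (\<forall>p\<ge>N. \<forall>q\<ge>N. G p q = H (of_nat p) (of_nat q)))"

lemma epoly2I:
  assumes "pf2 H" "\<And>p q. p \<ge> N \<Longrightarrow> q \<ge> N \<Longrightarrow> G p q = H (of_nat p) (of_nat q)"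
  shows "epoly2 G"
  unfolding epoly2_def
  by (rule exI[of _ H], rule exI[of _ N]) (use assms in simp)

lemma epoly2E:
  assumes "epoly2 G"
  obtains H N where "pf2 H" "\<forall>p\<ge>N. \<forall>q\<ge>N. G p q = H (of_nat p) (of_nat q)"
  using assms unfolding epoly2_def by (elim exE conjE)

text \<open>Summation over one argument passes through small values of it, where the joint
  polynomial need not be valid. There each row or column contributes its own polynomial, and the
  combined property is inherited by the sum.\<close>

definition good :: "(nat \<Rightarrow> nat \<Rightarrow> rat) \<Rightarrow> bool" where
  "good G \<longleftrightarrow> epoly2 G \<and> (\<forall>p. epoly (\<lambda>q. G p q)) \<and> (\<forall>q. epoly (\<lambda>p. G p q))"

lemma good_swap: "good G \<Longrightarrow> good (\<lambda>p q. G q p)"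
  unfolding good_def epoly2_def
proof (elim conjE exE, intro conjI)
  fix H N assume "pf2 H" "\<forall>p\<ge>N. \<forall>q\<ge>N. G p q = H (of_nat p) (of_nat q)"
  then show "\<exists>H N. pf2 H \<and> (\<forall>p\<ge>N. \<forall>q\<ge>N. G q p = H (of_nat p) (of_nat q))"
    by (intro exI[of _ "\<lambda>x y. H y x"] exI[of _ N]) (simp add: pf2_compose[OF _ pf2_snd pf2_fst])
qed simp_all

lemma common_bound:
  assumes "\<And>i. i < (k :: nat) \<Longrightarrow> epoly (h i)"
  obtains P N where "\<forall>i<k. \<forall>n\<ge>N. h i n = poly (P i) (of_nat n)"
proof -
  have "\<forall>i. \<exists>PN. i < k \<longrightarrow> (\<forall>n\<ge>snd PN. h i n = poly (fst PN) (of_nat n))"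
    using assms unfolding epoly_def by auto
  from choice[OF this] obtain PN
    where PN: "\<forall>i. i < k \<longrightarrow> (\<forall>n\<ge>snd (PN i). h i n = poly (fst (PN i)) (of_nat n))" by (rule exE)
  let ?N = "Max (insert 0 ((\<lambda>i. snd (PN i)) ` {..<k}))"
  have "snd (PN i) \<le> ?N" if "i < k" for i
    using that by (intro Max_ge) auto
  then have "\<forall>i<k. \<forall>n\<ge>?N. h i n = poly (fst (PN i)) (of_nat n)"
    using PN order.trans by blast
  then show ?thesis by (rule that)
qed

lemma good_sum:
  assumes "good G"
  shows "good (\<lambda>p q. \<Sum>i<Suc q. G p i)"
proof -
  from assms have "epoly2 G" by (simp add: good_def)
  then obtain H N where H: "pf2 H" "\<forall>p\<ge>N. \<forall>q\<ge>N. G p q = H (of_nat p) (of_nat q)"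
    by (rule epoly2E)
  have rows: "epoly (\<lambda>q. G p q)" and cols: "epoly (\<lambda>p. G p q)" for p q
    using assms by (simp_all add: good_def)
  obtain P M where P: "\<forall>i<N. \<forall>p\<ge>M. G p i = poly (P i) (of_nat p)"
    by (rule common_bound[of N "\<lambda>i p. G p i"]) (rule cols)
  have H': "pf2 (\<lambda>x y. H y x)" using pf2_compose[OF H(1) pf2_snd pf2_fst] .
  from pf2_summation[OF H']
  obtain S where S: "pf2 S" "\<forall>n y. (\<Sum>i<n. H y (of_nat i)) = S (of_nat n) y"
    by (elim exE conjE)
  \<comment> \<open>The first \<open>N\<close> columns enter with their own polynomials;
    \<open>y + 1\<close> counts the \<open>Suc q\<close> summands.\<close>
  let ?T = "\<lambda>x y. (\<Sum>i<N. poly (P i) x) + S (y + 1) x - S (of_nat N) x"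
  have "pf2 ?T"
    by (intro pf2_add pf2_diff pf2_sum pf2_poly pf2_compose[OF S(1)] pf2_fst pf2_snd pf2_const)
  moreover have "(\<Sum>i<Suc q. G p i) = ?T (of_nat p) (of_nat q)" if "p \<ge> max M N" "q \<ge> max M N" for p q
  proof -
    have "(\<Sum>i<Suc q. G p i) = (\<Sum>i<N. G p i) + (\<Sum>i<Suc q. H (of_nat p) (of_nat i)) - (\<Sum>i<N. H (of_nat p) (of_nat i))"
      by (rule sum_atMost_split) (use that H(2) in auto)
    also have "(\<Sum>i<N. G p i) = (\<Sum>i<N. poly (P i) (of_nat p))"
      using that P by (intro sum.cong refl) simp
    finally show ?thesis unfolding S(2)[rule_format] by (simp only: of_nat_Suc add.commute)
  qed
  ultimately have "epoly2 (\<lambda>p q. \<Sum>i<Suc q. G p i)" by (rule epoly2I)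
  then show ?thesis unfolding good_def
    by (intro conjI allI epoly_summation rows epoly_sum cols)
qed

text \<open>Dividing the generating function by \<open>1 - X\<close> or \<open>1 - Y\<close> is
  summation in that direction; the sums start at 0 because \<open>F\<close> vanishes at negative
  arguments.\<close>

lemma good_hs:
  fixes F :: "int \<times> int \<Rightarrow> int"
  assumes "hs L F" "set L \<subseteq> {(1, 0), (0, 1)}" "\<And>p q. p < 0 \<or> q < 0 \<Longrightarrow> F (p, q) = 0"
  shows "good (\<lambda>p q. of_int (F (int p, int q)))"
  using assms
proof (induction L arbitrary: F)
  case Nil
  then have fin: "finite {d. F d \<noteq> 0}" by simp
  define N where "N = Max (insert 0 ((\<lambda>d. nat (fst d)) ` {d. F d \<noteq> 0} \<union> (\<lambda>d. nat (snd d)) ` {d. F d \<noteq> 0})) + 1"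
  have "nat (fst d) < N \<and> nat (snd d) < N" if "F d \<noteq> 0" for d
    unfolding N_def using fin that by (auto simp: less_Suc_eq_le intro!: Max_ge)
  then have z: "F (int p, int q) = 0" if "p \<ge> N \<or> q \<ge> N" for p q
    using that by fastforce
  have "epoly (\<lambda>q. of_int (F (int p, int q)))" "epoly (\<lambda>p. of_int (F (int p, int q)))" for p q
    unfolding epoly_def using z by (auto intro!: exI[of _ 0] exI[of _ N])
  moreover have "epoly2 (\<lambda>p q. of_int (F (int p, int q)))"
    unfolding epoly2_def by (intro exI[of _ "\<lambda>x y. 0"] exI[of _ N]) (simp add: pf2_const z)
  ultimately show ?case by (simp add: good_def)
next
  case (Cons g L)
  define F1 where "F1 d = F d - sh g F d" for d
  have F1: "F1 (p, q) = F (p, q) - F (p - fst g, q - snd g)" for p q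
    by (cases g) (simp add: F1_def sh_def)
  have g: "g = (1, 0) \<or> g = (0, 1)" using Cons.prems(2) by auto
  have "good (\<lambda>p q. of_int (F1 (int p, int q)))"
  proof (rule Cons.IH)
    show "hs L F1" using Cons.prems(1) by (simp add: F1_def[abs_def])
    show "F1 (p, q) = 0" if "p < 0 \<or> q < 0" for p q
      using Cons.prems(3)[of p q] Cons.prems(3)[of "p - fst g" "q - snd g"] g that by (auto simp: F1)
  qed (use Cons.prems in simp)
  note IH = this
  from g show ?case
  proof
    assume g: "g = (0, 1)"
    have "F (int p, int q) = (\<Sum>i<Suc q. F1 (int p, int i))" for p q
      by (induction q) (auto simp: F1 g Cons.prems(3))
    then have "(\<lambda>p q. of_int (F (int p, int q))) = (\<lambda>p q. \<Sum>i<Suc q. (of_int (F1 (int p, int i)) :: rat))"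
      by (simp only: of_int_sum)
    with good_sum[OF IH] show ?thesis by simp
  next
    assume g: "g = (1, 0)"
    have "F (int p, int q) = (\<Sum>i<Suc p. F1 (int i, int q))" for p q
      by (induction p) (auto simp: F1 g Cons.prems(3))
    then have "(\<lambda>p q. of_int (F (int p, int q))) = (\<lambda>p q. \<Sum>i<Suc p. (of_int (F1 (int i, int q)) :: rat))"
      by (simp only: of_int_sum)
    with good_swap[OF good_sum[OF good_swap[OF IH]]] show ?thesis by simp
  qed
qed

text \<open>The second argument \<open>p + q - i\<close> stays above \<open>q\<close>, so only small
  \<open>i\<close> fall outside the range of the joint polynomial, and for these the rows are
  used.\<close>

lemma good_antidiagonal_sum:
  assumes "good G"
  shows "epoly2 (\<lambda>p q. \<Sum>i<p. G i (p + q - i))"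
proof -
  from assms have "epoly2 G" by (simp add: good_def)
  then obtain H N where H: "pf2 H" "\<forall>p\<ge>N. \<forall>q\<ge>N. G p q = H (of_nat p) (of_nat q)"
    by (rule epoly2E)
  have rows: "epoly (\<lambda>q. G p q)" for p using assms by (simp add: good_def)
  obtain P M where P: "\<forall>i<N. \<forall>q\<ge>M. G i q = poly (P i) (of_nat q)"
    by (rule common_bound[of N G]) (rule rows)
  have "pf2 (\<lambda>x s. H x (s - x))" by (intro pf2_compose[OF H(1)] pf2_diff pf2_fst pf2_snd)
  from pf2_summation[OF this]
  obtain S where S: "pf2 S" "\<forall>n s. (\<Sum>i<n. H (of_nat i) (s - of_nat i)) = S (of_nat n) s"
    by (elim exE conjE)
  let ?T = "\<lambda>x y. (\<Sum>i<N. poly (P i) (x + y - of_nat i)) + S x (x + y) - S (of_nat N) (x + y)"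
  have "pf2 ?T"
    by (intro pf2_add pf2_diff pf2_sum pf2_poly pf2_compose[OF S(1)] pf2_fst pf2_snd pf2_const)
  moreover have "(\<Sum>i<p. G i (p + q - i)) = ?T (of_nat p) (of_nat q)"
    if pq: "p \<ge> max M N" "q \<ge> max M N" for p q
  proof -
    have 1: "(\<Sum>i<N. G i (p + q - i)) = (\<Sum>i<N. poly (P i) (of_nat p + of_nat q - of_nat i))"
  proof (rule sum.cong[OF refl])
    fix i assume "i \<in> {..<N}"
    then have i: "i < N" by simp
    then have "p + q - i \<ge> M" using pq by simp linarith
    then have "G i (p + q - i) = poly (P i) (of_nat (p + q - i))" using P i by blast
    then show "G i (p + q - i) = poly (P i) (of_nat p + of_nat q - of_nat i)"
      using pq i by (simp add: of_nat_diff)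
  qed
    have "(\<Sum>i<p. G i (p + q - i)) = (\<Sum>i<N. G i (p + q - i))
        + (\<Sum>i<p. H (of_nat i) (of_nat p + of_nat q - of_nat i))
        - (\<Sum>i<N. H (of_nat i) (of_nat p + of_nat q - of_nat i))"
    proof (rule sum_atMost_split)
      fix i assume "i \<ge> N" "i < p"
      then show "G i (p + q - i) = H (of_nat i) (of_nat p + of_nat q - of_nat i)"
        using pq by (subst H(2)[rule_format]) (auto simp: of_nat_diff)
    qed (use pq in simp)
    then show ?thesis by (simp only: 1 S(2)[rule_format])
  qed
  ultimately show ?thesis by (rule epoly2I)
qed


section \<open>Monomials\<close>

abbreviation (input) keys where "keys \<equiv> Poly_Mapping.keys"
abbreviation (input) lookup where "lookup \<equiv> Poly_Mapping.lookup"
abbreviation (input) single where "single \<equiv> Poly_Mapping.single"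

type_synonym mon = "nat \<Rightarrow>\<^sub>0 nat"

definition mdeg :: "mon \<Rightarrow> nat" where
  "mdeg u = (\<Sum>i\<in>keys u. lookup u i)"

definition mons :: "nat set \<Rightarrow> nat \<Rightarrow> mon set" where
  "mons X s = {u. keys u \<subseteq> X \<and> mdeg u = s}"

lemma mdeg_superset: "finite X \<Longrightarrow> keys u \<subseteq> X \<Longrightarrow> mdeg u = (\<Sum>i\<in>X. lookup u i)"
  unfolding mdeg_def by (rule sum.mono_neutral_left) (auto simp: in_keys_iff)

lemma keys_add_nat [simp]: "keys (u + v) = keys u \<union> keys (v :: mon)"
  by (auto simp: in_keys_iff lookup_add)

lemma mdeg_add [simp]: "mdeg (u + v) = mdeg u + mdeg v"
  by (simp add: mdeg_superset[of "keys u \<union> keys v"] lookup_add sum.distrib)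

lemma mdeg_0 [simp]: "mdeg 0 = 0"
  by (simp add: mdeg_def)

lemma mdeg_single [simp]: "mdeg (single i n) = n"
  by (simp add: mdeg_def)

lemma mdeg_eq_0: "mdeg u = 0 \<longleftrightarrow> u = 0"
proof
  assume "mdeg u = 0"
  then have "\<forall>i\<in>keys u. lookup u i = 0" by (simp add: mdeg_def)
  then have "lookup u i = 0" for i by (metis in_keys_iff)
  then show "u = 0" by (intro poly_mapping_eqI) simp
qed simp

lemma mdeg_Suc_decompose:
  assumes "mdeg u = Suc p"
  obtains i v where "i \<in> keys u" "u = v + single i 1" "mdeg v = p"
proof -
  from assms have "u \<noteq> 0" by auto
  then obtain i where i: "i \<in> keys u" by fastforce
  define v where "v = u - single i 1"
  have "u = v + single i 1"
    using i by (intro poly_mapping_eqI) (auto simp: v_def lookup_add lookup_minus lookup_single in_keys_iff when_def)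
  moreover from this have "mdeg u = mdeg v + 1" by simp
  then have "mdeg v = p" using assms by simp
  ultimately show ?thesis by (rule that[OF i])
qed

text \<open>The index \<open>t\<close> is the degree in the old variables and not the exponent of
  \<open>i\<close>; in terms of it the sum for \<open>Lam\<close> can later be split at
  \<open>t = q\<close>, independently of \<open>p\<close>.\<close>

lemma mons_insert_bij:
  assumes "i \<notin> X"
  shows "bij_betw (\<lambda>(t, v). v + single i (s - t)) (Sigma {..s} (mons X)) (mons (insert i X) s)"
    (is "bij_betw ?g ?S _")
proof (rule bij_betw_byWitness[where f' = "\<lambda>u. (s - lookup u i, u - single i (lookup u i))"])
  have z: "lookup v i = 0" if "v \<in> mons X t" for v t
    using that assms by (auto simp: mons_def in_keys_iff)
  show "\<forall>a\<in>?S. (\<lambda>u. (s - lookup u i, u - single i (lookup u i))) (?g a) = a"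
    using z by (auto simp: lookup_add)
  have dec: "u = (u - single i (lookup u i)) + single i (lookup u i)" for u :: mon
    by (intro poly_mapping_eqI) (auto simp: lookup_add lookup_minus lookup_single when_def)
  have le: "lookup u i \<le> s \<and> (s - lookup u i, u - single i (lookup u i)) \<in> ?S"
    if u: "u \<in> mons (insert i X) s" for u
  proof -
    have "mdeg u = mdeg (u - single i (lookup u i)) + lookup u i"
      using arg_cong[OF dec[of u], of mdeg] by (simp only: mdeg_add mdeg_single)
    then have d: "s = mdeg (u - single i (lookup u i)) + lookup u i" using u by (simp add: mons_def)
    have "keys (u - single i (lookup u i)) \<subseteq> X"
    proof
      fix j assume "j \<in> keys (u - single i (lookup u i))"
      then have "j \<in> keys u" "j \<noteq> i"
        by (auto simp: in_keys_iff lookup_minus lookup_single when_def split: if_splits)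
      then show "j \<in> X" using u by (auto simp: mons_def)
    qed
    with d show ?thesis by (simp add: mons_def)
  qed
  show "\<forall>u\<in>mons (insert i X) s. ?g (s - lookup u i, u - single i (lookup u i)) = u"
  proof
    fix u assume "u \<in> mons (insert i X) s"
    then have "s - (s - lookup u i) = lookup u i" using le by simp
    then show "?g (s - lookup u i, u - single i (lookup u i)) = u" using dec[of u] by simp
  qed
  show "?g ` ?S \<subseteq> mons (insert i X) s"
    by (auto simp: mons_def dest: subsetD split: if_splits)
  show "(\<lambda>u. (s - lookup u i, u - single i (lookup u i))) ` mons (insert i X) s \<subseteq> ?S"
    using le by blast
qed

lemma finite_mons: "finite X \<Longrightarrow> finite (mons X s)"
proof (induction X arbitrary: s rule: finite_induct)
  case empty
  have "mons {} s \<subseteq> {0}" by (auto simp: mons_def)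
  then show ?case by (rule finite_subset) simp
next
  case (insert i X)
  then have "finite (Sigma {..s} (mons X))" by simp
  then show ?case using bij_betw_finite[OF mons_insert_bij[OF insert.hyps(2)]] by blast
qed

lemma sum_mons_insert:
  assumes "finite X" "i \<notin> X"
  shows "(\<Sum>u\<in>mons (insert i X) s. f u) = (\<Sum>t\<le>s. \<Sum>v\<in>mons X t. f (v + single i (s - t)))"
proof -
  have "(\<Sum>u\<in>mons (insert i X) s. f u) =
      (\<Sum>a\<in>Sigma {..s} (mons X). f ((\<lambda>(t, v). v + single i (s - t)) a))"
    by (rule sum.reindex_bij_betw[OF mons_insert_bij[OF assms(2)], symmetric])
  also have "\<dots> = (\<Sum>t\<le>s. \<Sum>v\<in>mons X t. f (v + single i (s - t)))"
    using finite_mons[OF assms(1)] by (subst sum.Sigma) (auto simp: case_prod_beta)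
  finally show ?thesis .
qed

section \<open>Coefficient ideals of the powers of M\<close>

definition ipow :: "(nat \<Rightarrow> 'a::comm_ring_1 ideal) \<Rightarrow> mon \<Rightarrow> 'a ideal" where
  "ipow I u = (\<Prod>i\<in>keys u. I i ^ lookup u i)"

lemma ipow_superset: "finite X \<Longrightarrow> keys u \<subseteq> X \<Longrightarrow> ipow I u = (\<Prod>i\<in>X. I i ^ lookup u i)"
  unfolding ipow_def by (rule prod.mono_neutral_left) (auto simp: in_keys_iff)

lemma ipow_add: "ipow I (u + v) = ipow I u * ipow I v"
  by (simp add: ipow_superset[of "keys u \<union> keys v"] lookup_add power_add prod.distrib)

lemma ipow_0 [simp]: "ipow I 0 = top"
  by (simp add: ipow_def ideal_one_eq_top)

lemma ipow_single [simp]: "ipow I (single i n) = I i ^ n"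
  by (cases "n = 0") (simp_all add: ipow_def)

text \<open>The coefficient ideal of \<open>t\<^bsup>u\<^esup>\<close> in \<open>M\<^sup>p S\<close>, where \<open>M = \<Oplus> I i \<cdot> t\<^sub>i\<close>.\<close>

definition J :: "(nat \<Rightarrow> 'a::comm_ring_1 ideal) \<Rightarrow> nat \<Rightarrow> mon \<Rightarrow> 'a ideal" where
  "J I p u = (SUP n\<in>{n. (\<exists>w. n + w = u) \<and> mdeg n = p}. ipow I n)"

lemma J_upper: "mdeg n = p \<Longrightarrow> n + w = u \<Longrightarrow> ipow I n \<le> J I p u"
  unfolding J_def by (rule SUP_upper) auto

lemma J_least:
  assumes "\<And>n w. mdeg n = p \<Longrightarrow> n + w = u \<Longrightarrow> ipow I n \<le> B"
  shows "J I p u \<le> B"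
  unfolding J_def by (rule SUP_least) (use assms in auto)

lemma times_J_le:
  assumes "\<And>n w. mdeg n = p \<Longrightarrow> n + w = u \<Longrightarrow> A * ipow I n \<le> B"
  shows "A * J I p u \<le> B"
  unfolding J_def times_SUP by (rule SUP_least) (use assms in auto)

lemma J_0: "J I 0 u = top"
  using J_upper[of 0 0 u u I] by (simp add: top_unique)

lemma J_bot: "mdeg u < p \<Longrightarrow> J I p u = bot"
  by (rule antisym[OF J_least]) auto

lemma J_Suc_le: "J I (Suc p) u \<le> J I p u"
proof (rule J_least)
  fix n w assume "mdeg n = Suc p" and w: "n + w = u"
  then obtain i v where v: "n = v + single i 1" "mdeg v = p" by (elim mdeg_Suc_decompose)
  have "ipow I n \<le> ipow I v" by (simp add: v(1) ipow_add ideal_times_le1)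
  also have "\<dots> \<le> J I p u"
    using v w by (intro J_upper[of _ _ "single i 1 + w"]) (simp_all add: add.assoc)
  finally show "ipow I n \<le> J I p u" .
qed

lemma times_J_step:
  assumes "A \<le> I i"
  shows "A * J I p u \<le> J I (Suc p) (u + single i 1)"
proof (rule times_J_le)
  fix n w assume n: "mdeg n = p" "n + w = u"
  have "A * ipow I n \<le> I i * ipow I n" using assms by (intro ideal_times_mono) auto
  also have "\<dots> = ipow I (n + single i 1)" by (simp add: ipow_add mult.commute)
  also have "\<dots> \<le> J I (Suc p) (u + single i 1)"
    using n by (intro J_upper[of _ _ w]) (auto simp: add_ac)
  finally show "A * ipow I n \<le> J I (Suc p) (u + single i 1)" .
qed

lemma J_mono_add: "J I p u \<le> J I p (u + v)"
proof (rule J_least)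
  fix n w assume "mdeg n = p" "n + w = u"
  then show "ipow I n \<le> J I p (u + v)"
    by (intro J_upper[of _ _ "w + v"]) (auto simp: add_ac)
qed

lemma mon_divisor_exists:
  assumes "p \<le> mdeg u"
  shows "\<exists>n w. n + w = u \<and> mdeg n = p"
  using assms
proof (induction "mdeg u - p" arbitrary: u)
  case 0
  then show ?case by (intro exI[of _ u] exI[of _ 0]) simp
next
  case (Suc k)
  then have "mdeg u = Suc (mdeg u - 1)" by simp
  then obtain i v where v: "u = v + single i 1" "mdeg v = mdeg u - 1" by (elim mdeg_Suc_decompose)
  have "k = mdeg v - p" "p \<le> mdeg v" using Suc.hyps(2) Suc.prems v(2) by simp_all
  then obtain n w where "n + w = v" "mdeg n = p" using Suc.hyps(1)[of v] by blast
  then show ?case using v(1) by (intro exI[of _ n] exI[of _ "w + single i 1"]) (auto simp: add_ac)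
qed

section \<open>Polynomiality of the Buchsbaum-Rim function\<close>

definition colen :: "'a::comm_ring_1 ideal \<Rightarrow> nat" where
  "colen A = the_enat (len A top)"

text \<open>\<open>c\<close> is a common exponent with \<open>m^c\<close> inside all the ideals.
  Together with the finite length of R/m^n it makes the colengths that occur natural numbers, so
  that \<open>the_enat\<close> loses nothing.\<close>

locale rees_setting = noeth_local ty m for ty :: "'a::comm_ring_1 itself" and m :: "'a ideal" +
  fixes X :: "nat set" and I :: "nat \<Rightarrow> 'a ideal" and c :: nat
  assumes finX: "finite X" and I_ge: "i \<in> X \<Longrightarrow> m ^ c \<le> I i" and fin_len: "len (m ^ n) top \<noteq> \<infinity>"
begin

lemma fin_len_ge: "m ^ n \<le> A \<Longrightarrow> A \<le> B \<Longrightarrow> len A B \<noteq> \<infinity>"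
proof -
  assume "m ^ n \<le> A" "A \<le> B"
  then have "len A B \<le> len A top" "len A top \<le> len (m ^ n) top"
    by (auto intro: len_mono_right len_top_antimono)
  then show ?thesis using fin_len[of n] by (cases "len A B"; cases "len A top") auto
qed

lemma len_top_eq: "m ^ n \<le> A \<Longrightarrow> len A top = enat (colen A)"
  using fin_len_ge[of n A top] unfolding colen_def by (cases "len A top") auto

lemma colen_diff:
  assumes "m ^ n \<le> A" "A \<le> B"
  shows "len A B = enat (colen A - colen B)" "colen B \<le> colen A"
proof -
  have "m ^ n \<le> B" using assms by (rule order.trans)
  from len_add[OF assms(2) top_greatest] len_top_eq[OF assms(1)] len_top_eq[OF this]
  have "enat (colen A) = len A B + enat (colen B)" by simp
  then show "len A B = enat (colen A - colen B)" "colen B \<le> colen A"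
    by (cases "len A B"; simp)+
qed

lemma ipow_ge: "keys u \<subseteq> X \<Longrightarrow> m ^ (c * mdeg u) \<le> ipow I u"
proof (induction "mdeg u" arbitrary: u)
  case 0
  then show ?case by (simp add: mdeg_eq_0)
next
  case (Suc p)
  then obtain i v where v: "i \<in> keys u" "u = v + single i 1" "mdeg v = p"
    by (metis mdeg_Suc_decompose)
  have i: "i \<in> X" "keys v \<subseteq> X" using Suc.prems v(1,2) by auto
  have "m ^ (c * mdeg u) = m ^ (c * mdeg v) * m ^ c"
    by (simp add: v(2) power_add distrib_left mult.commute)
  also have "\<dots> \<le> ipow I v * I i"
    using Suc.hyps(1)[of v] v(3) i I_ge by (intro ideal_times_mono) auto
  finally show ?case by (simp add: v(2) ipow_add)
qed

lemma J_ge: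
  assumes "keys u \<subseteq> X" "p \<le> mdeg u"
  shows "m ^ (c * p) \<le> J I p u"
proof -
  obtain n w where n: "n + w = u" "mdeg n = p" using mon_divisor_exists[OF assms(2)] by blast
  then have "keys n \<subseteq> X" using assms(1) by auto
  then have "m ^ (c * p) \<le> ipow I n" using ipow_ge[of n] n(2) by simp
  also have "\<dots> \<le> J I p u" using n by (intro J_upper)
  finally show ?thesis .
qed

text \<open>The algebra S[MT], the direct sum of all M^p S T^p, where the extra variable T records
  the power of M. It is graded by the exponent of T together with the monomial of S.\<close>

definition W :: "nat \<times> mon \<Rightarrow> 'a ideal" where
  "W d = (if keys (snd d) \<subseteq> X then J I (fst d) (snd d) else bot)"

text \<open>For \<open>|u| > p\<close> this is \<open>J I (Suc p) u\<close>; the second summand only makes \<open>W / V\<close> of finite length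
  when \<open>|u| = p\<close>.\<close>

definition V :: "nat \<times> mon \<Rightarrow> 'a ideal" where
  "V d = (if keys (snd d) \<subseteq> X then sup (J I (Suc (fst d)) (snd d)) (m ^ c * J I (fst d) (snd d)) else bot)"

lemma V_le_W: "V \<le> W"
  by (auto simp: le_fun_def V_def W_def ideal_times_le2 J_Suc_le)

text \<open>If \<open>n + w = u\<close> with \<open>|n| = p < |u|\<close>, some variable t_i is left
  in \<open>w\<close>, and \<open>m^c\<close> lies in \<open>I i\<close>; so the second summand of
  \<open>V\<close> is absorbed by the first.\<close>

lemma V_eq:
  assumes "keys u \<subseteq> X" "p < mdeg u"
  shows "V (p, u) = J I (Suc p) u"
proof -
  have "m ^ c * J I p u \<le> J I (Suc p) u"
  proof (rule times_J_le)
    fix n w assume n: "mdeg n = p" "n + w = u"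
    with assms(2) have "mdeg w = Suc (mdeg w - 1)" by auto
    then obtain i v where v: "i \<in> keys w" "w = v + single i 1" by (elim mdeg_Suc_decompose)
    have "i \<in> X" using v(1) n(2) assms(1) by auto
    then have "m ^ c * ipow I n \<le> I i * ipow I n" by (intro ideal_times_mono I_ge) auto
    also have "\<dots> = ipow I (n + single i 1)" by (simp add: ipow_add mult.commute)
    also have "\<dots> \<le> J I (Suc p) u"
      using n v(2) by (intro J_upper[of _ _ v]) (auto simp: add_ac)
    finally show "m ^ c * ipow I n \<le> J I (Suc p) u" .
  qed
  then show ?thesis using assms(1) by (simp add: V_def sup_absorb1)
qed

lemma fin_len_V_W: "len (V d) (W d) \<noteq> \<infinity>"
proof (cases "keys (snd d) \<subseteq> X \<and> fst d \<le> mdeg (snd d)")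
  case True
  then have "m ^ c * m ^ (c * fst d) \<le> m ^ c * J I (fst d) (snd d)"
    by (intro ideal_times_mono J_ge) auto
  also have "\<dots> \<le> V d" using True by (simp add: V_def)
  finally have "m ^ (c + c * fst d) \<le> V d" by (simp add: power_add)
  then show ?thesis using le_funD[OF V_le_W] by (rule fin_len_ge)
next
  case False
  then have "V d = W d" by (auto simp: V_def W_def J_bot)
  then show ?thesis by simp
qed

text \<open>The generators of S[MT]: the products \<open>a t_i T\<close>, with \<open>a\<close> from
  a finite generating set of \<open>I i\<close>, and the variables t_i themselves.\<close>

lemma operators_exist:
  obtains ops :: "('a \<times> nat \<times> mon) list" where
    "\<forall>x\<in>set ops. (\<exists>i\<in>X. fst x \<in> set_of (I i) \<and> snd x = (1, single i 1)) \<or> (\<exists>i\<in>X. snd x = (0, single i 1))"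
    "noeth (set ops) W"
proof -
  have "\<forall>i. \<exists>A. finite A \<and> I i = spn A"
  proof
    fix i
    obtain A where "finite A" "I i = spn A" by (rule finite_generators)
    then show "\<exists>A. finite A \<and> I i = spn A" by blast
  qed
  from choice[OF this] obtain A where A: "\<forall>i. finite (A i) \<and> I i = spn (A i)" by (rule exE)
  let ?S = "(\<Union>i\<in>X. (\<lambda>a. (a, 1 :: nat, single i (1 :: nat))) ` A i) \<union> (\<lambda>i. (1, 0, single i 1)) ` X"
  have fA: "finite (A i)" and IA: "I i = spn (A i)" for i using A by blast+
  have "finite ?S" by (intro finite_UnI finite_UN_I finite_imageI finX fA)
  from finite_list[OF this] obtain ops where ops: "set ops = ?S" by (rule exE)
  show ?thesis
  proof (rule that[of ops], intro ballI)
    fix x assume x: "x \<in> set ops"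
    have AI: "a \<in> set_of (I i)" if "a \<in> A i" for a i
      unfolding IA using that by (simp add: set_of_spn self_module.span_base)
    from x consider i a where "i \<in> X" "a \<in> A i" "x = (a, 1, single i 1)" | i where "i \<in> X" "x = (1, 0, single i 1)"
      unfolding ops by blast
    then show "(\<exists>i\<in>X. fst x \<in> set_of (I i) \<and> snd x = (1, single i 1)) \<or> (\<exists>i\<in>X. snd x = (0, single i 1))"
    proof cases
      case 1
      then show ?thesis using AI[OF 1(2)] by (intro disjI1 bexI[of _ i]) simp_all
    next
      case 2
      then show ?thesis by (intro disjI2 bexI[of _ i]) simp_all
    qed
  next
    show "noeth (set ops) W"
    proof (rule noeth_generated, rule le_funI)
      fix G :: "nat \<times> mon \<Rightarrow> 'a ideal" and d
      assume G: "stable (set ops) G" "G 0 = top"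
      have step1: "I i * B \<le> G (Suc p, u + single i 1)" if "B \<le> G (p, u)" "i \<in> X" for i p u B
      proof -
        have "B \<le> colon (G (Suc p, u + single i 1)) a" if a: "a \<in> A i" for a
        proof -
          have "G \<le> fcol (a, 1, single i 1) G"
            using G(1) a \<open>i \<in> X\<close> by (intro stableD[of "set ops"]) (auto simp: ops)
          from le_funD[OF this, of "(p, u)"] have "G (p, u) \<le> colon (G (Suc p, u + single i 1)) a"
            by (simp add: fcol_def)
          with \<open>B \<le> G (p, u)\<close> show ?thesis by (rule order.trans)
        qed
        then show ?thesis unfolding IA[of i] by (simp add: spn_times_le_iff)
      qed
      have step2: "G (p, u) \<le> G (p, u + single i 1)" if "i \<in> X" for i p u
      proof -
        have "G \<le> fcol (1, 0, single i 1) G"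
          using G(1) that by (intro stableD[of "set ops"]) (auto simp: ops)
        from le_funD[OF this, of "(p, u)"] have "G (p, u) \<le> colon (G (p, u + single i 1)) 1"
          by (simp add: fcol_def)
        then show ?thesis by (auto simp: less_eq_ideal_def)
      qed
      \<comment> \<open>Generators of the first kind alone already produce the ideal
        \<open>ipow I n\<close> in T-degree \<open>|n|\<close>.\<close>
      have pow: "keys n \<subseteq> X \<Longrightarrow> mdeg n = k \<Longrightarrow> ipow I n \<le> G (k, n)" for k n
      proof (induction k arbitrary: n)
        case 0
        then show ?case using G(2) by (simp add: mdeg_eq_0 zero_prod_def)
      next
        case (Suc k)
        from Suc.prems(2) obtain i v where v: "i \<in> keys n" "n = v + single i 1" "mdeg v = k"
          by (rule mdeg_Suc_decompose)
        then have "keys v \<subseteq> X" "i \<in> X" using Suc.prems(1) by auto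
        then have "I i * ipow I v \<le> G (Suc k, v + single i 1)"
          using v(3) by (intro step1 Suc.IH)
        then show ?case by (simp add: v(2) ipow_add mult.commute)
      qed
      \<comment> \<open>The variables then carry it to all multiples of that monomial.\<close>
      have ext: "keys w \<subseteq> X \<Longrightarrow> mdeg w = k \<Longrightarrow> G (p, n) \<le> G (p, n + w)" for k p n w
      proof (induction k arbitrary: w)
        case (Suc k)
        from Suc.prems(2) obtain i v where v: "i \<in> keys w" "w = v + single i 1" "mdeg v = k"
          by (rule mdeg_Suc_decompose)
        then have "keys v \<subseteq> X" "i \<in> X" using Suc.prems(1) by auto
        then have "G (p, n) \<le> G (p, n + v)" using v(3) by (intro Suc.IH)
        also have "\<dots> \<le> G (p, n + v + single i 1)" using \<open>i \<in> X\<close> by (rule step2)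
        finally show ?case by (simp add: v(2) add.assoc)
      qed (simp add: mdeg_eq_0)
      have "J I (fst d) (snd d) \<le> G (fst d, snd d)" if X: "keys (snd d) \<subseteq> X"
      proof (rule J_least)
        fix n w assume n: "mdeg n = fst d" "n + w = snd d"
        then have k: "keys n \<subseteq> X" "keys w \<subseteq> X" using X by (auto simp flip: n(2))
        have "ipow I n \<le> G (fst d, n)" using k(1) n(1) by (rule pow)
        also have "\<dots> \<le> G (fst d, n + w)" using k(2) refl by (rule ext)
        finally show "ipow I n \<le> G (fst d, snd d)" by (simp add: n(2))
      qed
      then show "W d \<le> G d" by (simp add: W_def)
    qed
  qed
qed

definition Lam :: "nat \<Rightarrow> nat \<Rightarrow> nat" where
  "Lam p q = (\<Sum>u\<in>mons X (p + q). colen (J I p u))"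

theorem Lam_polynomial: "epoly2 (\<lambda>p q. of_nat (Lam p q))"
proof -
  obtain ops :: "('a \<times> nat \<times> mon) list" where ops:
    "\<forall>x\<in>set ops. (\<exists>i\<in>X. fst x \<in> set_of (I i) \<and> snd x = (1, single i 1)) \<or> (\<exists>i\<in>X. snd x = (0, single i 1))"
    "noeth (set ops) W"
    by (rule operators_exist)
  have sJ: "gen (fst x) * J I p u \<le> J I (p + fst (snd x)) (u + snd (snd x))"
    and sX: "keys u \<subseteq> X \<Longrightarrow> keys (u + snd (snd x)) \<subseteq> X"
    if x: "x \<in> set ops" for x p u
  proof -
    consider i where "i \<in> X" "fst x \<in> set_of (I i)" "snd x = (1, single i 1)" | i where "i \<in> X" "snd x = (0, single i 1)"
      using bspec[OF ops(1) x] by blast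
    then have "gen (fst x) * J I p u \<le> J I (p + fst (snd x)) (u + snd (snd x)) \<and> (keys u \<subseteq> X \<longrightarrow> keys (u + snd (snd x)) \<subseteq> X)"
    proof cases
      case 1
      then show ?thesis using times_J_step[of "gen (fst x)" I i p u] by simp
    next
      case 2
      have "gen (fst x) * J I p u \<le> J I p u" by (rule ideal_times_le2)
      also have "\<dots> \<le> J I p (u + single i 1)" by (rule J_mono_add)
      finally show ?thesis using 2 by simp
    qed
    then show "gen (fst x) * J I p u \<le> J I (p + fst (snd x)) (u + snd (snd x))"
      "keys u \<subseteq> X \<Longrightarrow> keys (u + snd (snd x)) \<subseteq> X" by blast+
  qed
  have sW: "stable (set ops) W"
  proof (rule stableI)
    fix x d assume x: "x \<in> set ops"
    show "gen (fst x) * W d \<le> W (d + snd x)"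
      using sJ[OF x, of "fst d" "snd d"] sX[OF x, of "snd d"] by (auto simp: W_def)
  qed
  have sV: "stable (set ops) V"
  proof (rule stableI)
    fix x d assume x: "x \<in> set ops"
    have "gen (fst x) * (m ^ c * J I (fst d) (snd d)) = m ^ c * (gen (fst x) * J I (fst d) (snd d))"
      by (rule mult.left_commute)
    also have "\<dots> \<le> m ^ c * J I (fst d + fst (snd x)) (snd d + snd (snd x))"
      by (intro ideal_times_mono order_refl sJ[OF x])
    finally show "gen (fst x) * V d \<le> V (d + snd x)"
      using sJ[OF x, of "Suc (fst d)" "snd d"] sX[OF x, of "snd d"]
      by (auto simp: V_def times_sup intro: le_supI1 le_supI2)
  qed
  \<comment> \<open>This grading by \<open>(p, q)\<close> gives the generators the degrees
    \<open>(1, 0)\<close> and \<open>(0, 1)\<close>: a factor from M raises \<open>p\<close> and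
    keeps \<open>q\<close>, a variable raises \<open>q\<close>. It is taken in the integers because
    \<open>|u| - p\<close> can be negative; the lengths vanish there.\<close>
  define \<pi> :: "nat \<times> mon \<Rightarrow> int \<times> int" where "\<pi> d = (int (fst d), int (mdeg (snd d)) - int (fst d))" for d
  have hom: "\<pi> (d + d') = \<pi> d + \<pi> d'" for d d' by (simp add: \<pi>_def)
  have supp: "hl V W d \<noteq> 0 \<Longrightarrow> keys (snd d) \<subseteq> X \<and> fst d \<le> mdeg (snd d)" for d
  proof (rule ccontr)
    assume h: "hl V W d \<noteq> 0" "\<not> (keys (snd d) \<subseteq> X \<and> fst d \<le> mdeg (snd d))"
    then have "V d = W d" by (auto simp: V_def W_def J_bot)
    with h(1) show False by (simp add: hl_def zero_enat_def)
  qed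
  have fib: "{d. \<pi> d = (int p, int q) \<and> hl V W d \<noteq> 0} \<subseteq> Pair p ` mons X (p + q)" for p q
  proof
    fix d assume "d \<in> {d. \<pi> d = (int p, int q) \<and> hl V W d \<noteq> 0}"
    then have d: "fst d = p" "mdeg (snd d) = p + q" "keys (snd d) \<subseteq> X"
      using supp[of d] by (auto simp: \<pi>_def)
    then have "d = (p, snd d)" "snd d \<in> mons X (p + q)" by (auto simp: mons_def)
    then show "d \<in> Pair p ` mons X (p + q)" by blast
  qed
  have empty: "{d. \<pi> d = (p, q) \<and> hl V W d \<noteq> 0} = {}" if "p < 0 \<or> q < 0" for p q
    using that supp by (force simp: \<pi>_def)
  define F where "F = push \<pi> (hl V W)"
  have "finite {d. \<pi> d = e \<and> hl V W d \<noteq> 0}" for e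
  proof (cases e)
    case (Pair p q)
    show ?thesis
    proof (cases "p < 0 \<or> q < 0")
      case True then show ?thesis by (simp only: Pair empty finite.emptyI)
    next
      case False
      then have "{d. \<pi> d = e \<and> hl V W d \<noteq> 0} \<subseteq> Pair (nat p) ` mons X (nat p + nat q)"
        using fib[of "nat p" "nat q"] by (simp add: Pair)
      then show ?thesis by (rule finite_subset) (simp add: finite_mons finX)
    qed
  qed
  moreover have "hs (map snd ops) (hl V W)"
    by (rule Hilbert_Serre[OF ops(2) sW sV V_le_W fin_len_V_W]) auto
  ultimately have hsF: "hs (map \<pi> (map snd ops)) F" unfolding F_def by (intro hs_push hom)
  have "good (\<lambda>p q. of_int (F (int p, int q)))"
  proof (rule good_hs[OF hsF])
    show "set (map \<pi> (map snd ops)) \<subseteq> {(1, 0), (0, 1)}"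
      using ops(1) by (fastforce simp: \<pi>_def)
    show "F (p, q) = 0" if "p < 0 \<or> q < 0" for p q
      unfolding F_def push_def empty[OF that] by simp
  qed
  then have "epoly2 (\<lambda>p q. \<Sum>i<p. of_int (F (int i, int (p + q - i))))"
    by (rule good_antidiagonal_sum)
  \<comment> \<open>In total degree \<open>p + q\<close> the layers \<open>i < p\<close> telescope
    from \<open>J I 0 u = top\<close>, of colength 0, to \<open>J I p u\<close>.\<close>
  moreover have "(\<Sum>i<p. of_int (F (int i, int (p + q - i)))) = (of_nat (Lam p q) :: rat)" for p q
  proof -
    have F: "F (int i, int (p + q - i)) = (\<Sum>u\<in>mons X (p + q). int (colen (J I (Suc i) u)) - int (colen (J I i u)))"
      if "i < p" for i
    proof -
      have ipq: "i + (p + q - i) = p + q" using that by simp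
      have "F (int i, int (p + q - i)) = (\<Sum>d\<in>Pair i ` mons X (p + q). hl V W d)"
        unfolding F_def
      proof (rule push_eq)
        show "finite (Pair i ` mons X (p + q))" by (simp add: finite_mons finX)
        show "{d. \<pi> d = (int i, int (p + q - i)) \<and> hl V W d \<noteq> 0} \<subseteq> Pair i ` mons X (p + q)"
          using fib[of i "p + q - i"] unfolding ipq .
        show "\<pi> d = (int i, int (p + q - i))" if "d \<in> Pair i ` mons X (p + q)" for d
          using that \<open>i < p\<close> by (auto simp: \<pi>_def mons_def)
      qed
      also have "\<dots> = (\<Sum>u\<in>mons X (p + q). hl V W (i, u))"
        by (subst sum.reindex) (auto intro: inj_onI)
      also have "\<dots> = (\<Sum>u\<in>mons X (p + q). int (colen (J I (Suc i) u)) - int (colen (J I i u)))"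
      proof (rule sum.cong[OF refl])
        fix u assume "u \<in> mons X (p + q)"
        then have u: "keys u \<subseteq> X" "mdeg u = p + q" by (simp_all add: mons_def)
        have "m ^ (c * Suc i) \<le> J I (Suc i) u" using u that by (intro J_ge) auto
        note colen_diff[OF this J_Suc_le]
        \<comment> \<open>\<open>i < p \<le> |u|\<close> is the range in which the second summand of
          \<open>V\<close> is absorbed.\<close>
        moreover have "V (i, u) = J I (Suc i) u" using u that by (intro V_eq) auto
        moreover have "W (i, u) = J I i u" using u by (simp add: W_def)
        ultimately show "hl V W (i, u) = int (colen (J I (Suc i) u)) - int (colen (J I i u))"
          by (simp add: hl_def of_nat_diff)
      qed
      finally show ?thesis .
    qed
    have "(\<Sum>i<p. F (int i, int (p + q - i))) =
        (\<Sum>u\<in>mons X (p + q). \<Sum>i<p. int (colen (J I (Suc i) u)) - int (colen (J I i u)))"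
      using F by (subst sum.swap) simp
    also have "\<dots> = (\<Sum>u\<in>mons X (p + q). int (colen (J I p u)) - int (colen (J I 0 u)))"
      by (intro sum.cong refl sum_lessThan_telescope)
    also have "\<dots> = int (Lam p q)"
      by (simp add: Lam_def J_0 colen_def zero_enat_def)
    finally show ?thesis by (metis of_int_of_nat_eq of_int_sum)
  qed
  ultimately show ?thesis by simp
qed

end


section \<open>Monomial submodules\<close>

lemma lookup_mscale [simp]: "lookup (mscale c f) u = c * lookup f u"
  by (simp add: mscale_def mult_map_scale_conv_mult[symmetric] Poly_Mapping.map.rep_eq when_def)

lemma mscale_single: "mscale c (single u a) = single u (c * a)"
  by (simp add: mscale_def mult_single)

lemma submodule_add: "is_submodule N \<Longrightarrow> f \<in> N \<Longrightarrow> g \<in> N \<Longrightarrow> f + g \<in> N"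
  and submodule_diff: "is_submodule N \<Longrightarrow> f \<in> N \<Longrightarrow> g \<in> N \<Longrightarrow> f - g \<in> N"
  and submodule_scale: "is_submodule N \<Longrightarrow> f \<in> N \<Longrightarrow> mscale c f \<in> N"
  and submodule_0: "is_submodule N \<Longrightarrow> 0 \<in> N"
  and submodule_sum: "is_submodule N \<Longrightarrow> (\<And>i. i \<in> A \<Longrightarrow> F i \<in> N) \<Longrightarrow> sum F A \<in> N"
  by (simp_all add: mpoly_module.subspace_add mpoly_module.subspace_diff mpoly_module.subspace_scale
      mpoly_module.subspace_0 mpoly_module.subspace_sum)

lemma sum_singles: "(\<Sum>u\<in>keys f. single u (lookup f u)) = f"
proof (rule poly_mapping_eqI)
  fix v
  have "lookup (\<Sum>u\<in>keys f. single u (lookup f u)) v = (\<Sum>u\<in>keys f. if u = v then lookup f u else 0)"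
    by (simp add: lookup_sum lookup_single when_def)
  also have "\<dots> = lookup f v" by (simp add: in_keys_iff)
  finally show "lookup (\<Sum>u\<in>keys f. single u (lookup f u)) v = lookup f v" .
qed

definition monmod :: "mon set \<Rightarrow> (mon \<Rightarrow> 'a::comm_ring_1 ideal) \<Rightarrow> 'a mpoly set" where
  "monmod U K = {f. keys f \<subseteq> U \<and> (\<forall>u\<in>U. lookup f u \<in> set_of (K u))}"

lemma submodule_monmod: "is_submodule (monmod U K)"
proof (rule mpoly_module.subspaceI)
  show "0 \<in> monmod U K" by (simp add: monmod_def)
next
  fix f g assume "f \<in> monmod U K" "g \<in> monmod U K"
  then show "f + g \<in> monmod U K"
    using keys_add[of f g] by (auto simp: monmod_def lookup_add intro: ideal_add)
next
  fix c f assume f: "f \<in> monmod U K"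
  have "keys (mscale c f) \<subseteq> keys f" by (auto simp: in_keys_iff)
  with f show "mscale c f \<in> monmod U K" by (auto simp: monmod_def intro: ideal_mult)
qed

definition monomial_coeffs :: "'a::comm_ring_1 mpoly set \<Rightarrow> mon \<Rightarrow> 'a ideal" where
  "monomial_coeffs N u = Ideal {c. single u c \<in> N}"

lemma set_of_monomial_coeffs: "is_submodule N \<Longrightarrow> set_of (monomial_coeffs N u) = {c. single u c \<in> N}"
  unfolding monomial_coeffs_def
  by (rule set_of_Ideal, rule self_module.subspaceI)
    (auto simp: single_add submodule_0 intro: submodule_add dest: submodule_scale[of N "single u _"] simp flip: mscale_single)

lemma monmod_le:
  assumes "is_submodule N" "\<And>u. u \<in> U \<Longrightarrow> K u \<le> monomial_coeffs N u"
  shows "monmod U K \<subseteq> N"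
proof
  fix f assume f: "f \<in> monmod U K"
  have "(\<Sum>u\<in>keys f. single u (lookup f u)) \<in> N"
  proof (rule submodule_sum[OF assms(1)])
    fix u assume "u \<in> keys f"
    then have "u \<in> U" "lookup f u \<in> set_of (K u)" using f by (auto simp: monmod_def)
    then have "lookup f u \<in> set_of (monomial_coeffs N u)" using assms(2) by (blast dest: ideal_leD)
    then show "single u (lookup f u) \<in> N" by (simp add: set_of_monomial_coeffs[OF assms(1)])
  qed
  then show "f \<in> N" by (simp add: sum_singles)
qed

lemma mult_mem_submodule:
  assumes "is_submodule N"
    and "\<And>u v. u \<in> keys f \<Longrightarrow> v \<in> keys g \<Longrightarrow> single (u + v) (lookup f u * lookup g v) \<in> N"
  shows "f * g \<in> N"
proof -
  have "f * g = (\<Sum>u\<in>keys f. single u (lookup f u)) * (\<Sum>v\<in>keys g. single v (lookup g v))"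
    by (simp only: sum_singles)
  also have "\<dots> = (\<Sum>u\<in>keys f. \<Sum>v\<in>keys g. single (u + v) (lookup f u * lookup g v))"
    by (simp add: sum_product mult_single)
  also have "\<dots> \<in> N" using assms by (intro submodule_sum)
  finally show ?thesis .
qed

lemma single_mem_monmod:
  "u \<in> U \<Longrightarrow> c \<in> set_of (K u) \<Longrightarrow> single u c \<in> monmod U K"
  by (auto simp: monmod_def lookup_single when_def split: if_splits)

text \<open>Submodules in between need not be monomial. A chain is therefore split by the ideal of
  coefficients at \<open>u\<close> and by the kernel of taking that coefficient; for the converse
  two chains are joined at a module in the middle.\<close>

lemma clen_monmod:
  fixes K :: "mon \<Rightarrow> 'a::comm_ring_1 ideal"
  assumes "finite U"
  shows "clen {N. is_submodule N} (monmod U K) (monmod U (\<lambda>_. top)) = (\<Sum>u\<in>U. len (K u) top)"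
  using assms
proof (induction U rule: finite_induct)
  case empty
  have "monmod {} K = monmod {} (\<lambda>_. top)" by (simp add: monmod_def)
  then show ?case by simp
next
  case (insert u U)
  let ?c = "\<lambda>N :: 'a mpoly set. (\<lambda>f. lookup f u) ` N"
  let ?f = "\<lambda>N. Ideal (?c N)" and ?g = "\<lambda>N. N \<inter> {f :: 'a mpoly. lookup f u = 0}"
  let ?F = "\<lambda>N. {f :: 'a mpoly. keys f \<subseteq> insert u U \<and> lookup f u \<in> set_of (K u) \<and> f - single u (lookup f u) \<in> N}"
  let ?L = "{N :: 'a mpoly set. is_submodule N}" and ?U = "insert u U"
  let ?B = "monmod ?U K" and ?A = "monmod ?U (\<lambda>_. top :: 'a ideal)"
  have uniq: "f - single u (lookup f u) \<in> monmod U K" if "f \<in> monmod ?U K" for f and K :: "mon \<Rightarrow> 'a ideal"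
    using that insert.hyps
    by (auto simp: monmod_def lookup_minus lookup_single when_def in_keys_iff split: if_splits)
  have "clen ?L ?B ?A \<le> len (K u) top + clen ?L (monmod U K) (monmod U (\<lambda>_. top))"
  proof (rule clen_split[where f = ?f and g = ?g])
    have im: "is_ideal ((\<lambda>f. lookup f u) ` N)" if "N \<in> ?L" for N
    proof (rule self_module.subspaceI)
      show "0 \<in> ?c N" using that submodule_0 by (intro image_eqI[of _ _ 0]) auto
    next
      fix x y assume "x \<in> ?c N" "y \<in> ?c N"
      then obtain f g where "f \<in> N" "g \<in> N" "x = lookup f u" "y = lookup g u" by blast
      then show "x + y \<in> ?c N"
        using that submodule_add by (intro image_eqI[of _ _ "f + g"]) (auto simp: lookup_add)
    next
      fix c x assume "x \<in> ?c N"
      then obtain f where "f \<in> N" "x = lookup f u" by blast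
      then show "c * x \<in> ?c N"
        using that submodule_scale by (intro image_eqI[of _ _ "mscale c f"]) auto
    qed
    fix N N' :: "'a mpoly set" assume N: "N \<in> ?L" "N' \<in> ?L" "N < N'"
    have z: "is_submodule {f :: 'a mpoly. lookup f u = 0}"
      by (rule mpoly_module.subspaceI) (auto simp: lookup_add)
    have sub: "?g M \<in> ?L" if "M \<in> ?L" for M
      using that z by (auto intro: mpoly_module.subspace_inter)
    have "\<not> (?c N = ?c N' \<and> ?g N = ?g N')"
    proof
      assume eq: "?c N = ?c N' \<and> ?g N = ?g N'"
      have "N' \<subseteq> N"
      proof
        fix g assume g: "g \<in> N'"
        then have "lookup g u \<in> ?c N" using eq by blast
        then obtain f where f: "f \<in> N" "lookup f u = lookup g u" by auto
        have "g - f \<in> N'" using N g f(1) by (auto intro: submodule_diff)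
        then have "g - f \<in> ?g N'" using f(2) by (simp add: lookup_minus)
        then have "g - f \<in> N" using eq by blast
        then have "(g - f) + f \<in> N" using N(1) f(1) by (intro submodule_add) simp_all
        then show "g \<in> N" by simp
      qed
      then show False using N(3) by blast
    qed
    moreover have "?f N \<le> ?f N'"
      using N im[OF N(1)] im[OF N(2)] by (auto simp: less_eq_ideal_def)
    moreover have "?f N = ?f N' \<longleftrightarrow>
        ?c N = ?c N'"
      using im[OF N(1)] im[OF N(2)] by (simp add: Ideal_inject)
    ultimately show "?f N \<in> UNIV \<and> ?f N' \<in> UNIV \<and>
       ?g N \<in> ?L \<and> ?g N' \<in> ?L \<and>
       ?f N \<le> ?f N' \<and>
       ?g N \<le> ?g N' \<and>
       (?f N \<noteq> ?f N' \<or>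
         ?g N \<noteq> ?g N')"
      using N sub[OF N(1)] sub[OF N(2)] by auto
  next
    have im: "?c (monmod ?U K) = set_of (K u)" for K :: "mon \<Rightarrow> 'a ideal"
    proof
      show "?c (monmod ?U K) \<subseteq> set_of (K u)" by (auto simp: monmod_def)
      show "set_of (K u) \<subseteq> ?c (monmod ?U K)"
      proof
        fix c assume "c \<in> set_of (K u)"
        then have "single u c \<in> monmod ?U K" by (intro single_mem_monmod) auto
        then show "c \<in> ?c (monmod ?U K)" by (rule rev_image_eqI) simp
      qed
    qed
    have Id: "?f (monmod ?U K) = K u" for K :: "mon \<Rightarrow> 'a ideal"
      unfolding im by (rule set_of_inverse)
    show "?f ?B = K u" by (rule Id)
    show "?f ?A = top" using Id[of "\<lambda>_. top"] .
    have ker: "?g (monmod ?U K) = monmod U K" for K :: "mon \<Rightarrow> 'a ideal"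
    proof (intro set_eqI iffI)
      fix f assume "f \<in> ?g (monmod ?U K)"
      then show "f \<in> monmod U K" by (auto simp: monmod_def in_keys_iff subset_iff)
    next
      fix f assume f: "f \<in> monmod U K"
      then have "lookup f u = 0" using insert.hyps by (auto simp: monmod_def in_keys_iff subset_iff)
      with f show "f \<in> ?g (monmod ?U K)" by (auto simp: monmod_def)
    qed
    show "?g ?B = monmod U K" by (rule ker)
    show "?g ?A = monmod U (\<lambda>_. top)" using ker[of "\<lambda>_. top"] .
  qed
  moreover have "len (K u) top + clen ?L (monmod U K) (monmod U (\<lambda>_. top)) \<le> clen ?L ?B ?A"
  proof -
    \<comment> \<open>The module in the middle allows \<open>K u\<close> at \<open>u\<close> and
      everything elsewhere: above it only the coefficient at \<open>u\<close> varies, below it only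
      the others.\<close>
    let ?M = "monmod ?U ((\<lambda>_. top)(u := K u))" and ?E = "\<lambda>N. monmod ?U ((\<lambda>_. top)(u := N))"
    have 1: "len (K u) top \<le> clen ?L ?M ?A"
    proof (rule clen_map[where f = ?E])
      fix N N' :: "'a ideal" assume "N < N'"
      then have NN: "set_of N \<subset> set_of N'" by (simp add: less_ideal_def)
      then obtain c where c: "c \<in> set_of N'" "c \<notin> set_of N" by blast
      have "?E N \<subseteq> ?E N'" using NN by (auto simp: monmod_def)
      moreover have "single u c \<in> ?E N'" using c by (intro single_mem_monmod) auto
      moreover have "single u c \<notin> ?E N" using c by (simp add: monmod_def)
      ultimately have "?E N \<subset> ?E N'" by blast
      then show "chain_step ?L (?E N) (?E N')" by (simp add: submodule_monmod)
    qed (auto simp: monmod_def)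
    have 2: "clen ?L (monmod U K) (monmod U (\<lambda>_. top)) \<le> clen ?L ?B ?M"
    proof (rule clen_map[where f = ?F])
      fix N N' :: "'a mpoly set"
      assume N: "N \<in> ?L" "N' \<in> ?L" "N < N'" "N' \<le> monmod U (\<lambda>_. top)"
      have subm: "is_submodule (?F N)" if N: "N \<in> ?L" for N
      proof (rule mpoly_module.subspaceI)
        show "0 \<in> ?F N" using N submodule_0 by auto
      next
        fix f g assume f: "f \<in> ?F N" and g: "g \<in> ?F N"
        have "f + g - single u (lookup (f + g) u) = (f - single u (lookup f u)) + (g - single u (lookup g u))"
          by (simp add: lookup_add single_add)
        also have "\<dots> \<in> N" using f g N by (auto intro: submodule_add)
        finally show "f + g \<in> ?F N"
          using f g keys_add[of f g] by (auto simp: lookup_add intro: ideal_add)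
      next
        fix c f assume f: "f \<in> ?F N"
        have k: "keys (mscale c f) \<subseteq> keys f" by (auto simp: in_keys_iff)
        have "mscale c f - single u (lookup (mscale c f) u) = mscale c (f - single u (lookup f u))"
          by (intro poly_mapping_eqI) (simp add: lookup_minus lookup_single when_def right_diff_distrib)
        also have "\<dots> \<in> N" using f N by (auto intro: submodule_scale)
        finally show "mscale c f \<in> ?F N" using f k by (auto intro: ideal_mult)
      qed
      obtain f where f: "f \<in> N'" "f \<notin> N" using N(3) by blast
      then have k: "keys f \<subseteq> U" using N(4) by (auto simp: monmod_def)
      then have "lookup f u = 0" using insert.hyps by (auto simp: in_keys_iff subset_iff)
      then have "f \<in> ?F N'" "f \<notin> ?F N" using f k by auto
      moreover have "?F N \<subseteq> ?F N'" using N(3) by blast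
      ultimately have "?F N < ?F N'" by blast
      then show "chain_step ?L (?F N) (?F N')" using subm N by simp
    next
      have F: "?F (monmod U K') = monmod ?U (K'(u := K u))"
        for K' :: "mon \<Rightarrow> 'a ideal"
      proof (intro set_eqI iffI)
        fix f assume "f \<in> ?F (monmod U K')"
        then have f: "keys f \<subseteq> ?U" "lookup f u \<in> set_of (K u)" "\<And>v. v \<in> U \<Longrightarrow> lookup (f - single u (lookup f u)) v \<in> set_of (K' v)"
          by (simp_all add: monmod_def)
        have "lookup f v \<in> set_of (K' v)" if "v \<in> U" for v
        proof -
          have "v \<noteq> u" using that insert.hyps by blast
          then show ?thesis using f(3)[OF that] by (simp add: lookup_minus lookup_single when_def)
        qed
        with f(1,2) show "f \<in> monmod ?U (K'(u := K u))" by (simp add: monmod_def)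
      next
        fix f assume f: "f \<in> monmod ?U (K'(u := K u))"
        have "f - single u (lookup f u) \<in> monmod U (K'(u := K u))" by (rule uniq[OF f])
        also have "monmod U (K'(u := K u)) = monmod U K'"
          using insert.hyps by (auto simp: monmod_def)
        finally show "f \<in> ?F (monmod U K')"
          using f by (simp add: monmod_def)
      qed
      show "?F (monmod U K) = ?B"
        unfolding F by simp
      show "?F (monmod U (\<lambda>_. top)) = ?M"
        by (rule F)
    qed
    have "len (K u) top + clen ?L (monmod U K) (monmod U (\<lambda>_. top)) \<le> clen ?L ?M ?A + clen ?L ?B ?M"
      using 1 2 by (rule add_mono)
    also have "\<dots> = clen ?L ?B ?M + clen ?L ?M ?A" by (rule add.commute)
    also have "\<dots> \<le> clen ?L ?B ?A"
      by (rule clen_concat) (simp_all add: submodule_monmod, auto simp: monmod_def)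
    finally show ?thesis .
  qed
  ultimately have "clen ?L ?B ?A = len (K u) top + clen ?L (monmod U K) (monmod U (\<lambda>_. top))"
    by (rule antisym)
  then show ?case using insert by simp
qed

lemma sym_comp_eq: "sym_comp r p = monmod (mons {1..r} p) (\<lambda>_. top)"
  by (auto simp: sym_comp_def monmod_def mons_def mdeg_def)

lemma quot_length_monmod:
  "quot_length (sym_comp r p) (monmod (mons {1..r} p) K) = (\<Sum>u\<in>mons {1..r} p. len (K u) top)"
  unfolding quot_length_eq sym_comp_eq by (rule clen_monmod) (simp add: finite_mons)

text \<open>Since \<open>ipow\<close> turns sums of exponents into products, the polynomials with
  coefficient in \<open>ipow I u\<close> at every \<open>u\<close> form a subalgebra that contains
  M. Conversely, a monomial with such a coefficient is built up one variable at a time from elements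
  of M.\<close>

lemma rees_comp_cyclic_sum:
  fixes I :: "nat \<Rightarrow> 'a::comm_ring_1 ideal"
  shows "rees_comp r (cyclic_sum r (\<lambda>i. set_of (I i))) p = monmod (mons {1..r} p) (ipow I)"
proof
  let ?M = "cyclic_sum r (\<lambda>i. set_of (I i))" and ?N = "monmod UNIV (ipow I)"
  have subN: "is_submodule ?N" by (rule submodule_monmod)
  have "f \<in> ?N" if "f \<in> rees_algebra ?M" for f
    using that
  proof induction
    case (const c)
    show ?case by (rule single_mem_monmod) auto
  next
    case (gen f)
    have "lookup f u \<in> set_of (ipow I u)" for u
    proof (cases "u \<in> keys f")
      case True
      then have "keys u \<subseteq> {1..r}" "mdeg u = Suc 0"
        using gen by (auto simp: cyclic_sum_def sym_comp_def mdeg_def)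
      then obtain i v where v: "i \<in> keys u" "u = v + single i 1" "mdeg v = 0"
        by (elim mdeg_Suc_decompose)
      then have u: "u = single i 1" by (simp add: mdeg_eq_0)
      moreover have "i \<in> {1..r}" using v(1) \<open>keys u \<subseteq> {1..r}\<close> by blast
      ultimately show ?thesis using gen by (auto simp: cyclic_sum_def)
    qed (simp add: in_keys_iff)
    then show ?case by (simp add: monmod_def)
  next
    case (add f g)
    show ?case using subN add.IH by (rule submodule_add)
  next
    case (mult f g)
    have "lookup f u * lookup g v \<in> set_of (ipow I (u + v))" for u v
      using mult.IH unfolding ipow_add by (intro times_memI) (simp_all add: monmod_def)
    then show ?case by (intro mult_mem_submodule[OF subN] single_mem_monmod) simp_all
  qed
  then show "rees_comp r ?M p \<subseteq> monmod (mons {1..r} p) (ipow I)"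
    by (auto simp: rees_comp_def sym_comp_eq monmod_def)
  have sub: "is_submodule (rees_algebra ?M)"
  proof (rule mpoly_module.subspaceI)
    show "0 \<in> rees_algebra ?M" using rees_algebra.const[of 0] by simp
  qed (auto simp: mscale_def intro: rees_algebra.intros)
  have "ipow I u \<le> monomial_coeffs (rees_algebra ?M) u" if "mdeg u = k" "keys u \<subseteq> {1..r}" for k u
    using that
  proof (induction k arbitrary: u)
    case 0
    then show ?case
      by (auto simp: mdeg_eq_0 less_eq_ideal_def set_of_monomial_coeffs[OF sub] intro: rees_algebra.const)
  next
    case (Suc k)
    from Suc.prems(1) obtain i v where v: "i \<in> keys u" "u = v + single i 1" "mdeg v = k"
      by (rule mdeg_Suc_decompose)
    then have iv: "i \<in> {1..r}" "keys v \<subseteq> {1..r}" using Suc.prems(2) by auto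
    have IH: "ipow I v \<le> monomial_coeffs (rees_algebra ?M) v" using v(3) iv(2) by (rule Suc.IH)
    have "I i * ipow I v \<le> monomial_coeffs (rees_algebra ?M) u"
      unfolding times_le_iff
    proof (intro ballI)
      fix a b assume a: "a \<in> set_of (I i)" and b: "b \<in> set_of (ipow I v)"
      have inj: "single i (Suc 0) = single j (Suc 0) \<longleftrightarrow> i = j" for j
      proof
        assume "single i (Suc 0) = single j (Suc 0)"
        then have "keys (single i (Suc 0)) = keys (single j (Suc 0))" by (rule arg_cong)
        then show "i = j" by simp
      qed simp
      have "single (single i 1) a \<in> ?M"
        using a iv(1) by (auto simp: cyclic_sum_def sym_comp_def lookup_single when_def inj split: if_splits)
      then have "single (single i 1) a \<in> rees_algebra ?M" by (rule rees_algebra.gen)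
      moreover have "single v b \<in> rees_algebra ?M"
        using ideal_leD[OF IH b] by (simp add: set_of_monomial_coeffs[OF sub])
      ultimately have "single (single i 1) a * single v b \<in> rees_algebra ?M" by (rule rees_algebra.mult)
      then show "a * b \<in> set_of (monomial_coeffs (rees_algebra ?M) u)"
        by (simp add: set_of_monomial_coeffs[OF sub] mult_single v(2) add.commute)
    qed
    then show ?case by (simp add: v(2) ipow_add mult.commute)
  qed
  then have "monmod (mons {1..r} p) (ipow I) \<subseteq> rees_algebra ?M"
    by (intro monmod_le[OF sub]) (simp add: mons_def)
  moreover have "monmod (mons {1..r} p) (ipow I) \<subseteq> sym_comp r p"
    by (auto simp: sym_comp_eq monmod_def)
  ultimately show "monmod (mons {1..r} p) (ipow I) \<subseteq> rees_comp r ?M p"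
    unfolding rees_comp_def by blast
qed

text \<open>Each way of writing \<open>u = n + w\<close> with \<open>|n| = p\<close> contributes
  \<open>ipow I n\<close> to the coefficients at \<open>u\<close>, the monomial \<open>w\<close>
  being taken from S_q; these ideals add up to \<open>J I p u\<close>.\<close>

lemma span_rees_comp_sym_comp:
  fixes I :: "nat \<Rightarrow> 'a::comm_ring_1 ideal"
  shows "module.span mscale {f * g | f g. f \<in> rees_comp r (cyclic_sum r (\<lambda>i. set_of (I i))) p \<and> g \<in> sym_comp r q}
    = monmod (mons {1..r} (p + q)) (J I p)" (is "module.span mscale ?S = ?N")
proof
  show "module.span mscale ?S \<subseteq> ?N"
  proof (rule mpoly_module.span_minimal)
    show "?S \<subseteq> ?N"
    proof clarify
      fix f g :: "'a mpoly"
      assume f: "f \<in> rees_comp r (cyclic_sum r (\<lambda>i. set_of (I i))) p" and g: "g \<in> sym_comp r q"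
      show "f * g \<in> ?N"
      proof (rule mult_mem_submodule[OF submodule_monmod])
        fix u v assume uv: "u \<in> keys f" "v \<in> keys g"
        have u: "u \<in> mons {1..r} p" "lookup f u \<in> set_of (ipow I u)"
          using f uv(1) unfolding rees_comp_cyclic_sum by (auto simp: monmod_def)
        have v: "v \<in> mons {1..r} q" using g uv(2) unfolding sym_comp_eq by (auto simp: monmod_def)
        have "ipow I u \<le> J I p (u + v)" using u(1) by (intro J_upper[of _ _ v]) (simp_all add: mons_def)
        then have "lookup f u * lookup g v \<in> set_of (J I p (u + v))"
          using u(2) by (blast dest: ideal_leD intro: ideal_mult_right)
        then show "single (u + v) (lookup f u * lookup g v) \<in> ?N"
          using u(1) v by (intro single_mem_monmod) (auto simp: mons_def)
      qed
    qed
  qed (rule submodule_monmod)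
  have sub: "is_submodule (module.span mscale ?S)" by (rule mpoly_module.subspace_span)
  show "?N \<subseteq> module.span mscale ?S"
  proof (rule monmod_le[OF sub], rule J_least)
    fix u n w assume u: "u \<in> mons {1..r} (p + q)" and n: "mdeg n = p" "n + w = u"
    then have n': "n \<in> mons {1..r} p" "w \<in> mons {1..r} q" by (auto simp: mons_def)
    show "ipow I n \<le> monomial_coeffs (module.span mscale ?S) u"
    proof (rule ideal_leI)
      fix c assume "c \<in> set_of (ipow I n)"
      then have "single n c \<in> rees_comp r (cyclic_sum r (\<lambda>i. set_of (I i))) p"
        unfolding rees_comp_cyclic_sum using n' by (intro single_mem_monmod)
      moreover have "single w 1 \<in> (sym_comp r q :: 'a mpoly set)"
        unfolding sym_comp_eq using n' by (intro single_mem_monmod) simp_all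
      ultimately have "single n c * single w 1 \<in> ?S" by blast
      then have "single n c * single w 1 \<in> module.span mscale ?S" by (rule mpoly_module.span_base)
      then show "c \<in> set_of (monomial_coeffs (module.span mscale ?S) u)"
        by (simp add: set_of_monomial_coeffs[OF sub] mult_single n(2))
    qed
  qed
qed

lemma br_fun_cyclic_sum:
  "br_fun r (cyclic_sum r (\<lambda>i. set_of (I i))) p = (\<Sum>u\<in>mons {1..r} p. len (ipow I u) top)"
  unfolding br_fun_def rees_comp_cyclic_sum by (rule quot_length_monmod)

lemma br_fun2_cyclic_sum:
  "br_fun2 r (cyclic_sum r (\<lambda>i. set_of (I i))) p q = (\<Sum>u\<in>mons {1..r} (p + q). len (J I p u) top)"
  unfolding br_fun2_def span_rees_comp_sym_comp by (rule quot_length_monmod)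


section \<open>Counting monomials\<close>

lemma card_mons_insert:
  "finite X \<Longrightarrow> i \<notin> X \<Longrightarrow> card (mons (insert i X) s) = (\<Sum>t\<le>s. card (mons X t))"
  using sum_mons_insert[of X i "\<lambda>_. 1 :: nat" s] by simp

lemma mons_empty: "mons {} s = (if s = 0 then {0} else {})"
  by (auto simp: mons_def)

lemma card_mons:
  assumes "finite X" "card X = Suc k"
  shows "card (mons X s) = (s + k) choose k"
  using assms
proof (induction k arbitrary: X s)
  case 0
  then obtain i where X: "X = {i}" by (metis One_nat_def card_1_singletonE)
  have "card (mons (insert i {}) s) = (\<Sum>t\<le>s. card (mons {} t))" by (rule card_mons_insert) auto
  also have "\<dots> = (\<Sum>t\<le>s. if t = 0 then 1 else 0)" by (intro sum.cong) (auto simp: mons_empty)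
  also have "\<dots> = 1" by simp
  finally show ?case by (simp add: X)
next
  case (Suc k)
  then obtain i Y where X: "X = insert i Y" "i \<notin> Y" "card Y = Suc k" by (metis card_Suc_eq)
  then have "finite Y" using Suc.prems by simp
  have "card (mons X s) = (\<Sum>t\<le>s. (k + t) choose k)"
    unfolding X(1) card_mons_insert[OF \<open>finite Y\<close> X(2)] using Suc.IH[OF \<open>finite Y\<close> X(3)]
    by (simp add: add.commute)
  also have "\<dots> = (k + s + 1) choose (k + 1)" by (rule choose_rising_sum)
  finally show ?case by (simp add: add.commute)
qed

text \<open>Its value at \<open>s\<close> is the binomial coefficient C(s+k, k); the recursion comes
  from \<open>(k+1) C(s+k+1, k+1) = (s+k+1) C(s+k, k)\<close>.\<close>

primrec multichoose_poly :: "nat \<Rightarrow> rat poly" where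
  "multichoose_poly 0 = 1"
| "multichoose_poly (Suc k) = smult (1 / of_nat (Suc k)) (multichoose_poly k * [:of_nat (Suc k), 1:])"

lemma poly_multichoose_poly: "poly (multichoose_poly k) (of_nat s) = of_nat ((s + k) choose k)"
proof (induction k)
  case (Suc k)
  have "Suc k * ((s + Suc k) choose Suc k) = (s + Suc k) * ((s + k) choose k)"
    using Suc_times_binomial[of k "s + k"] by simp
  then have "(of_nat (Suc k) * of_nat ((s + Suc k) choose Suc k) :: rat) = of_nat (s + Suc k) * of_nat ((s + k) choose k)"
    by (simp only: of_nat_mult[symmetric])
  then have "(of_nat ((s + Suc k) choose Suc k) :: rat) = of_nat (s + Suc k) * of_nat ((s + k) choose k) / of_nat (Suc k)"
    by (subst (asm) mult.commute) (simp add: eq_divide_eq del: of_nat_Suc binomial_Suc_Suc)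
  then show ?case by (simp add: Suc.IH add_divide_distrib algebra_simps del: binomial_Suc_Suc)
qed simp

lemma multichoose_poly_degree: "degree (multichoose_poly k) = k \<and> coeff (multichoose_poly k) k = 1 / fact k"
proof (induction k)
  case (Suc k)
  have ne: "multichoose_poly k \<noteq> 0" using Suc by auto
  have d: "degree (multichoose_poly (Suc k)) = Suc k"
    using degree_mult_eq[OF ne, of "[:of_nat (Suc k), 1:]"] Suc by (simp del: mult_pCons_right of_nat_Suc)
  have "coeff (multichoose_poly k * [:of_nat (Suc k), 1:]) (k + 1) = coeff (multichoose_poly k) k"
    using coeff_mult_degree_sum[of "multichoose_poly k" "[:of_nat (Suc k), 1:]"] Suc by simp
  then have "coeff (multichoose_poly (Suc k)) (Suc k) = 1 / fact (Suc k)"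
    using Suc by simp
  with d show ?case by simp
qed simp

lemma card_mons_le_power:
  assumes "finite X" "X \<noteq> {}"
  shows "card (mons X s) \<le> (s + 1) ^ (card X - 1)"
  using assms
proof (induction X arbitrary: s rule: finite_ne_induct)
  case (singleton i)
  then show ?case using card_mons[of "{i}" 0 s] by simp
next
  case (insert i X)
  have "card (mons (insert i X) s) = (\<Sum>t\<le>s. card (mons X t))"
    using insert.hyps by (intro card_mons_insert)
  also have "\<dots> \<le> (\<Sum>t\<le>s. (s + 1) ^ (card X - 1))"
  proof (rule sum_mono)
    fix t assume "t \<in> {..s}"
    then have "(t + 1) ^ (card X - 1) \<le> (s + 1) ^ (card X - 1)" by (intro power_mono) auto
    with insert.IH[of t] show "card (mons X t) \<le> (s + 1) ^ (card X - 1)" by simp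
  qed
  also have "\<dots> = (s + 1) ^ Suc (card X - 1)" by simp
  also have "Suc (card X - 1) = card (insert i X) - 1"
    using insert.hyps by (simp add: card_gt_0_iff)
  finally show ?case .
qed

text \<open>The factor \<open>q\<close> on the left replaces the exponent \<open>card X - 1\<close> on the right, so that \<open>X = {}\<close>, where
  there are no such monomials, needs no separate statement.\<close>

lemma card_small_exponent:
  assumes "finite X" "i \<notin> X" "q \<ge> 1"
  shows "q * card {v \<in> mons (insert i X) (q + a). lookup v i < a} \<le> a * (a + 2) ^ card X * q ^ card X"
proof -
  let ?s = "q + a"
  have b: "q * card (mons X t) \<le> (a + 2) ^ card X * q ^ card X" if "q < t" "t \<le> ?s" for t
  proof (cases "X = {}")
    case True then show ?thesis using that by (simp add: mons_empty)
  next
    case False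
    have "card (mons X t) \<le> (t + 1) ^ (card X - 1)" using assms(1) False by (rule card_mons_le_power)
    also have "\<dots> \<le> ((a + 2) * q) ^ (card X - 1)"
    proof (rule power_mono)
      have "t + 1 \<le> q + (a + 1) * 1" using that by simp
      also have "\<dots> \<le> q + (a + 1) * q" using assms(3) by (intro add_left_mono mult_left_mono) auto
      finally show "t + 1 \<le> (a + 2) * q" by simp
    qed simp
    finally have "q * card (mons X t) \<le> q * ((a + 2) * q) ^ (card X - 1)" by simp
    also have "\<dots> \<le> (a + 2) * q * ((a + 2) * q) ^ (card X - 1)" by simp
    also have "\<dots> = ((a + 2) * q) ^ card X"
      using False assms(1) by (cases "card X") (auto simp: card_eq_0_iff)
    finally show ?thesis by (simp only: power_mult_distrib)
  qed
  have "card {v \<in> mons (insert i X) ?s. lookup v i < a} = (\<Sum>v\<in>{v \<in> mons (insert i X) ?s. lookup v i < a}. 1)"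
    by simp
  also have "\<dots> = (\<Sum>v\<in>mons (insert i X) ?s. if lookup v i < a then 1 else 0)"
    by (rule sum.inter_filter) (simp add: finite_mons assms(1))
  also have "\<dots> = (\<Sum>t\<le>?s. \<Sum>v\<in>mons X t. if lookup (v + single i (?s - t)) i < a then 1 else 0)"
    using assms by (intro sum_mons_insert)
  \<comment> \<open>The exponent of \<open>i\<close> is \<open>q + a - t\<close>, which is below
    \<open>a\<close> exactly for \<open>t > q\<close>.\<close>
  also have "\<dots> \<le> (\<Sum>t\<le>?s. if q < t then card (mons X t) else 0)"
  proof (intro sum_mono)
    fix t assume t: "t \<in> {..?s}"
    have "(\<Sum>v\<in>mons X t. if lookup (v + single i (?s - t)) i < a then 1 else 0) = (\<Sum>v\<in>mons X t. if q < t then 1 else (0 :: nat))"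
    proof (rule sum.cong[OF refl])
      fix v assume "v \<in> mons X t"
      then have "lookup v i = 0" using assms(2) by (auto simp: mons_def in_keys_iff)
      then show "(if lookup (v + single i (?s - t)) i < a then 1 else 0) = (if q < t then 1 else (0 :: nat))"
        using t by (auto simp: lookup_add)
    qed
    then show "(\<Sum>v\<in>mons X t. if lookup (v + single i (?s - t)) i < a then 1 else 0) \<le> (if q < t then card (mons X t) else 0)"
      by simp
  qed
  also have "\<dots> = (\<Sum>t\<in>{q<..?s}. card (mons X t))"
    by (rule sum.mono_neutral_cong_right) auto
  finally have "q * card {v \<in> mons (insert i X) ?s. lookup v i < a} \<le> (\<Sum>t\<in>{q<..?s}. q * card (mons X t))"
    by (simp flip: sum_distrib_left)
  also have "\<dots> \<le> (\<Sum>t\<in>{q<..?s}. (a + 2) ^ card X * q ^ card X)"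
    using b by (intro sum_mono) auto
  also have "\<dots> = a * (a + 2) ^ card X * q ^ card X" by simp
  finally show ?thesis .
qed

lemma card_bad_monomials:
  assumes "finite Y" "card Y = Suc k"
  shows "\<exists>K. \<forall>q\<ge>1. q * card {v \<in> mons Y (q + a). \<exists>i\<in>Y. lookup v i < a} \<le> K * q ^ k"
proof -
  have "q * card {v \<in> mons Y (q + a). \<exists>i\<in>Y. lookup v i < a} \<le> (card Y * (a * (a + 2) ^ k)) * q ^ k"
    if q: "q \<ge> 1" for q
  proof -
    have "{v \<in> mons Y (q + a). \<exists>i\<in>Y. lookup v i < a} = (\<Union>i\<in>Y. {v \<in> mons Y (q + a). lookup v i < a})" by blast
    then have "q * card {v \<in> mons Y (q + a). \<exists>i\<in>Y. lookup v i < a} \<le> q * (\<Sum>i\<in>Y. card {v \<in> mons Y (q + a). lookup v i < a})"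
      using card_UN_le[OF assms(1), of "\<lambda>i. {v \<in> mons Y (q + a). lookup v i < a}"] by simp
    also have "\<dots> = (\<Sum>i\<in>Y. q * card {v \<in> mons Y (q + a). lookup v i < a})" by (rule sum_distrib_left)
    also have "\<dots> \<le> (\<Sum>i\<in>Y. a * (a + 2) ^ k * q ^ k)"
    proof (rule sum_mono)
      fix i assume i: "i \<in> Y"
      then have "insert i (Y - {i}) = Y" "card (Y - {i}) = k" using assms by auto
      with card_small_exponent[of "Y - {i}" i q a] assms(1) q
      show "q * card {v \<in> mons Y (q + a). lookup v i < a} \<le> a * (a + 2) ^ k * q ^ k" by simp
    qed
    finally show ?thesis by (simp add: mult.assoc)
  qed
  then show ?thesis by blast
qed

section \<open>Growth of polynomials\<close>

lemma poly_le_power: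
  fixes P :: "rat poly"
  assumes "degree P \<le> e"
  shows "\<exists>S\<ge>0. \<forall>n\<ge>1. \<bar>poly P (of_nat n)\<bar> \<le> S * of_nat n ^ e"
proof -
  have "\<bar>poly P (of_nat n)\<bar> \<le> (\<Sum>i\<le>degree P. \<bar>coeff P i\<bar>) * of_nat n ^ e" if "n \<ge> 1" for n
  proof -
    have "\<bar>poly P (of_nat n)\<bar> \<le> (\<Sum>i\<le>degree P. \<bar>coeff P i * of_nat n ^ i\<bar>)"
      unfolding poly_altdef by (rule sum_abs)
    also have "\<dots> \<le> (\<Sum>i\<le>degree P. \<bar>coeff P i\<bar> * of_nat n ^ e)"
    proof (rule sum_mono)
      fix i assume "i \<in> {..degree P}"
      then have "(of_nat n :: rat) ^ i \<le> of_nat n ^ e"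
        using that assms by (intro power_increasing) auto
      then show "\<bar>coeff P i * of_nat n ^ i\<bar> \<le> \<bar>coeff P i\<bar> * of_nat n ^ e"
        by (simp add: abs_mult mult_left_mono)
    qed
    finally show ?thesis by (simp add: sum_distrib_right)
  qed
  then show ?thesis by (intro exI[of _ "\<Sum>i\<le>degree P. \<bar>coeff P i\<bar>"]) (simp add: sum_nonneg)
qed

lemma degree_le_growth:
  fixes P :: "rat poly"
  assumes "\<And>n. n \<ge> N \<Longrightarrow> \<bar>poly P (of_nat n)\<bar> \<le> K * of_nat n ^ e"
  shows "degree P \<le> e"
proof (rule ccontr)
  assume "\<not> degree P \<le> e"
  then obtain D where D: "degree P = Suc D" "e \<le> D" by (cases "degree P") auto
  define L where "L = \<bar>lead_coeff P\<bar>"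
  have "P \<noteq> 0" using D(1) by auto
  then have L: "L > 0" by (simp add: L_def)
  define Q where "Q = P - monom (lead_coeff P) (Suc D)"
  have "degree Q \<le> D"
  proof (rule degree_le, intro allI impI)
    fix i assume "i > D"
    then show "coeff Q i = 0" using D(1) coeff_eq_0[of P i] by (cases "i = Suc D") (auto simp: Q_def)
  qed
  from poly_le_power[OF this] obtain S where S: "S \<ge> 0" "\<forall>n\<ge>1. \<bar>poly Q (of_nat n)\<bar> \<le> S * of_nat n ^ D" by blast
  obtain n0 :: nat where n0: "(S + \<bar>K\<bar>) / L < of_nat n0" using reals_Archimedean2 by blast
  define n where "n = max (max n0 N) 1"
  have n: "n \<ge> 1" "n \<ge> N" "n \<ge> n0" by (auto simp: n_def)
  have pos: "(0 :: rat) < of_nat n ^ D" using n(1) by simp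
  have "L * of_nat n ^ Suc D = \<bar>poly P (of_nat n) - poly Q (of_nat n)\<bar>"
    by (simp add: Q_def L_def poly_monom abs_mult)
  also have "\<dots> \<le> \<bar>poly P (of_nat n)\<bar> + \<bar>poly Q (of_nat n)\<bar>" by (rule abs_triangle_ineq4)
  also have "\<dots> \<le> \<bar>K\<bar> * of_nat n ^ D + S * of_nat n ^ D"
  proof (rule add_mono)
    have "\<bar>poly P (of_nat n)\<bar> \<le> K * of_nat n ^ e" using n by (intro assms)
    also have "\<dots> \<le> \<bar>K\<bar> * of_nat n ^ e" by (intro mult_right_mono) auto
    also have "\<dots> \<le> \<bar>K\<bar> * of_nat n ^ D"
      using D(2) n(1) by (intro mult_left_mono power_increasing) auto
    finally show "\<bar>poly P (of_nat n)\<bar> \<le> \<bar>K\<bar> * of_nat n ^ D" .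
    show "\<bar>poly Q (of_nat n)\<bar> \<le> S * of_nat n ^ D" using S(2) n(1) by blast
  qed
  finally have "(L * of_nat n) * of_nat n ^ D \<le> (S + \<bar>K\<bar>) * of_nat n ^ D"
    by (simp add: algebra_simps)
  then have "L * of_nat n \<le> S + \<bar>K\<bar>" using pos by (simp only: mult_le_cancel_right_pos)
  then have "of_nat n \<le> (S + \<bar>K\<bar>) / L" using L by (simp add: field_simps)
  from le_less_trans[OF this n0] have "(of_nat n :: rat) < of_nat n0" .
  with n(3) show False by simp
qed

text \<open>The extra factor \<open>n\<close> amounts to multiplying \<open>E\<close> by its
  variable. It expresses growth of order \<open>k - 1\<close> also for \<open>k = 0\<close>, where
  \<open>E\<close> has to vanish.\<close>

lemma coeff_eq_0_growth:
  fixes E :: "rat poly"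
  assumes "\<And>n. n \<ge> N \<Longrightarrow> of_nat n * \<bar>poly E (of_nat n)\<bar> \<le> K * of_nat n ^ k" and "j \<ge> k"
  shows "coeff E j = 0"
proof -
  have "degree (pCons 0 E) \<le> k"
    using assms(1) by (intro degree_le_growth[of N _ K]) (simp add: abs_mult)
  then have "coeff (pCons 0 E) (Suc j) = 0" using assms(2) by (intro coeff_eq_0) simp
  then show ?thesis by simp
qed

lemma poly_eq_0_infinite:
  fixes P :: "'b::idom poly" and f :: "nat \<Rightarrow> 'b"
  assumes "inj f" "\<And>n. n \<ge> N \<Longrightarrow> poly P (f n) = 0"
  shows "P = 0"
proof (rule ccontr)
  assume "P \<noteq> 0"
  then have "finite {x. poly P x = 0}" by (rule poly_roots_finite)
  then have "finite (f ` {N..})" by (rule finite_subset[rotated]) (use assms(2) in auto)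
  then have "finite {N..}" by (rule finite_imageD) (rule inj_on_subset[OF assms(1) subset_UNIV])
  then show False by (simp add: infinite_Ici)
qed

lemma poly_eq_eventually:
  fixes P Q :: "rat poly"
  assumes "\<And>n. n \<ge> N \<Longrightarrow> poly P (of_nat n) = poly Q (of_nat n)"
  shows "P = Q"
proof -
  have "P - Q = 0"
    by (rule poly_eq_0_infinite[of "of_nat :: nat \<Rightarrow> rat" N]) (use assms in \<open>auto intro: inj_of_nat\<close>)
  then show ?thesis by simp
qed

text \<open>The difference, taken as a polynomial over the domain \<open>rat poly\<close>, has
  infinitely many constant polynomials among its roots.\<close>

lemma poly2_eq_eventually:
  fixes P Q :: "rat poly poly"
  assumes "\<And>p q. p \<ge> N \<Longrightarrow> q \<ge> N \<Longrightarrow>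
    poly (poly P [:of_nat q:]) (of_nat p) = poly (poly Q [:of_nat q:]) (of_nat p)"
  shows "P = Q"
proof -
  have "P - Q = 0"
  proof (rule poly_eq_0_infinite[of "\<lambda>n. [:of_nat n :: rat:]" N])
    show "inj (\<lambda>n. [:of_nat n :: rat:])" by (auto intro: injI)
    fix q assume "q \<ge> N"
    then have "poly P [:of_nat q:] = poly Q [:of_nat q:]"
      using assms by (intro poly_eq_eventually[of N]) auto
    then show "poly (P - Q) [:of_nat q:] = 0" by simp
  qed
  then show ?thesis by simp
qed

lemma poly_map_poly_eval: "poly (map_poly (\<lambda>c. poly c x) H) y = poly (poly H [:y:]) (x :: rat)"
  by (induction H) (simp_all add: map_poly_pCons)

lemma sum_enat: "(\<Sum>i\<in>A. enat (f i)) = enat (\<Sum>i\<in>A. f i)"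
  by (induction A rule: infinite_finite_induct) (simp_all add: zero_enat_def)


section \<open>The leading coefficients\<close>

lemma ipow_le_power:
  assumes "\<And>i. i \<in> keys u \<Longrightarrow> I i \<le> B"
  shows "ipow I u \<le> B ^ mdeg u"
  using assms
proof (induction "mdeg u" arbitrary: u)
  case 0
  then show ?case by (simp add: mdeg_eq_0 ideal_one_eq_top)
next
  case (Suc k)
  from Suc.hyps(2)[symmetric] obtain i v where v: "i \<in> keys u" "u = v + single i 1" "mdeg v = k"
    by (rule mdeg_Suc_decompose)
  have "ipow I v * I i \<le> B ^ mdeg v * B"
    using Suc.hyps(1)[of v] Suc.prems v by (intro ideal_times_mono) auto
  then show ?case by (simp add: v(2) ipow_add mult.commute)
qed

text \<open>The free factor \<open>B\<close> absorbs one factor of the sum in each step of the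
  induction, which avoids a multinomial expansion.\<close>

lemma SUP_power_times_le:
  assumes "\<And>n. n \<in> mons Y a \<Longrightarrow> ipow I n * B \<le> D"
  shows "(SUP i\<in>Y. I i) ^ a * B \<le> D"
  using assms
proof (induction a arbitrary: B)
  case 0
  have "0 \<in> mons Y 0" by (simp add: mons_def)
  from 0[OF this] show ?case by simp
next
  case (Suc a)
  have "(SUP i\<in>Y. I i) ^ a * ((SUP i\<in>Y. I i) * B) \<le> D"
  proof (rule Suc.IH)
    fix n assume n: "n \<in> mons Y a"
    have "(ipow I n * B) * (SUP i\<in>Y. I i) \<le> D"
      unfolding times_SUP
    proof (rule SUP_least)
      fix i assume "i \<in> Y"
      then have "n + single i 1 \<in> mons Y (Suc a)" using n by (simp add: mons_def)
      from Suc.prems[OF this] show "ipow I n * B * I i \<le> D" by (simp add: ipow_add mult_ac)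
    qed
    then show "ipow I n * ((SUP i\<in>Y. I i) * B) \<le> D" by (simp add: mult_ac)
  qed
  then show ?case by (simp add: mult_ac)
qed

text \<open>The dimension enters through chains of primes: none is longer than \<open>d\<close>, and
  one has length \<open>d\<close>. The exponent \<open>c\<close> expresses that the ideals are
  primary to \<open>m\<close>.\<close>

locale br_setting = noeth_local ty m for ty :: "'a::comm_ring_1 itself" and m :: "'a ideal" +
  fixes I :: "nat \<Rightarrow> 'a ideal" and c r d :: nat
  assumes r: "r \<ge> 2" and d: "d > 0"
    and I_ge': "i \<in> {1..r} \<Longrightarrow> m ^ c \<le> I i" and I_le_m: "i \<in> {1..r} \<Longrightarrow> I i \<le> m"
    and I_le: "i \<in> {1..r-1} \<Longrightarrow> I i \<le> I r"
    and dim_le: "prime_chain bot n \<Longrightarrow> n \<le> d" and dim_ge: "prime_chain bot d"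
begin

lemma chi_bot: "chi bot n = len (m ^ n) top"
  by (simp add: chi_def)

lemma len_power_le: "\<exists>C. \<forall>n. len (m ^ n) top \<le> enat (C * (n + 1) ^ d)"
  using chi_le_dim[where J = bot and k = d, OF dim_le] unfolding chi_bot .

text \<open>Finite length of R/m^n is not an assumption here but follows from the bound of
  \<open>chi_le_dim\<close>.\<close>

sublocale rees_setting ty m "{1..r}" I c
proof
  fix n
  obtain C where "\<forall>n. len (m ^ n) top \<le> enat (C * (n + 1) ^ d)" using len_power_le by blast
  then have "len (m ^ n) top \<le> enat (C * (n + 1) ^ d)" by blast
  then show "len (m ^ n) top \<noteq> \<infinity>" by (cases "len (m ^ n) top") auto
qed (use I_ge' in auto)

text \<open>Besides being the index of the multiplicity, \<open>k\<close> is the degree in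
  \<open>s\<close> of the number of monomials of degree \<open>s\<close> in the \<open>k + 1\<close>
  variables of \<open>Y\<close>.\<close>

definition k where "k = r - 2"

abbreviation Y where "Y \<equiv> {1..r - 1}"

definition JJ where "JJ = (SUP i\<in>Y. I i)"

lemma r_eq: "r = k + 2" and X_eq: "{1..r} = insert r Y" and r_notin: "r \<notin> Y" and card_Y: "card Y = Suc k"
  using r by (auto simp: k_def)

lemma JJ_le: "JJ \<le> I r"
  unfolding JJ_def by (intro SUP_least I_le)

lemma JJ_ge: "m ^ c \<le> JJ"
proof -
  have "m ^ c \<le> I 1" using r by (intro I_ge') auto
  also have "\<dots> \<le> JJ" unfolding JJ_def using r by (intro SUP_upper) auto
  finally show ?thesis .
qed

lemma colen_antimono: "m ^ n \<le> A \<Longrightarrow> A \<le> B \<Longrightarrow> colen B \<le> colen A"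
  by (rule colen_diff(2))

text \<open>The colength at the monomial t_1^a t_2^(p-a) in the ordinary Buchsbaum-Rim function of
  the pair \<open>JJ\<close>, \<open>I r\<close>. In particular \<open>B p 0\<close> is the A(p) of
  the overview.\<close>

definition B :: "nat \<Rightarrow> nat \<Rightarrow> nat" where
  "B p a = colen (JJ ^ a * I r ^ (p - a))"

lemma B_ideal_ge: "a \<le> p \<Longrightarrow> m ^ (c * p) \<le> JJ ^ a * I r ^ (p - a)"
proof -
  assume "a \<le> p"
  then have "m ^ (c * p) = (m ^ c) ^ a * (m ^ c) ^ (p - a)"
    by (simp flip: power_mult power_add add: distrib_left[symmetric])
  also have "\<dots> \<le> JJ ^ a * I r ^ (p - a)"
    using r by (intro ideal_times_mono ideal_power_mono JJ_ge I_ge') auto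
  finally show ?thesis .
qed

lemma B_le: "a \<le> p \<Longrightarrow> B p a \<le> colen (m ^ (c * p))"
  unfolding B_def by (rule colen_antimono[OF order_refl B_ideal_ge])

lemma J_le_power:
  assumes "keys u \<subseteq> {1..r}"
  shows "J I p u \<le> I r ^ p"
proof (rule J_least)
  fix n w assume n: "mdeg n = p" "n + w = u"
  have "I i \<le> I r" if "i \<in> keys n" for i
  proof -
    have "i \<in> insert r Y" using that n(2) assms X_eq by auto
    then show ?thesis using I_le by auto
  qed
  then show "ipow I n \<le> I r ^ p" using ipow_le_power[of n I "I r"] n(1) by simp
qed

text \<open>All \<open>p\<close> factors may be taken from the last variable, and no other choice
  gives more, since \<open>I r\<close> contains the other ideals.\<close>

lemma J_large_last:
  assumes "keys v \<subseteq> Y" "b \<ge> p"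
  shows "J I p (v + single r b) = I r ^ p"
proof (rule antisym)
  have "keys (v + single r b) \<subseteq> {1..r}" unfolding X_eq using assms(1) by auto
  then show "J I p (v + single r b) \<le> I r ^ p" by (rule J_le_power)
  have "single r p + (v + single r (b - p)) = v + single r b"
    using assms(2) by (simp add: add.left_commute single_add[symmetric])
  then show "I r ^ p \<le> J I p (v + single r b)"
    using J_upper[of "single r p" p "v + single r (b - p)" "v + single r b" I] by simp
qed

text \<open>At most \<open>p - a\<close> factors can come from the last variable. The others lie in
  \<open>JJ\<close>, and those in excess of \<open>a\<close> are enlarged to
  \<open>I r\<close>.\<close>

lemma J_small_last_le:
  assumes "keys v \<subseteq> Y" "a \<le> p"
  shows "J I p (v + single r (p - a)) \<le> JJ ^ a * I r ^ (p - a)"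
proof (rule J_least)
  fix n w assume n: "mdeg n = p" "n + w = v + single r (p - a)"
  define b n' where "b = lookup n r" and "n' = n - single r (lookup n r)"
  have dec: "n = n' + single r b"
    by (intro poly_mapping_eqI) (auto simp: n'_def b_def lookup_add lookup_minus lookup_single when_def)
  have "lookup v r = 0" using assms(1) r_notin by (auto simp: in_keys_iff subset_iff)
  moreover have "lookup (n + w) r = lookup (v + single r (p - a)) r" by (simp add: n(2))
  ultimately have b: "b \<le> p - a" by (simp add: lookup_add b_def)
  have "keys n \<subseteq> insert r Y"
  proof -
    have "keys n \<subseteq> keys (n + w)" by simp
    also have "\<dots> \<subseteq> insert r Y" unfolding n(2) using assms(1) by auto
    finally show ?thesis .
  qed
  then have kn': "keys n' \<subseteq> Y"
    by (auto simp: n'_def in_keys_iff lookup_minus lookup_single when_def subset_iff split: if_splits)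
  have "mdeg n = mdeg n' + b" using arg_cong[OF dec, of mdeg] by simp
  then have deg: "mdeg n' = a + (p - a - b)" using n(1) b assms(2) by simp
  have "ipow I n' \<le> JJ ^ mdeg n'"
    using kn' by (intro ipow_le_power) (auto simp: JJ_def intro: SUP_upper)
  then have "ipow I n \<le> JJ ^ mdeg n' * I r ^ b"
    unfolding dec ipow_add ipow_single by (intro ideal_times_mono) auto
  also have "\<dots> = JJ ^ a * (JJ ^ (p - a - b) * I r ^ b)" by (simp add: deg power_add mult.assoc)
  also have "\<dots> \<le> JJ ^ a * (I r ^ (p - a - b) * I r ^ b)"
    by (intro ideal_times_mono ideal_power_mono JJ_le order_refl)
  also have "\<dots> = JJ ^ a * I r ^ (p - a - b + b)" by (simp only: power_add)
  also have "p - a - b + b = p - a" using b by simp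
  finally show "ipow I n \<le> JJ ^ a * I r ^ (p - a)" .
qed

text \<open>When all exponents of \<open>v\<close> are at least \<open>a\<close>, every monomial of
  degree \<open>a\<close> in \<open>Y\<close> divides \<open>v\<close>, so all terms in the
  expansion of \<open>JJ^a\<close> occur.\<close>

lemma J_small_last:
  assumes "keys v \<subseteq> Y" "a \<le> p" "\<And>i. i \<in> Y \<Longrightarrow> a \<le> lookup v i"
  shows "J I p (v + single r (p - a)) = JJ ^ a * I r ^ (p - a)"
proof (rule antisym[OF J_small_last_le[OF assms(1,2)]])
  show "JJ ^ a * I r ^ (p - a) \<le> J I p (v + single r (p - a))"
    unfolding JJ_def
  proof (rule SUP_power_times_le)
    fix n assume n: "n \<in> mons Y a"
    have le: "lookup n i \<le> lookup v i" for i
    proof (cases "i \<in> keys n")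
      case True
      then have "lookup n i \<le> mdeg n" unfolding mdeg_def by (intro member_le_sum) auto
      with n True assms(3)[of i] show ?thesis by (auto simp: mons_def)
    qed (simp add: in_keys_iff)
    have "v = n + (v - n)" by (intro poly_mapping_eqI) (simp add: lookup_add lookup_minus le)
    then have "(n + single r (p - a)) + (v - n) = v + single r (p - a)"
      by (metis add.assoc add.commute)
    moreover have "mdeg (n + single r (p - a)) = p" using n assms(2) by (simp add: mons_def)
    ultimately have "ipow I (n + single r (p - a)) \<le> J I p (v + single r (p - a))"
      by (intro J_upper)
    then show "ipow I n * I r ^ (p - a) \<le> J I p (v + single r (p - a))" by (simp add: ipow_add)
  qed
qed

text \<open>Split by the degree \<open>t\<close> in the variables of \<open>Y\<close>: for
  \<open>t \<le> q\<close> the exponent \<open>p + q - t\<close> of the last variable is at least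
  \<open>p\<close>, where the ideal is known exactly; the degrees \<open>t = q + a\<close> are left
  for an estimate.\<close>

lemma Lam_eq: "Lam p q = B p 0 * card (mons {1..r} q)
    + (\<Sum>a\<in>{1..p}. \<Sum>v\<in>mons Y (q + a). colen (J I p (v + single r (p - a))))"
proof -
  let ?g = "\<lambda>t. \<Sum>v\<in>mons Y t. colen (J I p (v + single r (p + q - t)))"
  have "Lam p q = (\<Sum>t\<le>p + q. ?g t)"
    unfolding Lam_def using sum_mons_insert[OF finite_atLeastAtMost r_notin] by (simp only: X_eq)
  also have "{..p + q} = {..q} \<union> {q + 1..q + p}" by auto
  also have "(\<Sum>t\<in>{..q} \<union> {q + 1..q + p}. ?g t) = (\<Sum>t\<le>q. ?g t) + (\<Sum>t\<in>{q + 1..q + p}. ?g t)"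
    by (intro sum.union_disjoint) auto
  also have "(\<Sum>t\<in>{q + 1..q + p}. ?g t) = (\<Sum>a\<in>{1..p}. ?g (q + a))"
    by (rule sum.reindex_bij_witness[of _ "\<lambda>a. q + a" "\<lambda>t. t - q"]) auto
  also have "\<dots> = (\<Sum>a\<in>{1..p}. \<Sum>v\<in>mons Y (q + a). colen (J I p (v + single r (p - a))))"
    by (intro sum.cong refl) simp
  also have "(\<Sum>t\<le>q. ?g t) = (\<Sum>t\<le>q. card (mons Y t) * B p 0)"
  proof (rule sum.cong[OF refl])
    fix t assume t: "t \<in> {..q}"
    have "?g t = (\<Sum>v\<in>mons Y t. B p 0)"
      using t by (intro sum.cong refl) (simp add: J_large_last mons_def B_def)
    then show "?g t = card (mons Y t) * B p 0" by simp
  qed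
  also have "\<dots> = B p 0 * card (mons {1..r} q)"
    unfolding X_eq card_mons_insert[OF finite_atLeastAtMost r_notin]
    by (simp add: sum_distrib_left mult.commute)
  finally show ?thesis .
qed

text \<open>The deviation of \<open>Lam\<close> from the value it would have if every monomial of
  degree \<open>q + a\<close> in \<open>Y\<close> were covered by
  \<open>J_small_last\<close>.\<close>

definition err :: "nat \<Rightarrow> nat \<Rightarrow> rat" where
  "err p q = of_nat (Lam p q) - of_nat (B p 0 * card (mons {1..r} q))
      - (\<Sum>a\<in>{1..p}. of_nat (B p a * card (mons Y (q + a))))"

text \<open>Only monomials with an exponent below \<open>a\<close> contribute, each at most the
  colength of \<open>m^(c p)\<close>, and \<open>card_bad_monomials\<close> counts them. The bound
  \<open>K\<close> may depend on \<open>p\<close>, since \<open>p\<close> is fixed when coefficients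
  in \<open>q\<close> are compared.\<close>

lemma Lam_asymptotics:
  "\<exists>K. \<forall>q\<ge>1. of_nat q * \<bar>err p q\<bar> \<le> (K :: rat) * of_nat q ^ k"
proof -
  let ?bad = "\<lambda>q a. {v \<in> mons Y (q + a). \<exists>i\<in>Y. lookup v i < a}" and ?M = "colen (m ^ (c * p))"
    and ?S = "\<lambda>q a. \<Sum>v\<in>mons Y (q + a). colen (J I p (v + single r (p - a)))"
  have "\<forall>a. \<exists>K. \<forall>q\<ge>1. q * card (?bad q a) \<le> K * q ^ k"
    using card_bad_monomials[OF _ card_Y] by simp
  from choice[OF this] obtain K where K: "\<forall>a. \<forall>q\<ge>1. q * card (?bad q a) \<le> K a * q ^ k" by (rule exE)
  have diff: "\<bar>of_nat (?S q a) - of_nat (B p a * card (mons Y (q + a)))\<bar>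
      \<le> (of_nat (?M * card (?bad q a)) :: rat)" if a: "a \<in> {1..p}" for a q
  proof -
    let ?f = "\<lambda>v. colen (J I p (v + single r (p - a)))"
    have le: "?f v \<le> ?M" if "v \<in> mons Y (q + a)" for v
    proof (rule colen_antimono[OF order_refl J_ge])
      show "keys (v + single r (p - a)) \<subseteq> {1..r}" unfolding X_eq using that by (auto simp: mons_def)
      show "p \<le> mdeg (v + single r (p - a))" using that a by (simp add: mons_def)
    qed
    have eq: "?f v = B p a" if "v \<in> mons Y (q + a)" "v \<notin> ?bad q a" for v
    proof -
      have "a \<le> lookup v i" if "i \<in> Y" for i using that \<open>v \<in> _\<close> \<open>v \<notin> _\<close> not_less by blast
      moreover have "keys v \<subseteq> Y" using \<open>v \<in> _\<close> by (simp add: mons_def)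
      ultimately show ?thesis unfolding B_def using a by (subst J_small_last) simp_all
    qed
    have BM: "B p a \<le> ?M" using a by (intro B_le) simp
    have "\<bar>of_nat (\<Sum>v\<in>mons Y (q + a). ?f v) - of_nat (B p a * card (mons Y (q + a)))\<bar>
        = \<bar>\<Sum>v\<in>mons Y (q + a). (of_nat (?f v) - of_nat (B p a) :: rat)\<bar>"
      by (simp add: sum_subtractf mult.commute)
    also have "\<dots> \<le> (\<Sum>v\<in>mons Y (q + a). \<bar>of_nat (?f v) - of_nat (B p a) :: rat\<bar>)" by (rule sum_abs)
    also have "\<dots> \<le> (\<Sum>v\<in>mons Y (q + a). if v \<in> ?bad q a then of_nat ?M else 0)"
    proof (rule sum_mono)
      fix v assume v: "v \<in> mons Y (q + a)"
      have "(of_nat (?f v) :: rat) \<le> of_nat ?M" "(of_nat (B p a) :: rat) \<le> of_nat ?M"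
        using le[OF v] BM by simp_all
      then have "\<bar>of_nat (?f v) - of_nat (B p a) :: rat\<bar> \<le> of_nat ?M"
        by (auto simp: abs_le_iff intro: order.trans)
      then show "\<bar>of_nat (?f v) - of_nat (B p a) :: rat\<bar> \<le> (if v \<in> ?bad q a then of_nat ?M else 0)"
        using eq[OF v] by auto
    qed
    also have "\<dots> = (\<Sum>v\<in>mons Y (q + a) \<inter> ?bad q a. of_nat ?M)"
      by (rule sum.inter_restrict[symmetric]) (simp add: finite_mons)
    also have "mons Y (q + a) \<inter> ?bad q a = ?bad q a" by blast
    finally show ?thesis by (simp add: mult.commute)
  qed
  have "of_nat q * \<bar>err p q\<bar> \<le> (of_nat (\<Sum>a\<in>{1..p}. ?M * K a) :: rat) * of_nat q ^ k"
    if q: "q \<ge> 1" for q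
  proof -
    have "\<bar>err p q\<bar>
      = \<bar>\<Sum>a\<in>{1..p}. of_nat (?S q a) - (of_nat (B p a * card (mons Y (q + a))) :: rat)\<bar>"
      unfolding err_def Lam_eq by (simp add: sum_subtractf)
    also have "\<dots> \<le> (\<Sum>a\<in>{1..p}. \<bar>of_nat (?S q a) - (of_nat (B p a * card (mons Y (q + a))) :: rat)\<bar>)"
      by (rule sum_abs)
    also have "\<dots> \<le> (\<Sum>a\<in>{1..p}. of_nat (?M * card (?bad q a)))" by (intro sum_mono diff)
    also have "\<dots> = of_nat (\<Sum>a\<in>{1..p}. ?M * card (?bad q a))" by (rule of_nat_sum[symmetric])
    finally have "of_nat q * \<bar>err p q\<bar> \<le> (of_nat q * of_nat (\<Sum>a\<in>{1..p}. ?M * card (?bad q a)) :: rat)"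
      by (intro mult_left_mono) simp_all
    also have "\<dots> = of_nat (\<Sum>a\<in>{1..p}. ?M * (q * card (?bad q a)))"
      by (simp only: of_nat_mult[symmetric] sum_distrib_left mult.left_commute)
    also have "\<dots> \<le> of_nat (\<Sum>a\<in>{1..p}. ?M * (K a * q ^ k))"
      using K q by (intro of_nat_mono sum_mono mult_left_mono) auto
    also have "\<dots> = of_nat (\<Sum>a\<in>{1..p}. ?M * K a) * of_nat q ^ k"
      by (simp only: of_nat_mult[symmetric] of_nat_power[symmetric] sum_distrib_right mult.assoc)
    finally show ?thesis .
  qed
  then show ?thesis by blast
qed

definition lam :: "nat \<Rightarrow> nat" where
  "lam p = (\<Sum>a\<le>p. B p a)"

lemma lam_split: "lam p = B p 0 + (\<Sum>a\<in>{1..p}. B p a)"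
proof -
  have "{..p} = insert 0 {1..p}" by auto
  then show ?thesis by (simp add: lam_def)
qed

definition LamPoly :: "rat poly poly" where
  "LamPoly = (SOME H. \<exists>N. \<forall>p\<ge>N. \<forall>q\<ge>N. poly (poly H [:of_nat q:]) (of_nat p) = of_nat (Lam p q))"

lemma LamPoly:
  "\<exists>N. \<forall>p\<ge>N. \<forall>q\<ge>N. poly (poly LamPoly [:of_nat q:]) (of_nat p) = of_nat (Lam p q)"
  unfolding LamPoly_def
proof (rule someI_ex)
  from Lam_polynomial obtain H N where H: "pf2 H" "\<forall>p\<ge>N. \<forall>q\<ge>N. of_nat (Lam p q) = H (of_nat p) (of_nat q)"
    by (rule epoly2E)
  from H(1) obtain P where P: "H = (\<lambda>x y. poly (poly P [:y:]) x)" by (rule pf2E)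
  show "\<exists>P N. \<forall>p\<ge>N. \<forall>q\<ge>N. poly (poly P [:of_nat q:]) (of_nat p) = (of_nat (Lam p q) :: rat)"
    by (rule exI[of _ P], rule exI[of _ N]) (use H(2) in \<open>simp add: P\<close>)
qed

text \<open>For fixed \<open>p\<close> the error is of order \<open>q^(k-1)\<close>, so the
  coefficients of \<open>q^(k+1)\<close> and \<open>q^k\<close> are those of the explicit main
  terms.\<close>

lemma LamPoly_coeffs:
  obtains N where
    "\<forall>p\<ge>N. poly (coeff LamPoly (k + 1)) (of_nat p) = of_nat (B p 0) / fact (k + 1)"
    "\<forall>p\<ge>N. poly (coeff LamPoly k) (of_nat p) =
      of_nat (B p 0) * coeff (multichoose_poly (k + 1)) k + (of_nat (lam p) - of_nat (B p 0)) / fact k"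
proof -
  obtain N where N: "\<forall>p\<ge>N. \<forall>q\<ge>N. poly (poly LamPoly [:of_nat q:]) (of_nat p) = of_nat (Lam p q)"
    using LamPoly by blast
  let ?C = multichoose_poly
  have card_X: "of_nat (card (mons {1..r} q)) = poly (?C (k + 1)) (of_nat q)" for q
  proof -
    have "card {1..r} = Suc (k + 1)" using r by (simp add: k_def)
    then show ?thesis using card_mons[of "{1..r}" "k + 1" q] poly_multichoose_poly[of "k + 1" q] by (simp only: finite_atLeastAtMost)
  qed
  have card_Y': "of_nat (card (mons Y (q + a))) = poly (pcompose (?C k) [:of_nat a, 1:]) (of_nat q)" for q a
    using card_mons[OF _ card_Y, of "q + a"] poly_multichoose_poly[of k "q + a"]
    by (simp add: poly_pcompose add.commute)
  \<comment> \<open>The shift by \<open>a\<close> changes neither degree nor leading coefficient, so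
    all \<open>B p a\<close> with \<open>a \<ge> 1\<close> enter the coefficient of
    \<open>q^k\<close> with the same weight \<open>1/k!\<close>.\<close>
  have Ck: "coeff (pcompose (?C k) [:of_nat a, 1:]) k = 1 / fact k"
    "coeff (pcompose (?C k) [:of_nat a, 1:]) (k + 1) = 0" for a
  proof -
    have deg: "degree (pcompose (?C k) [:of_nat a, 1:]) = k" using multichoose_poly_degree[of k] by (simp add: degree_pcompose)
    then show "coeff (pcompose (?C k) [:of_nat a, 1:]) (k + 1) = 0" by (intro coeff_eq_0) simp
    have "lead_coeff (pcompose (?C k) [:of_nat a, 1:]) = lead_coeff (?C k)" by (simp add: lead_coeff_comp)
    then show "coeff (pcompose (?C k) [:of_nat a, 1:]) k = 1 / fact k"
      using deg multichoose_poly_degree[of k] by simp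
  qed
  have both: "poly (coeff LamPoly j) (of_nat p) = of_nat (B p 0) * coeff (?C (k + 1)) j
      + (\<Sum>a\<in>{1..p}. of_nat (B p a) * coeff (pcompose (?C k) [:of_nat a, 1:]) j)" if p: "p \<ge> N" and j: "j \<ge> k" for p j
  proof -
    \<comment> \<open>Evaluating the inner variable at \<open>p\<close> leaves a polynomial in
      \<open>q\<close>; for large \<open>q\<close> the values of \<open>E\<close> are
      \<open>err p q\<close>.\<close>
    define E where "E = map_poly (\<lambda>c. poly c (of_nat p)) LamPoly - smult (of_nat (B p 0)) (?C (k + 1))
      - (\<Sum>a\<in>{1..p}. smult (of_nat (B p a)) (pcompose (?C k) [:of_nat a, 1:]))"
    obtain K :: rat where K: "\<forall>q\<ge>1. of_nat q * \<bar>err p q\<bar> \<le> K * of_nat q ^ k"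
      using Lam_asymptotics[of p] by blast
    have "coeff E j = 0"
    proof (rule coeff_eq_0_growth[OF _ j])
      fix q assume q: "q \<ge> max N 1"
      have "poly E (of_nat q) = err p q"
        using N p q unfolding E_def err_def of_nat_mult card_X card_Y'
        by (simp add: poly_map_poly_eval poly_sum del: multichoose_poly.simps)
      then show "of_nat q * \<bar>poly E (of_nat q)\<bar> \<le> K * of_nat q ^ k" using K q by simp
    qed
    then show ?thesis by (simp add: E_def coeff_map_poly coeff_sum)
  qed
  show ?thesis
  proof (rule that[of N]; intro allI impI)
    fix p assume p: "p \<ge> N"
    have "coeff (?C (k + 1)) (k + 1) = 1 / fact (k + 1)" using multichoose_poly_degree by blast
    then show "poly (coeff LamPoly (k + 1)) (of_nat p) = of_nat (B p 0) / fact (k + 1)"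
      using both[OF p, of "k + 1"] by (simp only: Ck) simp
    show "poly (coeff LamPoly k) (of_nat p) =
      of_nat (B p 0) * coeff (?C (k + 1)) k + (of_nat (lam p) - of_nat (B p 0)) / fact k"
      using both[OF p, of k] by (simp only: Ck lam_split) (simp add: sum_divide_distrib)
  qed
qed

text \<open>The two formulas of \<open>LamPoly_coeffs\<close>, solved for
  \<open>lam p\<close>.\<close>

definition lamPoly :: "rat poly" where
  "lamPoly = smult (fact k) (coeff LamPoly k
    - smult ((coeff (multichoose_poly (k + 1)) k - 1 / fact k) * fact (k + 1)) (coeff LamPoly (k + 1)))"

lemma lamPoly: "\<exists>N. \<forall>p\<ge>N. poly lamPoly (of_nat p) = of_nat (lam p)"
proof -
  obtain N where N: "\<forall>p\<ge>N. poly (coeff LamPoly (k + 1)) (of_nat p) = of_nat (B p 0) / fact (k + 1)"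
    "\<forall>p\<ge>N. poly (coeff LamPoly k) (of_nat p) =
      of_nat (B p 0) * coeff (multichoose_poly (k + 1)) k + (of_nat (lam p) - of_nat (B p 0)) / fact k"
    by (rule LamPoly_coeffs)
  have "poly lamPoly (of_nat p) = of_nat (lam p)" if "p \<ge> N" for p
    unfolding lamPoly_def using N(1)[rule_format, OF that] N(2)[rule_format, OF that]
    by (simp add: field_simps del: multichoose_poly.simps fact_Suc)
  then show ?thesis by blast
qed

lemma colen_power_le: "\<exists>C :: rat. \<forall>p\<ge>1. of_nat (colen (m ^ (c * p))) \<le> C * of_nat p ^ d"
proof -
  obtain C where C: "\<forall>n. len (m ^ n) top \<le> enat (C * (n + 1) ^ d)" using len_power_le by blast
  have "of_nat (colen (m ^ (c * p))) \<le> (of_nat (C * (c + 1) ^ d) :: rat) * of_nat p ^ d" if "p \<ge> 1" for p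
  proof -
    have "enat (colen (m ^ (c * p))) = len (m ^ (c * p)) top" using len_top_eq[OF order_refl] by simp
    also have "\<dots> \<le> enat (C * (c * p + 1) ^ d)" using C by blast
    finally have "colen (m ^ (c * p)) \<le> C * (c * p + 1) ^ d" by simp
    also have "\<dots> \<le> C * ((c + 1) * p) ^ d" using that by (intro mult_left_mono power_mono) auto
    also have "\<dots> = C * (c + 1) ^ d * p ^ d" by (simp only: power_mult_distrib mult.assoc)
    finally show ?thesis by (simp only: of_nat_mult[symmetric] of_nat_power[symmetric] of_nat_le_iff)
  qed
  then show ?thesis by blast
qed

lemma degree_first: "degree (coeff LamPoly (k + 1)) \<le> d"
proof -
  obtain N where N: "\<forall>p\<ge>N. poly (coeff LamPoly (k + 1)) (of_nat p) = of_nat (B p 0) / fact (k + 1)"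
    by (rule LamPoly_coeffs)
  obtain C :: rat where C: "\<forall>p\<ge>1. of_nat (colen (m ^ (c * p))) \<le> C * of_nat p ^ d"
    using colen_power_le by blast
  show ?thesis
  proof (rule degree_le_growth)
    fix p assume p: "p \<ge> max N 1"
    have "\<bar>poly (coeff LamPoly (k + 1)) (of_nat p)\<bar> = of_nat (B p 0) / fact (k + 1)"
      using N p by (simp del: fact_Suc)
    also have "\<dots> \<le> of_nat (B p 0)" by (simp add: divide_le_eq mult_le_cancel_left1 fact_ge_1 del: fact_Suc)
    also have "\<dots> \<le> of_nat (colen (m ^ (c * p)))" using B_le[of 0 p] by simp
    also have "\<dots> \<le> C * of_nat p ^ d" using C p by simp
    finally show "\<bar>poly (coeff LamPoly (k + 1)) (of_nat p)\<bar> \<le> C * of_nat p ^ d" .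
  qed
qed

lemma coeff_lamPoly: "coeff lamPoly (d + 1) = fact k * coeff (coeff LamPoly k) (d + 1)"
proof -
  have "coeff (coeff LamPoly (k + 1)) (d + 1) = 0" using degree_first by (intro coeff_eq_0) simp
  then show ?thesis by (simp add: lamPoly_def)
qed

lemma lam_le: "\<exists>C :: rat. \<forall>p\<ge>1. of_nat (lam p) \<le> C * of_nat p ^ (d + 1)"
proof -
  obtain C :: rat where C: "\<forall>p\<ge>1. of_nat (colen (m ^ (c * p))) \<le> C * of_nat p ^ d"
    using colen_power_le by blast
  have "of_nat (lam p) \<le> (2 * C) * of_nat p ^ (d + 1)" if p: "p \<ge> 1" for p
  proof -
    have "lam p \<le> (\<Sum>a\<le>p. colen (m ^ (c * p)))" unfolding lam_def using B_le by (intro sum_mono) simp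
    also have "\<dots> \<le> (2 * p) * colen (m ^ (c * p))" using p by simp
    finally have "of_nat (lam p) \<le> (of_nat ((2 * p) * colen (m ^ (c * p))) :: rat)" by (simp only: of_nat_le_iff)
    also have "\<dots> = of_nat (2 * p) * of_nat (colen (m ^ (c * p)))" by (rule of_nat_mult)
    also have "\<dots> \<le> of_nat (2 * p) * (C * of_nat p ^ d)" using C p by (intro mult_left_mono) auto
    finally show ?thesis by (simp add: mult_ac)
  qed
  then show ?thesis by blast
qed

text \<open>All \<open>p + 1\<close> ideals in the sum are contained in \<open>m^p\<close>.\<close>

lemma lam_ge: "(p + 1) * colen (m ^ p) \<le> lam p"
proof -
  have "(p + 1) * colen (m ^ p) = (\<Sum>a\<le>p. colen (m ^ p))" by simp
  also have "\<dots> \<le> (\<Sum>a\<le>p. B p a)"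
  proof (rule sum_mono)
    fix a assume a: "a \<in> {..p}"
    have Im: "I r \<le> m" using r by (intro I_le_m) auto
    then have "JJ \<le> m" using JJ_le by (rule order.trans[rotated])
    then have "JJ ^ a * I r ^ (p - a) \<le> m ^ a * m ^ (p - a)"
      using Im by (intro ideal_times_mono ideal_power_mono)
    also have "\<dots> = m ^ p" using a by (simp flip: power_add)
    finally show "colen (m ^ p) \<le> B p a"
      unfolding B_def using a by (intro colen_antimono[OF B_ideal_ge]) auto
  qed
  finally show ?thesis by (simp add: lam_def)
qed

text \<open>Up to the factor \<open>p + 1\<close>, \<open>lam p\<close> lies between the colengths
  of \<open>m^p\<close> and of \<open>m^(c p)\<close>. The lower bound for colengths is available
  only at multiples of \<open>D\<close>, which is enough to exclude degree \<open>d\<close>.\<close>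

lemma degree_lamPoly: "degree lamPoly = d + 1"
proof (rule antisym)
  obtain N where N: "\<forall>p\<ge>N. poly lamPoly (of_nat p) = of_nat (lam p)" using lamPoly by blast
  obtain C :: rat where C: "\<forall>p\<ge>1. of_nat (lam p) \<le> C * of_nat p ^ (d + 1)" using lam_le by blast
  show "degree lamPoly \<le> d + 1"
  proof (rule degree_le_growth)
    fix p assume "p \<ge> max N 1"
    then show "\<bar>poly lamPoly (of_nat p)\<bar> \<le> C * of_nat p ^ (d + 1)" using N C by simp
  qed
  show "d + 1 \<le> degree lamPoly"
  proof (rule ccontr)
    assume "\<not> d + 1 \<le> degree lamPoly"
    then have "degree lamPoly \<le> d" by simp
    from poly_le_power[OF this] obtain S where S: "S \<ge> 0" "\<forall>n\<ge>1. \<bar>poly lamPoly (of_nat n)\<bar> \<le> S * of_nat n ^ d" by blast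
    obtain D where D: "D \<ge> 1" "\<forall>s\<ge>1. enat (s choose d) \<le> chi bot (D * s)"
      using chi_ge_dim[OF dim_ge] by blast
    \<comment> \<open>Chosen for the final comparison: at \<open>p = D s\<close>, \<open>lam\<close>
      is at least \<open>s (s/d)^d\<close>, while degree at most \<open>d\<close> would allow only
      \<open>S (D s)^d\<close>.\<close>
    obtain n0 :: nat where n0: "S * of_nat D ^ d * of_nat d ^ d < of_nat n0" using reals_Archimedean2 by blast
    define s where "s = max (max n0 N) (max d 1)"
    have s: "s \<ge> n0" "s \<ge> N" "s \<ge> d" "s \<ge> 1" by (auto simp: s_def)
    have Ds: "s \<le> D * s" using D(1) by simp
    have "enat (s choose d) \<le> enat (colen (m ^ (D * s)))"
      using D(2)[rule_format, OF s(4)] len_top_eq[OF order_refl, of "D * s"] by (simp add: chi_bot)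
    then have "s choose d \<le> colen (m ^ (D * s))" by simp
    then have "(D * s + 1) * (s choose d) \<le> (D * s + 1) * colen (m ^ (D * s))" by (rule mult_left_mono) simp
    also have "\<dots> \<le> lam (D * s)" by (rule lam_ge)
    finally have 1: "(of_nat ((D * s + 1) * (s choose d)) :: rat) \<le> of_nat (lam (D * s))" by (simp only: of_nat_le_iff)
    also have "\<dots> = \<bar>poly lamPoly (of_nat (D * s))\<bar>"
    proof -
      have "D * s \<ge> N" using Ds s(2) by (rule order.trans[rotated])
      then show ?thesis using N by (simp del: of_nat_mult)
    qed
    also have "\<dots> \<le> S * of_nat (D * s) ^ d"
    proof -
      have "D * s \<ge> 1" using Ds s(4) by (rule order.trans[rotated])
      then show ?thesis using S(2) by blast
    qed
    finally have 2: "of_nat (D * s + 1) * of_nat (s choose d) \<le> S * (of_nat D ^ d * of_nat s ^ d)"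
      by (simp only: of_nat_mult power_mult_distrib)
    have "(of_nat s :: rat) * (of_nat s ^ d / of_nat d ^ d) \<le> of_nat (D * s + 1) * of_nat (s choose d)"
    proof (rule mult_mono)
      show "(of_nat s :: rat) \<le> of_nat (D * s + 1)" using Ds by (simp only: of_nat_le_iff)
      show "(of_nat s :: rat) ^ d / of_nat d ^ d \<le> of_nat (s choose d)"
        using binomial_ge_n_over_k_pow_k[OF s(3), where ?'a = rat] by (simp add: power_divide)
    qed simp_all
    with 2 have "(of_nat s :: rat) * (of_nat s ^ d / of_nat d ^ d) \<le> S * (of_nat D ^ d * of_nat s ^ d)"
      by (rule order.trans[rotated])
    then have "(of_nat s :: rat) * of_nat s ^ d \<le> (S * of_nat D ^ d * of_nat d ^ d) * of_nat s ^ d"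
      using d by (simp add: divide_le_eq mult_ac)
    moreover have "(0 :: rat) < of_nat s ^ d" using s(4) by simp
    ultimately have "(of_nat s :: rat) \<le> S * of_nat D ^ d * of_nat d ^ d" by (simp only: mult_le_cancel_right_pos)
    then have "(of_nat s :: rat) < of_nat n0" using n0 by (rule le_less_trans)
    with s(1) show False by simp
  qed
qed

section \<open>Identification with the Buchsbaum-Rim multiplicities\<close>

abbreviation "M \<equiv> cyclic_sum r (\<lambda>i. set_of (I i))"
abbreviation "M' \<equiv> cyclic_sum 2 (\<lambda>i. set_of (if i = 1 then JJ else I r))"

lemma br_poly2_eq: "br_poly2 r M = LamPoly"
  unfolding br_poly2_def
proof (rule the_equality)
  have fun2: "br_fun2 r M p q = enat (Lam p q)" for p q
  proof -
    have "(\<Sum>u\<in>mons {1..r} (p + q). len (J I p u) top) = (\<Sum>u\<in>mons {1..r} (p + q). enat (colen (J I p u)))"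
    proof (rule sum.cong[OF refl])
      fix u assume "u \<in> mons {1..r} (p + q)"
      then have "m ^ (c * p) \<le> J I p u" by (intro J_ge) (simp_all add: mons_def)
      then show "len (J I p u) top = enat (colen (J I p u))" by (rule len_top_eq)
    qed
    then show ?thesis by (simp only: br_fun2_cyclic_sum sum_enat Lam_def)
  qed
  obtain N where N: "\<forall>p\<ge>N. \<forall>q\<ge>N. poly (poly LamPoly [:of_nat q:]) (of_nat p) = of_nat (Lam p q)"
    using LamPoly by blast
  show "\<exists>N. \<forall>p\<ge>N. \<forall>q\<ge>N. \<exists>k. br_fun2 r M p q = enat k \<and>
     poly (poly LamPoly [:of_nat q:]) (of_nat p) = of_nat k"
    using N by (intro exI[of _ N]) (simp add: fun2)
  fix H :: "rat poly poly"
  assume "\<exists>N. \<forall>p\<ge>N. \<forall>q\<ge>N. \<exists>k. br_fun2 r M p q = enat k \<and>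
     poly (poly H [:of_nat q:]) (of_nat p) = of_nat k"
  then obtain M where M: "\<forall>p\<ge>M. \<forall>q\<ge>M. poly (poly H [:of_nat q:]) (of_nat p) = of_nat (Lam p q)"
    by (auto simp: fun2)
  show "H = LamPoly"
    by (rule poly2_eq_eventually[of "max M N"]) (use M N in simp)
qed

lemma br_fun_pair:
  "br_fun 2 M' p = enat (lam p)"
proof -
  let ?K = "\<lambda>i :: nat. if i = 1 then JJ else I r"
  have single1: "mons {1} t = {single 1 t}" for t
  proof -
    have "mons (insert 1 {}) t = (\<lambda>(t', v). v + single 1 (t - t')) ` Sigma {..t} (mons {})"
      using mons_insert_bij[of 1 "{}" t] by (simp add: bij_betw_def)
    also have "Sigma {..t} (mons {}) = {(0, 0)}" by (auto simp: mons_empty split: if_splits)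
    finally show ?thesis by simp
  qed
  have set2: "{1..2} = insert 2 {1 :: nat}" by auto
  have "br_fun 2 (cyclic_sum 2 (\<lambda>i. set_of (?K i))) p = (\<Sum>u\<in>mons {1..2} p. len (ipow ?K u) top)"
    by (rule br_fun_cyclic_sum)
  also have "\<dots> = (\<Sum>t\<le>p. \<Sum>v\<in>mons {1} t. len (ipow ?K (v + single 2 (p - t))) top)"
    unfolding set2 by (rule sum_mons_insert) auto
  also have "\<dots> = (\<Sum>t\<le>p. len (JJ ^ t * I r ^ (p - t)) top)"
    by (simp add: single1 ipow_add del: One_nat_def)
  also have "\<dots> = (\<Sum>t\<le>p. enat (B p t))"
    unfolding B_def by (intro sum.cong refl len_top_eq[OF B_ideal_ge]) simp
  finally show ?thesis by (simp add: sum_enat lam_def)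
qed

lemma br_poly_eq: "br_poly 2 M' = lamPoly"
  unfolding br_poly_def
proof (rule the_equality)
  obtain N where N: "\<forall>p\<ge>N. poly lamPoly (of_nat p) = of_nat (lam p)" using lamPoly by blast
  then show "\<exists>N. \<forall>p\<ge>N. \<exists>k. br_fun 2 M' p = enat k \<and>
     poly lamPoly (of_nat p) = of_nat k"
    by (intro exI[of _ N]) (simp add: br_fun_pair del: One_nat_def)
  fix H :: "rat poly"
  assume "\<exists>N. \<forall>p\<ge>N. \<exists>k. br_fun 2 M' p = enat k \<and>
     poly H (of_nat p) = of_nat k"
  then obtain M where M: "\<forall>p\<ge>M. poly H (of_nat p) = of_nat (lam p)" by (auto simp: br_fun_pair simp del: One_nat_def)
  show "H = lamPoly"
    by (rule poly_eq_eventually[of "max M N"]) (use M N in simp)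
qed

text \<open>For \<open>j = r - 2 = k\<close> the exponent of \<open>p\<close> is
  \<open>d + r - 1 - k = d + 1\<close>, the factor \<open>k!\<close> is the one in
  \<open>coeff_lamPoly\<close>, and by \<open>degree_lamPoly\<close> the leading coefficient on the
  right stands at \<open>p^(d+1)\<close>.\<close>

theorem br_mult_eq:
  assumes "krull_dim TYPE('a) = enat d"
  shows "br_mult_assoc (r - 2) r M =
    br_mult 2 M'"
proof -
  have "br_mult_assoc (r - 2) r M = coeff (coeff LamPoly k) (d + 1) * fact (d + 1) * fact k"
  proof -
    have "r - 2 = k" "d + r - 1 - k = d + 1" using r_eq by simp_all
    then show ?thesis unfolding br_mult_assoc_def br_poly2_eq Let_def assms the_enat.simps by (simp only:)
  qed
  moreover have "br_mult 2 M' = fact (d + 1) * coeff lamPoly (d + 1)"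
    unfolding br_mult_def br_poly_eq Let_def assms the_enat.simps degree_lamPoly by (simp del: fact_Suc)
  ultimately show ?thesis using coeff_lamPoly by (simp del: fact_Suc)
qed

end

section \<open>From the hypotheses of the theorem to the local setting\<close>

lemma cyclic_sum_cong: "(\<And>i. i \<in> {1..r} \<Longrightarrow> I i = I' i) \<Longrightarrow> cyclic_sum r I = cyclic_sum r I'"
  unfolding cyclic_sum_def by auto

context noetherian begin

text \<open>Noetherian induction takes the place of Zorn's lemma. With uniqueness of the maximal
  ideal this puts every proper ideal below it.\<close>

lemma exists_maximal:
  fixes J :: "'a ideal"
  shows "J \<noteq> top \<Longrightarrow> \<exists>K. J \<le> K \<and> maximal_ideal (set_of K)"
proof (induction J rule: noetherian_induct)
  case (less J)
  show ?case
  proof (cases "\<exists>K. J < K \<and> K \<noteq> top")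
    case True
    then obtain K where K: "J < K" "K \<noteq> top" by blast
    from less.IH[OF K] obtain L where L: "K \<le> L" "maximal_ideal (set_of L)" by blast
    have "J \<le> L" using order.trans[OF less_imp_le[OF K(1)] L(1)] .
    with L(2) show ?thesis by blast
  next
    case False
    have "maximal_ideal (set_of J)"
      unfolding maximal_ideal_def
    proof (intro conjI allI impI)
      show "set_of J \<noteq> UNIV" using less.prems by (simp add: set_of_inject[symmetric])
      fix L :: "'a set" assume L: "is_ideal L \<and> set_of J \<subseteq> L"
      then have "J \<le> Ideal L" by (simp add: less_eq_ideal_def)
      then have "Ideal L = J \<or> Ideal L = top" using False le_less by blast
      then have "set_of (Ideal L) = set_of J \<or> set_of (Ideal L) = UNIV" by auto
      then show "L = set_of J \<or> L = UNIV" using L by simp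
    qed simp
    then show ?thesis by blast
  qed
qed

text \<open>Take \<open>a\<close> in \<open>m\<close> outside \<open>J\<close>, and let
  \<open>b\<close> be its last power outside \<open>J\<close>. Then \<open>J + (b)\<close> and
  \<open>J : b\<close> are both larger than \<open>J\<close>, and their product lies in
  \<open>J\<close>, so that the exponents add.\<close>

lemma power_le_of_radical:
  fixes m J :: "'a ideal"
  assumes "\<And>x. x \<in> set_of m \<Longrightarrow> \<exists>n. x ^ n \<in> set_of J"
  shows "\<exists>c. m ^ c \<le> J"
  using assms
proof (induction J rule: noetherian_induct)
  case (less J)
  show ?case
  proof (cases "m \<le> J")
    case True
    then show ?thesis by (intro exI[of _ 1]) simp
  next
    case False
    then obtain a where a: "a \<in> set_of m" "a \<notin> set_of J" by (auto simp: less_eq_ideal_def)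
    define n where "n = (LEAST n. a ^ n \<in> set_of J)"
    have n: "a ^ n \<in> set_of J" unfolding n_def using less.prems[OF a(1)] by (rule LeastI_ex)
    have "n \<noteq> 0"
    proof
      assume "n = 0"
      with n have "J = top" by (simp add: top_iff_one)
      with a(2) show False by simp
    qed
    then obtain k where k: "n = Suc k" by (cases n) auto
    define b where "b = a ^ k"
    have "k < n" by (simp add: k)
    then have b: "b \<notin> set_of J" unfolding b_def n_def by (rule not_less_Least)
    have ab: "b * a \<in> set_of J" using n by (simp add: k b_def mult.commute)
    have lt1: "J < sup J (gen b)" using b by (simp add: less_le_not_le)
    have "J \<le> colon J b" by (rule ideal_leI) (simp add: ideal_mult)
    moreover have "\<not> colon J b \<le> J" using ab a(2) by (auto simp: less_eq_ideal_def)
    ultimately have lt2: "J < colon J b" by (simp add: less_le_not_le)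
    have rad: "\<exists>n. x ^ n \<in> set_of K" if "J < K" "x \<in> set_of m" for K x
    proof -
      from less.prems[OF that(2)] obtain n where "x ^ n \<in> set_of J" by (rule exE)
      then have "x ^ n \<in> set_of K" by (rule ideal_leD[OF less_imp_le[OF that(1)]])
      then show ?thesis by (rule exI)
    qed
    obtain c1 where c1: "m ^ c1 \<le> sup J (gen b)" using less.IH[OF lt1 rad[OF lt1]] by (rule exE)
    obtain c2 where c2: "m ^ c2 \<le> colon J b" using less.IH[OF lt2 rad[OF lt2]] by (rule exE)
    have "m ^ (c1 + c2) \<le> sup J (gen b) * colon J b"
      unfolding power_add using c1 c2 by (rule ideal_times_mono)
    also have "\<dots> \<le> J" unfolding sup_times by (simp add: ideal_times_le1 gen_times_le_iff)
    finally show ?thesis by blast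
  qed
qed

end

text \<open>The empty set has supremum 0, so \<open>d > 0\<close> guarantees a member; the set is
  bounded by \<open>d\<close>, and the supremum is a maximum.\<close>

lemma SUP_enat_attained:
  assumes "(SUP n\<in>S. enat n) = enat d" "d > 0"
  shows "n \<in> S \<Longrightarrow> n \<le> d" and "d \<in> S"
proof -
  have le: "n \<le> d" if "n \<in> S" for n
    using SUP_upper[OF that, of enat] by (simp add: assms(1))
  then show "n \<in> S \<Longrightarrow> n \<le> d" .
  have fin: "finite S" unfolding finite_nat_set_iff_bounded_le by (rule exI[of _ d]) (simp add: le)
  have ne: "S \<noteq> {}" using assms by (auto simp: bot_enat_def zero_enat_def)
  have "(SUP n\<in>S. enat n) \<le> enat (Max S)" using fin by (intro SUP_least) simp
  then have "d \<le> Max S" by (simp add: assms(1))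
  moreover have "Max S \<in> S" using fin ne by (rule Max_in)
  ultimately show "d \<in> S" using le[of "Max S"] by simp
qed

lemma (in noeth_local) prime_chain_bot_iff:
  "prime_chain bot n \<longleftrightarrow> (\<exists>P :: nat \<Rightarrow> 'a set. (\<forall>i\<le>n. prime_ideal (P i)) \<and> (\<forall>i<n. P i \<subset> P (Suc i)))"
proof
  assume "\<exists>P :: nat \<Rightarrow> 'a set. (\<forall>i\<le>n. prime_ideal (P i)) \<and> (\<forall>i<n. P i \<subset> P (Suc i))"
  then obtain P :: "nat \<Rightarrow> 'a set" where P: "\<forall>i\<le>n. prime_ideal (P i)" "\<forall>i<n. P i \<subset> P (Suc i)"
    by (elim exE conjE)
  then have id: "is_ideal (P i)" if "i \<le> n" for i using that by (simp add: prime_ideal_def)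
  have "prime_id (Ideal (P i))" if "i \<le> n" for i
    using P(1) that by (simp add: prime_id_iff id[OF that])
  moreover have "Ideal (P i) < Ideal (P (Suc i))" if "i < n" for i
    using P(2) that id[of i] id[of "Suc i"] by (simp add: less_ideal_def)
  ultimately show "prime_chain bot n" unfolding prime_chain_def
    by (intro exI[of _ "\<lambda>i. Ideal (P i)"] conjI allI impI bot_least)
next
  assume "prime_chain bot n"
  then obtain P :: "nat \<Rightarrow> 'a ideal" where P: "\<forall>i\<le>n. prime_id (P i)" "\<forall>i<n. P i < P (Suc i)"
    unfolding prime_chain_def by (elim exE conjE)
  then show "\<exists>P :: nat \<Rightarrow> 'a set. (\<forall>i\<le>n. prime_ideal (P i)) \<and> (\<forall>i<n. P i \<subset> P (Suc i))"
    by (intro exI[of _ "\<lambda>i. set_of (P i)"]) (simp add: prime_id_iff less_ideal_def)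
qed

lemma (in noeth_local) krull_dim_eq:
  "krull_dim TYPE('a) = (SUP n\<in>{n. prime_chain bot n}. enat n)"
  unfolding krull_dim_def prime_chain_bot_iff ..

theorem corollary4p2:
  fixes m :: "'a::comm_ring_1 set" and d r :: nat and I :: "nat \<Rightarrow> 'a set"
  assumes "noetherian_local_ring m"
    and "krull_dim TYPE('a) = enat d" and "d > 0"
    and "r \<ge> 2"
    and "\<And>i. i \<in> {1..r} \<Longrightarrow> primary_ideal_of m (I i)"
    and "\<And>i. i \<in> {1..r-1} \<Longrightarrow> I i \<subseteq> I r"
  shows "br_mult_assoc (r - 2) r (cyclic_sum r I) =
           br_mult 2 (cyclic_sum 2 (\<lambda>i. if i = 1 then ideal_gen (\<Union>j\<in>{1..r-1}. I j) else I r))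
         \<and> ((\<forall>i\<in>{1..r-1}. I i \<subseteq> I (i + 1)) \<longrightarrow>
           br_mult_assoc (r - 2) r (cyclic_sum r I) =
             br_mult 2 (cyclic_sum 2 (\<lambda>i. if i = 1 then I (r - 1) else I r)))"
proof -
  have max: "maximal_ideal m" and uniq: "\<And>m'. maximal_ideal m' \<Longrightarrow> m' = m"
    using assms(1) unfolding noetherian_local_ring_def by blast+
  interpret noetherian "TYPE('a)"
    by unfold_locales (use assms(1) in \<open>unfold noetherian_local_ring_def, blast\<close>)
  define mm where "mm = Ideal m"
  have set_mm: "set_of mm = m" using max by (simp add: mm_def maximal_ideal_def)
  have loc: "noeth_local mm"
  proof
    show "mm \<noteq> top" using max set_mm set_of_top by (metis maximal_ideal_def)
    fix J :: "'a ideal" assume "J \<noteq> top"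
    then obtain K where "J \<le> K" "maximal_ideal (set_of K)" using exists_maximal by blast
    moreover from this have "K = mm" using uniq[of "set_of K"] set_mm set_of_inject[of K mm] by simp
    ultimately show "J \<le> mm" by simp
  qed
  interpret noeth_local "TYPE('a)" mm by (rule loc)
  define I' where "I' i = Ideal (I i)" for i
  have prim: "is_ideal (I i)" "I i \<noteq> UNIV" "radical (I i) = m" if "i \<in> {1..r}" for i
    using assms(5)[OF that] by (simp_all add: primary_ideal_of_def)
  have setI: "set_of (I' i) = I i" if "i \<in> {1..r}" for i
    using prim[OF that] by (simp add: I'_def)
  have "\<forall>i. \<exists>c. i \<in> {1..r} \<longrightarrow> mm ^ c \<le> I' i"
  proof
    fix i
    show "\<exists>c. i \<in> {1..r} \<longrightarrow> mm ^ c \<le> I' i"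
    proof (cases "i \<in> {1..r}")
      case True
      have "\<exists>n. x ^ n \<in> set_of (I' i)" if "x \<in> set_of mm" for x
        using prim(3)[OF True] that by (auto simp: setI[OF True] set_mm radical_def)
      then show ?thesis using power_le_of_radical by blast
    qed blast
  qed
  from choice[OF this] obtain cc where cc: "\<forall>i. i \<in> {1..r} \<longrightarrow> mm ^ cc i \<le> I' i" by (rule exE)
  \<comment> \<open>A common exponent for all the ideals, as the sum bounds each
    \<open>cc i\<close>.\<close>
  define c where "c = (\<Sum>i\<in>{1..r}. cc i)"
  interpret br_setting "TYPE('a)" mm I' c r d
  proof unfold_locales
    show "2 \<le> r" "0 < d" by fact+
    show "mm ^ c \<le> I' i" if i: "i \<in> {1..r}" for i
    proof -
      have "cc i \<le> c" unfolding c_def using i by (intro member_le_sum) auto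
      then have "mm ^ c \<le> mm ^ cc i" by (rule ideal_power_antimono)
      also have "\<dots> \<le> I' i" using cc i by blast
      finally show ?thesis .
    qed
    show "I' i \<le> mm" if "i \<in> {1..r}" for i
    proof (rule le_m)
      show "I' i \<noteq> top"
      proof
        assume "I' i = top"
        then have "set_of (I' i) = UNIV" by simp
        with prim(2)[OF that] show False unfolding setI[OF that] by contradiction
      qed
    qed
    show "I' i \<le> I' r" if "i \<in> {1..r - 1}" for i
    proof -
      have "i \<in> {1..r}" "r \<in> {1..r}" using that assms(4) by auto
      then show ?thesis using assms(6)[OF that] by (simp only: less_eq_ideal_def setI)
    qed
    \<comment> \<open>The dimension is a finite positive supremum, hence attained by a chain of
      primes.\<close>
    note SUP_enat_attained[OF assms(2)[unfolded krull_dim_eq] assms(3)]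
    then show "prime_chain bot n \<Longrightarrow> n \<le> d" "prime_chain bot d" for n by simp_all
  qed
  let ?J = "ideal_gen (\<Union>j\<in>{1..r-1}. I j)"
  have "set_of JJ = ?J"
  proof -
    have "JJ = spn (\<Union>j\<in>{1..r-1}. set_of (I' j))" by (simp add: JJ_def Sup_ideal_def)
    also have "(\<Union>j\<in>{1..r-1}. set_of (I' j)) = (\<Union>j\<in>{1..r-1}. I j)" by (intro SUP_cong) (auto simp: setI)
    finally show ?thesis by (simp add: set_of_spn)
  qed
  moreover have "set_of (I' r) = I r" using assms(4) by (intro setI) simp
  ultimately have R: "(\<lambda>i. set_of ((if i = 1 then JJ else I' r) :: 'a ideal)) = (\<lambda>i :: nat. if i = 1 then ?J else I r)"
    by (intro ext) simp
  have L: "cyclic_sum r (\<lambda>i. set_of (I' i)) = cyclic_sum r I"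
    by (rule cyclic_sum_cong) (rule setI)
  have main: "br_mult_assoc (r - 2) r (cyclic_sum r I) = br_mult 2 (cyclic_sum 2 (\<lambda>i. if i = 1 then ?J else I r))"
    using br_mult_eq[OF assms(2)] unfolding R L .
  \<comment> \<open>For increasing ideals the union of the first \<open>r - 1\<close> is the last of
    them, which is already an ideal.\<close>
  have "?J = I (r - 1)" if inc: "\<forall>i\<in>{1..r-1}. I i \<subseteq> I (i + 1)"
  proof -
    have "I j \<subseteq> I (r - 1)" if "1 \<le> j" "j \<le> r - 1" for j
      using that(2,1)
    proof (induction rule: inc_induct)
      case (step n)
      then have "n \<in> {1..r-1}" by simp
      with inc have "I n \<subseteq> I (Suc n)" by (metis Suc_eq_plus1)
      also have "\<dots> \<subseteq> I (r - 1)" using step by simp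
      finally show ?case .
    qed simp
    then have "(\<Union>j\<in>{1..r-1}. I j) = I (r - 1)" using assms(4) by (intro antisym UN_least UN_upper) auto
    moreover have "is_ideal (I (r - 1))" using assms(4) by (intro prim) auto
    ultimately show ?thesis by (simp only: self_module.span_eq_iff[THEN iffD2])
  qed
  then have "(\<forall>i\<in>{1..r-1}. I i \<subseteq> I (i + 1)) \<longrightarrow>
      br_mult_assoc (r - 2) r (cyclic_sum r I) = br_mult 2 (cyclic_sum 2 (\<lambda>i. if i = 1 then I (r - 1) else I r))"
    using main by (intro impI) (simp only:)
  with main show ?thesis by (rule conjI)
qed

end
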